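(* Let $S$ be a continuous ($\mathbb{R}^d$-valued, locally square-integrable semimartingale) price process on $[0,T]$. The following are equivalent. (i) $S$ satisfies the law of one price. (ii) $S$ admits an equivalent local martingale measure with square-integrable density. (iii) The variance-optimal (signed) local martingale measure for $S$ exists and is positive. (iv) There is no "$L^2$ free lunch", i.e., $\operatorname{cl}\big(\{\vartheta\cdot S_T:\vartheta\in\Theta\}-L^2_+\big)\cap L^2_+=\{0\}$. (v) There is no arbitrage on the $L^2$ closure of simple strategies, i.e., $\operatorname{cl}\{\vartheta\cdot S_T:\vartheta\in\Theta\}\cap L^2_+=\{0\}$.
   Context: **Setting.** Fix $T>0$ and a filtered probability space $(\Omega,\mathcal{F},(\mathcal{F}_t)_{0\le t\le T},P)$ with $\mathcal{F}_T=\mathcal{F}$ satisfying the usual conditions. $L^p$ means $L^p(\mathcal{F}_T,P)$; $L^2_+$ is the set of non-negative elements of $L^2$; $\operatorname{cl}$ is the closure in $L^2$; $L^0$ carries convergence in probability; $\mathcal{T}$ is the set of $[0,T]$-valued stopping times. A sequence of stopping times $\sigma_n$ converges stationarily to $T$ if $P(\sigma_n<T)\to0$; on $[0,T]$, localizing sequences are increasing sequences of stopping times converging stationarily to $T$. $\vartheta\cdot S_t=\int_{(0,t]}\vartheta_u\,dS_u$; $S^*$ is the running supremum of $|S|$. $S$ locally square integrable: there exist localizing sequences $(\tau_n)$ with $S^*_{\tau_n}\in L^2$. The market consists of a riskless asset with constant value $1$ and the $d$ risky assets $S$. **Simple strategies.** $\Theta$ is the set of $\vartheta=\sum_{i=1}^{m-1}\xi_i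 1_{]\!]\sigma_i,\sigma_{i+1}]\!]}$ with stopping times $0\le\sigma_1\le\dots\le\sigma_m\le\tau_n$ for some $n$ and some localizing sequence $(\tau_n)$ converging stationarily to $T$ with $S^*_{\tau_n}\in L^2$, and bounded $\mathbb{R}^d$-valued $\mathcal{F}_{\sigma_i}$-measurable $\xi_i$. **Law of one price for $S$.** (1) For all $\tau\in\mathcal{T}$, all $\mathcal{F}_\tau$-measurable $x_\tau$ and all sequences $(\vartheta^n)$ in $\Theta$ with $x_\tau+(\vartheta^n1_{]\!]\tau,T]\!]})\cdot S_T\to0$ in $L^2$, we have $x_\tau=0$. (2) For every predictable $\sigma\in\mathcal{T}$, any announcing sequence $(\sigma_n)$ for $\sigma$, all sequences of $\mathcal{F}_{\sigma_n}$-measurable $x^n_{\sigma_n}$ and $\vartheta^n\in\Theta$ such that $x^n_{\sigma_n}+(\vartheta^n1_{]\!]\sigma_n,T]\!]})\cdot S_T\to0$ in $L^2$ and $x^n_{\sigma_n}\to x_{\sigma-}$ in $L^0$ for some random variable $x_{\sigma-}$, we have $x_{\sigma-}=0$. **Local martingale measures.** An equivalent local martingale measure with square-integrable density is a probability measure $Q\sim P$ with $dQ/dP\in L^2$ under which $S$ is a local martingale. A signed local martingale measure with square-integrable density is a signed measure $Q\ll P$ with $Q(\Omega)=1$, $dQ/dP\in L^2$ and $E[\frac{dQ}{dP}\,(\vartheta\cdot S_T)]=0$ for all $\vartheta\in\Theta$. The variance-optimal one is the one whose density has the smallest variance (equivalently, smallest $L^2$ norm) among all of these; it is positive if $dQ/dP>0$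 $P$-a.s. *)

theory Defs
  imports "HOL-Probability.Probability"
begin

section \<open>Filtered probability spaces on a finite horizon\<close>

text \<open>
  A filtration on \<open>[0,T]\<close> is represented by a library filtration on the whole real line which is
  constant from \<open>T\<close> on.  What happens before time \<open>0\<close> is irrelevant: for a \<open>[0,T]\<close>-valued \<open>\<tau>\<close>,
  both \<^const>\<open>stopping_time\<close> and \<^const>\<open>filtration.pre_sigma\<close> depend on the \<open>\<sigma>\<close>-algebras
  at times in \<open>[0,T]\<close> only.
\<close>

locale usual_filtered_prob_space =
  prob_space M + filtration "space M" F
  for M :: "'a measure" and F :: "real \<Rightarrow> 'a measure" +
  fixes T :: real
  assumes horizon_pos: "0 < T"
    and sets_F_horizon: "\<And>t. T \<le> t \<Longrightarrow> sets (F t) = sets M"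
    and right_continuous: "\<And>t. 0 \<le> t \<Longrightarrow> t < T \<Longrightarrow> sets (F t) = (\<Inter>s\<in>{t<..T}. sets (F s))"
    and complete: "\<And>A N. N \<in> null_sets M \<Longrightarrow> A \<subseteq> N \<Longrightarrow> A \<in> sets (F 0)"

definition stopping_times :: "'a measure \<Rightarrow> (real \<Rightarrow> 'a measure) \<Rightarrow> real \<Rightarrow> ('a \<Rightarrow> real) set" where
  "stopping_times M F T = {\<tau>. stopping_time F \<tau> \<and> (\<forall>\<omega>\<in>space M. 0 \<le> \<tau> \<omega> \<and> \<tau> \<omega> \<le> T)}"

abbreviation stopped_algebra ::
    "'a measure \<Rightarrow> (real \<Rightarrow> 'a measure) \<Rightarrow> ('a \<Rightarrow> real) \<Rightarrow> 'a measure" where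
  "stopped_algebra M F \<tau> \<equiv> filtration.pre_sigma (space M) F \<tau>"

definition localizing_sequence ::
    "'a measure \<Rightarrow> (real \<Rightarrow> 'a measure) \<Rightarrow> real \<Rightarrow> (nat \<Rightarrow> 'a \<Rightarrow> real) \<Rightarrow> bool" where
  "localizing_sequence M F T \<tau> \<longleftrightarrow>
     (\<forall>n. \<tau> n \<in> stopping_times M F T) \<and>
     (\<forall>n. \<forall>\<omega>\<in>space M. \<tau> n \<omega> \<le> \<tau> (Suc n) \<omega>) \<and>
     (\<lambda>n. measure M {\<omega>\<in>space M. \<tau> n \<omega> < T}) \<longlonglongrightarrow> 0"

definition announcing_sequence ::
    "'a measure \<Rightarrow> (real \<Rightarrow> 'a measure) \<Rightarrow> real \<Rightarrow> ('a \<Rightarrow> real) \<Rightarrow> (nat \<Rightarrow> 'a \<Rightarrow> real) \<Rightarrow> bool" where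
  "announcing_sequence M F T \<sigma> \<sigma>s \<longleftrightarrow>
     (\<forall>n. \<sigma>s n \<in> stopping_times M F T) \<and>
     (\<forall>\<omega>\<in>space M. (\<forall>n. \<sigma>s n \<omega> \<le> \<sigma>s (Suc n) \<omega>) \<and> (\<lambda>n. \<sigma>s n \<omega>) \<longlonglongrightarrow> \<sigma> \<omega> \<and>
        (0 < \<sigma> \<omega> \<longrightarrow> (\<forall>n. \<sigma>s n \<omega> < \<sigma> \<omega>)))"

definition predictable_times ::
    "'a measure \<Rightarrow> (real \<Rightarrow> 'a measure) \<Rightarrow> real \<Rightarrow> ('a \<Rightarrow> real) set" where
  "predictable_times M F T =
     {\<sigma> \<in> stopping_times M F T. \<exists>\<sigma>s. announcing_sequence M F T \<sigma> \<sigma>s}"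


section \<open>Square-integrable random variables\<close>

text \<open>
  Random variables are functions rather than equivalence classes; accordingly the set \<open>{0}\<close>
  of the single zero element of \<open>L\<^sup>2\<close> becomes the set \<open>L2_zero\<close> of all its representatives.
\<close>

definition L2 :: "'a measure \<Rightarrow> ('a \<Rightarrow> real) set" where
  "L2 M = {f \<in> borel_measurable M. integrable M (\<lambda>\<omega>. (f \<omega>)\<^sup>2)}"

definition L2_plus :: "'a measure \<Rightarrow> ('a \<Rightarrow> real) set" where
  "L2_plus M = {f \<in> L2 M. AE \<omega> in M. 0 \<le> f \<omega>}"

definition L2_zero :: "'a measure \<Rightarrow> ('a \<Rightarrow> real) set" where
  "L2_zero M = {f \<in> L2 M. AE \<omega> in M. f \<omega> = 0}"

definition L2_norm :: "'a measure \<Rightarrow> ('a \<Rightarrow> real) \<Rightarrow> real" where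
  "L2_norm M f = sqrt (\<integral>\<omega>. (f \<omega>)\<^sup>2 \<partial>M)"

definition L2_tendsto :: "'a measure \<Rightarrow> (nat \<Rightarrow> 'a \<Rightarrow> real) \<Rightarrow> ('a \<Rightarrow> real) \<Rightarrow> bool" where
  "L2_tendsto M X Y \<longleftrightarrow>
     (\<forall>n. X n \<in> L2 M) \<and> Y \<in> L2 M \<and> (\<lambda>n. L2_norm M (\<lambda>\<omega>. X n \<omega> - Y \<omega>)) \<longlonglongrightarrow> 0"

definition L2_closure :: "'a measure \<Rightarrow> ('a \<Rightarrow> real) set \<Rightarrow> ('a \<Rightarrow> real) set" where
  "L2_closure M A =
     {f \<in> L2 M. \<forall>\<epsilon>>0. \<exists>g\<in>A \<inter> L2 M. L2_norm M (\<lambda>\<omega>. f \<omega> - g \<omega>) < \<epsilon>}"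

definition tendsto_in_probability ::
    "'a measure \<Rightarrow> (nat \<Rightarrow> 'a \<Rightarrow> real) \<Rightarrow> ('a \<Rightarrow> real) \<Rightarrow> bool" where
  "tendsto_in_probability M X Y \<longleftrightarrow>
     (\<forall>n. X n \<in> borel_measurable M) \<and> Y \<in> borel_measurable M \<and>
     (\<forall>\<epsilon>>0. (\<lambda>n. measure M {\<omega>\<in>space M. \<bar>X n \<omega> - Y \<omega>\<bar> > \<epsilon>}) \<longlonglongrightarrow> 0)"


section \<open>Semimartingales\<close>

definition adapted ::
    "(real \<Rightarrow> 'a measure) \<Rightarrow> real \<Rightarrow> (real \<Rightarrow> 'a \<Rightarrow> real ^ 'd) \<Rightarrow> bool" where
  "adapted F T X \<longleftrightarrow> (\<forall>t\<in>{0..T}. X t \<in> borel_measurable (F t))"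

definition cadlag_paths ::
    "'a measure \<Rightarrow> real \<Rightarrow> (real \<Rightarrow> 'a \<Rightarrow> real ^ 'd) \<Rightarrow> bool" where
  "cadlag_paths M T X \<longleftrightarrow> (\<forall>\<omega>\<in>space M.
     (\<forall>t\<in>{0..<T}. ((\<lambda>u. X u \<omega>) \<longlongrightarrow> X t \<omega>) (at_right t)) \<and>
     (\<forall>t\<in>{0<..T}. \<exists>l. ((\<lambda>u. X u \<omega>) \<longlongrightarrow> l) (at_left t)))"

definition continuous_paths ::
    "'a measure \<Rightarrow> real \<Rightarrow> (real \<Rightarrow> 'a \<Rightarrow> real ^ 'd) \<Rightarrow> bool" where
  "continuous_paths M T X \<longleftrightarrow> (\<forall>\<omega>\<in>space M. continuous_on {0..T} (\<lambda>t. X t \<omega>))"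

definition finite_variation_paths ::
    "'a measure \<Rightarrow> real \<Rightarrow> (real \<Rightarrow> 'a \<Rightarrow> real ^ 'd) \<Rightarrow> bool" where
  "finite_variation_paths M T X \<longleftrightarrow> (\<forall>\<omega>\<in>space M. \<exists>B. \<forall>n p.
     mono_on {..n} p \<and> p ` {..n} \<subseteq> {0..T} \<longrightarrow>
       (\<Sum>i<n. norm (X (p (Suc i)) \<omega> - X (p i) \<omega>)) \<le> B)"

definition stopped_process ::
    "('a \<Rightarrow> real) \<Rightarrow> (real \<Rightarrow> 'a \<Rightarrow> real ^ 'd) \<Rightarrow> real \<Rightarrow> 'a \<Rightarrow> real ^ 'd" where
  "stopped_process \<tau> X t \<omega> = X (min t (\<tau> \<omega>)) \<omega>"

definition martingale ::
    "'a measure \<Rightarrow> (real \<Rightarrow> 'a measure) \<Rightarrow> real \<Rightarrow> (real \<Rightarrow> 'a \<Rightarrow> real ^ 'd) \<Rightarrow> bool" where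
  "martingale M F T X \<longleftrightarrow>
     adapted F T X \<and> cadlag_paths M T X \<and>
     (\<forall>t\<in>{0..T}. integrable M (X t)) \<and>
     (\<forall>s\<in>{0..T}. \<forall>t\<in>{s..T}. \<forall>i.
        AE \<omega> in M. real_cond_exp M (F s) (\<lambda>\<omega>. X t \<omega> $ i) \<omega> = X s \<omega> $ i)"

definition local_martingale ::
    "'a measure \<Rightarrow> (real \<Rightarrow> 'a measure) \<Rightarrow> real \<Rightarrow> (real \<Rightarrow> 'a \<Rightarrow> real ^ 'd) \<Rightarrow> bool" where
  "local_martingale M F T X \<longleftrightarrow>
     adapted F T X \<and> cadlag_paths M T X \<and>
     (\<exists>\<tau>. localizing_sequence M F T \<tau> \<and> (\<forall>n. martingale M F T (stopped_process (\<tau> n) X)))"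

definition semimartingale ::
    "'a measure \<Rightarrow> (real \<Rightarrow> 'a measure) \<Rightarrow> real \<Rightarrow> (real \<Rightarrow> 'a \<Rightarrow> real ^ 'd) \<Rightarrow> bool" where
  "semimartingale M F T X \<longleftrightarrow>
     X 0 \<in> borel_measurable (F 0) \<and>
     (\<exists>N A. local_martingale M F T N \<and>
        adapted F T A \<and> cadlag_paths M T A \<and> finite_variation_paths M T A \<and>
        (\<forall>\<omega>\<in>space M. N 0 \<omega> = 0 \<and> A 0 \<omega> = 0 \<and>
           (\<forall>t\<in>{0..T}. X t \<omega> = X 0 \<omega> + N t \<omega> + A t \<omega>)))"

definition running_sup :: "(real \<Rightarrow> 'a \<Rightarrow> real ^ 'd) \<Rightarrow> ('a \<Rightarrow> real) \<Rightarrow> 'a \<Rightarrow> real" where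
  "running_sup X \<tau> \<omega> = (SUP t\<in>{0..\<tau> \<omega>}. norm (X t \<omega>))"

definition square_localizing ::
    "'a measure \<Rightarrow> (real \<Rightarrow> 'a measure) \<Rightarrow> real \<Rightarrow> (real \<Rightarrow> 'a \<Rightarrow> real ^ 'd) \<Rightarrow>
     (nat \<Rightarrow> 'a \<Rightarrow> real) \<Rightarrow> bool" where
  "square_localizing M F T X \<tau> \<longleftrightarrow>
     localizing_sequence M F T \<tau> \<and> (\<forall>n. running_sup X (\<tau> n) \<in> L2 M)"

definition locally_square_integrable ::
    "'a measure \<Rightarrow> (real \<Rightarrow> 'a measure) \<Rightarrow> real \<Rightarrow> (real \<Rightarrow> 'a \<Rightarrow> real ^ 'd) \<Rightarrow> bool" where
  "locally_square_integrable M F T X \<longleftrightarrow> (\<exists>\<tau>. square_localizing M F T X \<tau>)"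


section \<open>Simple strategies and their gains\<close>

definition simple_strategies ::
    "'a measure \<Rightarrow> (real \<Rightarrow> 'a measure) \<Rightarrow> real \<Rightarrow> (real \<Rightarrow> 'a \<Rightarrow> real ^ 'd) \<Rightarrow>
     (real \<Rightarrow> 'a \<Rightarrow> real ^ 'd) set" where
  "simple_strategies M F T S = {\<theta>. \<exists>m \<sigma> \<xi> \<tau> n.
     1 \<le> m \<and>
     \<theta> = (\<lambda>t \<omega>. \<Sum>i = 1..<m. indicator {\<sigma> i \<omega><..\<sigma> (Suc i) \<omega>} t *\<^sub>R \<xi> i \<omega>) \<and>
     (\<forall>i\<in>{1..m}. \<sigma> i \<in> stopping_times M F T) \<and>
     (\<forall>i\<in>{1..<m}. \<forall>\<omega>\<in>space M. \<sigma> i \<omega> \<le> \<sigma> (Suc i) \<omega>) \<and>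
     square_localizing M F T S \<tau> \<and> (\<forall>\<omega>\<in>space M. \<sigma> m \<omega> \<le> \<tau> n \<omega>) \<and>
     (\<forall>i\<in>{1..<m}. \<xi> i \<in> borel_measurable (stopped_algebra M F (\<sigma> i)) \<and>
        (\<exists>C. \<forall>\<omega>\<in>space M. norm (\<xi> i \<omega>) \<le> C))}"

text \<open>
  The integral \<open>\<integral>\<^bsub>(0,t]\<^esub> h dx\<close> of a left-continuous step function \<open>h\<close> against an arbitrary path \<open>x\<close>.
  It is the limit, along finite \<open>D \<subseteq> (0,t]\<close> ordered by inclusion, of the sums
  \<open>\<Sum> h(v) \<bullet> (x(v) - x(u))\<close> over consecutive points \<open>u < v\<close> of \<open>{0} \<union> D\<close>.
  As \<open>h\<close> is constant on each \<open>(u,v]\<close> once \<open>D\<close> contains the jump times, these sums are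
  eventually constant.  The definition makes the integral a function of the integrand,
  independently of how the latter is written as a sum; see \<open>path_integral_step\<close>
  and \<open>gains_start_after\<close> below.  It is not meant for integrands that are not of this form.
\<close>

definition path_integral ::
    "(real \<Rightarrow> real ^ 'd) \<Rightarrow> (real \<Rightarrow> real ^ 'd) \<Rightarrow> real \<Rightarrow> real" where
  "path_integral h x t =
     Lim (finite_subsets_at_top {0<..t})
       (\<lambda>D. \<Sum>v\<in>D. h v \<bullet> (x v - x (Max (insert 0 {u\<in>D. u < v}))))"

definition gains ::
    "(real \<Rightarrow> 'a \<Rightarrow> real ^ 'd) \<Rightarrow> (real \<Rightarrow> 'a \<Rightarrow> real ^ 'd) \<Rightarrow> real \<Rightarrow> 'a \<Rightarrow> real" where
  "gains \<theta> S t \<omega> = path_integral (\<lambda>u. \<theta> u \<omega>) (\<lambda>u. S u \<omega>) t"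

definition start_after ::
    "('a \<Rightarrow> real) \<Rightarrow> real \<Rightarrow> (real \<Rightarrow> 'a \<Rightarrow> real ^ 'd) \<Rightarrow> real \<Rightarrow> 'a \<Rightarrow> real ^ 'd" where
  "start_after \<tau> T \<theta> t \<omega> = indicator {\<tau> \<omega><..T} t *\<^sub>R \<theta> t \<omega>"

lemma telescope_partition:
  fixes x :: "real \<Rightarrow> 'v::real_vector"
  assumes "finite D" "D \<subseteq> {0<..}" "b \<in> insert 0 D"
  shows "(\<Sum>v | v \<in> D \<and> v \<le> b. x v - x (Max (insert 0 {u\<in>D. u < v}))) = x b - x 0"
  using assms
proof (induction D arbitrary: b rule: finite_linorder_max_induct)
  case empty
  then show ?case by simp
next
  case (insert d D)
  have D: "D \<subseteq> {0<..}" and d: "0 < d" using insert.prems by auto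
  have below: "{u \<in> insert d D. u < v} = {u \<in> D. u < v}" if "v \<in> D" for v
    using insert.hyps(2) that by force
  show ?case
  proof (cases "b = d")
    case True
    let ?m = "Max (insert 0 D)"
    have m: "?m \<in> insert 0 D" using insert.hyps(1) by (intro Max_in) auto
    have all: "{v. v \<in> D \<and> v \<le> ?m} = D" using insert.hyps(1) by auto
    have IH: "(\<Sum>v\<in>D. x v - x (Max (insert 0 {u\<in>D. u < v}))) = x ?m - x 0"
      using insert.IH[OF D m] unfolding all .
    have split: "{v. v \<in> insert d D \<and> v \<le> b} = insert d D" "d \<notin> D"
      "{u \<in> insert d D. u < d} = D"
      using insert.hyps(2) True by (auto intro: less_imp_le)
    show ?thesis
      unfolding split(1) using split(2,3) insert.hyps(1) IH True below by (simp cong: sum.cong)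
  next
    case False
    then have b: "b \<in> insert 0 D" using insert.prems by auto
    then have "b < d" using insert.hyps(2) d by auto
    then have set: "{v. v \<in> insert d D \<and> v \<le> b} = {v. v \<in> D \<and> v \<le> b}" by auto
    show ?thesis
      unfolding set insert.IH[OF D b, symmetric] by (intro sum.cong refl) (use below in force)
  qed
qed

lemma path_integral_step:
  fixes a b :: "'i \<Rightarrow> real" and c :: "'i \<Rightarrow> real ^ 'd"
  assumes fin: "finite I" and ab: "\<And>i. i \<in> I \<Longrightarrow> 0 \<le> a i \<and> a i \<le> b i" and t: "0 \<le> t"
  shows "path_integral (\<lambda>u. \<Sum>i\<in>I. indicator {a i<..b i} u *\<^sub>R c i) x t =
    (\<Sum>i\<in>I. c i \<bullet> (x (min (b i) t) - x (min (a i) t)))"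
    (is "path_integral ?h x t = ?R")
proof -
  define P where "P = (\<Union>i\<in>I. {min (a i) t, min (b i) t}) \<inter> {0<..t}"
  have P: "finite P" "P \<subseteq> {0<..t}" using fin by (auto simp: P_def)
  have eq: "(\<Sum>v\<in>D. ?h v \<bullet> (x v - x (Max (insert 0 {u\<in>D. u < v})))) = ?R"
    if D: "finite D" "P \<subseteq> D" "D \<subseteq> {0<..t}" for D
  proof -
    let ?d = "\<lambda>v. x v - x (Max (insert 0 {u\<in>D. u < v}))"
    have one: "(\<Sum>v\<in>D. indicator {a i<..b i} v *\<^sub>R ?d v) = x (min (b i) t) - x (min (a i) t)"
      if i: "i \<in> I" for i
    proof -
      have mem: "min (a i) t \<in> insert 0 D" "min (b i) t \<in> insert 0 D"
        using ab[OF i] t D(2) i by (auto simp: P_def less_le)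
      have pos: "D \<subseteq> {0<..}" using D(3) by auto
      have "(\<Sum>v\<in>D. indicator {a i<..b i} v *\<^sub>R ?d v) =
          (\<Sum>v | v \<in> D \<and> a i < v \<and> v \<le> b i. ?d v)"
        using D(1) by (intro sum.mono_neutral_cong_right) (auto simp: indicator_def)
      also have "{v. v \<in> D \<and> a i < v \<and> v \<le> b i} =
          {v. v \<in> D \<and> v \<le> min (b i) t} - {v. v \<in> D \<and> v \<le> min (a i) t}"
        using D(3) by auto
      also have "(\<Sum>v\<in>\<dots>. ?d v) = (\<Sum>v | v \<in> D \<and> v \<le> min (b i) t. ?d v) -
          (\<Sum>v | v \<in> D \<and> v \<le> min (a i) t. ?d v)"
        using D(1) ab[OF i] by (intro sum_diff) auto
      also have "\<dots> = x (min (b i) t) - x (min (a i) t)"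
        using telescope_partition[OF D(1) pos mem(1), of x]
          telescope_partition[OF D(1) pos mem(2), of x] by simp
      finally show ?thesis .
    qed
    have "(\<Sum>v\<in>D. ?h v \<bullet> ?d v) = (\<Sum>v\<in>D. \<Sum>i\<in>I. c i \<bullet> (indicator {a i<..b i} v *\<^sub>R ?d v))"
      by (simp add: inner_sum_left)
    also have "\<dots> = (\<Sum>i\<in>I. c i \<bullet> (\<Sum>v\<in>D. indicator {a i<..b i} v *\<^sub>R ?d v))"
      by (subst sum.swap) (simp only: inner_sum_right)
    also have "\<dots> = ?R" using one by simp
    finally show ?thesis .
  qed
  show ?thesis unfolding path_integral_def
  proof (rule tendsto_Lim)
    show "finite_subsets_at_top {0<..t} \<noteq> bot" by simp
    show "((\<lambda>D. \<Sum>v\<in>D. ?h v \<bullet> (x v - x (Max (insert 0 {u\<in>D. u < v})))) \<longlongrightarrow> ?R)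
        (finite_subsets_at_top {0<..t})"
      using P eq by (intro tendsto_eventually) (auto simp: eventually_finite_subsets_at_top)
  qed
qed

lemma gains_start_after:
  fixes \<sigma> :: "nat \<Rightarrow> 'a \<Rightarrow> real" and \<xi> :: "nat \<Rightarrow> 'a \<Rightarrow> real ^ 'd"
  assumes "\<And>i. i \<in> {1..<m} \<Longrightarrow> 0 \<le> \<sigma> i \<omega> \<and> \<sigma> i \<omega> \<le> \<sigma> (Suc i) \<omega> \<and> \<sigma> (Suc i) \<omega> \<le> T"
    and "0 \<le> \<tau> \<omega>" "\<tau> \<omega> \<le> T"
    and "\<theta> = (\<lambda>t \<omega>. \<Sum>i = 1..<m. indicator {\<sigma> i \<omega><..\<sigma> (Suc i) \<omega>} t *\<^sub>R \<xi> i \<omega>)"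
  shows "gains (start_after \<tau> T \<theta>) S T \<omega> =
    (\<Sum>i = 1..<m. \<xi> i \<omega> \<bullet> (S (max (\<tau> \<omega>) (\<sigma> (Suc i) \<omega>)) \<omega> - S (max (\<tau> \<omega>) (\<sigma> i \<omega>)) \<omega>))"
proof -
  have "(\<lambda>u. start_after \<tau> T \<theta> u \<omega>) = (\<lambda>u. \<Sum>i = 1..<m.
      indicator {max (\<tau> \<omega>) (\<sigma> i \<omega>)<..max (\<tau> \<omega>) (\<sigma> (Suc i) \<omega>)} u *\<^sub>R \<xi> i \<omega>)"
    unfolding start_after_def assms(4) scaleR_sum_right scaleR_scaleR
    by (intro ext sum.cong refl arg_cong2[where f=scaleR])
      (use assms(1) in \<open>force simp: indicator_def max_def split: if_splits\<close>)
  then have "gains (start_after \<tau> T \<theta>) S T \<omega> =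
    (\<Sum>i = 1..<m. \<xi> i \<omega> \<bullet> (S (min (max (\<tau> \<omega>) (\<sigma> (Suc i) \<omega>)) T) \<omega> -
      S (min (max (\<tau> \<omega>) (\<sigma> i \<omega>)) T) \<omega>))"
    unfolding gains_def using assms(1-3)
    by (simp only:, intro path_integral_step) (auto simp: max_def intro: order_trans)
  also have "\<dots> = (\<Sum>i = 1..<m. \<xi> i \<omega> \<bullet> (S (max (\<tau> \<omega>) (\<sigma> (Suc i) \<omega>)) \<omega> -
      S (max (\<tau> \<omega>) (\<sigma> i \<omega>)) \<omega>))"
    by (intro sum.cong refl) (use assms(1-3) in \<open>force simp: min_absorb1\<close>)
  finally show ?thesis .
qed


section \<open>Law of one price, martingale measures and free lunches\<close>

definition law_of_one_price ::
    "'a measure \<Rightarrow> (real \<Rightarrow> 'a measure) \<Rightarrow> real \<Rightarrow> (real \<Rightarrow> 'a \<Rightarrow> real ^ 'd) \<Rightarrow> bool" where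
  "law_of_one_price M F T S \<longleftrightarrow>
     (\<forall>\<tau>\<in>stopping_times M F T. \<forall>x\<in>borel_measurable (stopped_algebra M F \<tau>). \<forall>\<theta>.
        (\<forall>n. \<theta> n \<in> simple_strategies M F T S) \<and>
        L2_tendsto M (\<lambda>n \<omega>. x \<omega> + gains (start_after \<tau> T (\<theta> n)) S T \<omega>) (\<lambda>\<omega>. 0) \<longrightarrow>
        (AE \<omega> in M. x \<omega> = 0)) \<and>
     (\<forall>\<sigma>\<in>predictable_times M F T. \<forall>\<sigma>s x \<theta> y.
        announcing_sequence M F T \<sigma> \<sigma>s \<and>
        (\<forall>n. x n \<in> borel_measurable (stopped_algebra M F (\<sigma>s n))) \<and>
        (\<forall>n. \<theta> n \<in> simple_strategies M F T S) \<and>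
        L2_tendsto M (\<lambda>n \<omega>. x n \<omega> + gains (start_after (\<sigma>s n) T (\<theta> n)) S T \<omega>) (\<lambda>\<omega>. 0) \<and>
        tendsto_in_probability M x y \<longrightarrow>
        (AE \<omega> in M. y \<omega> = 0))"

definition equivalent_lmm ::
    "'a measure \<Rightarrow> (real \<Rightarrow> 'a measure) \<Rightarrow> real \<Rightarrow> (real \<Rightarrow> 'a \<Rightarrow> real ^ 'd) \<Rightarrow>
     'a measure \<Rightarrow> bool" where
  "equivalent_lmm M F T S Q \<longleftrightarrow>
     prob_space Q \<and> sets Q = sets M \<and>
     absolutely_continuous M Q \<and> absolutely_continuous Q M \<and>
     (\<lambda>\<omega>. enn2real (RN_deriv M Q \<omega>)) \<in> L2 M \<and>
     local_martingale Q F T S"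

definition signed_measure :: "'a measure \<Rightarrow> ('a set \<Rightarrow> real) \<Rightarrow> bool" where
  "signed_measure M Q \<longleftrightarrow>
     Q {} = 0 \<and>
     (\<forall>A. range A \<subseteq> sets M \<and> disjoint_family A \<longrightarrow> (\<lambda>n. Q (A n)) sums Q (\<Union>n. A n))"

definition signed_density :: "'a measure \<Rightarrow> ('a set \<Rightarrow> real) \<Rightarrow> ('a \<Rightarrow> real) \<Rightarrow> bool" where
  "signed_density M Q Z \<longleftrightarrow>
     integrable M Z \<and> (\<forall>A\<in>sets M. Q A = set_lebesgue_integral M A Z)"

text \<open>In the next two definitions \<open>Z\<close> is a version of the density \<open>dQ/dP\<close>, \<open>P\<close> being \<open>M\<close>.\<close>

definition signed_lmm ::
    "'a measure \<Rightarrow> (real \<Rightarrow> 'a measure) \<Rightarrow> real \<Rightarrow> (real \<Rightarrow> 'a \<Rightarrow> real ^ 'd) \<Rightarrow>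
     ('a set \<Rightarrow> real) \<Rightarrow> ('a \<Rightarrow> real) \<Rightarrow> bool" where
  "signed_lmm M F T S Q Z \<longleftrightarrow>
     signed_measure M Q \<and> (\<forall>A\<in>null_sets M. Q A = 0) \<and> Q (space M) = 1 \<and>
     signed_density M Q Z \<and> Z \<in> L2 M \<and>
     (\<forall>\<theta>\<in>simple_strategies M F T S. (\<integral>\<omega>. Z \<omega> * gains \<theta> S T \<omega> \<partial>M) = 0)"

definition variance_optimal_lmm ::
    "'a measure \<Rightarrow> (real \<Rightarrow> 'a measure) \<Rightarrow> real \<Rightarrow> (real \<Rightarrow> 'a \<Rightarrow> real ^ 'd) \<Rightarrow>
     ('a set \<Rightarrow> real) \<Rightarrow> ('a \<Rightarrow> real) \<Rightarrow> bool" where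
  "variance_optimal_lmm M F T S Q Z \<longleftrightarrow>
     signed_lmm M F T S Q Z \<and>
     (\<forall>Q' Z'. signed_lmm M F T S Q' Z' \<longrightarrow>
        (\<integral>\<omega>. (Z \<omega> - (\<integral>\<omega>. Z \<omega> \<partial>M))\<^sup>2 \<partial>M) \<le> (\<integral>\<omega>. (Z' \<omega> - (\<integral>\<omega>. Z' \<omega> \<partial>M))\<^sup>2 \<partial>M))"

definition terminal_gains ::
    "'a measure \<Rightarrow> (real \<Rightarrow> 'a measure) \<Rightarrow> real \<Rightarrow> (real \<Rightarrow> 'a \<Rightarrow> real ^ 'd) \<Rightarrow>
     ('a \<Rightarrow> real) set" where
  "terminal_gains M F T S = (\<lambda>\<theta>. gains \<theta> S T) ` simple_strategies M F T S"

definition no_L2_free_lunch ::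
    "'a measure \<Rightarrow> (real \<Rightarrow> 'a measure) \<Rightarrow> real \<Rightarrow> (real \<Rightarrow> 'a \<Rightarrow> real ^ 'd) \<Rightarrow> bool" where
  "no_L2_free_lunch M F T S \<longleftrightarrow>
     L2_closure M {\<lambda>\<omega>. g \<omega> - f \<omega> | g f. g \<in> terminal_gains M F T S \<and> f \<in> L2_plus M}
       \<inter> L2_plus M = L2_zero M"

definition no_L2_closure_arbitrage ::
    "'a measure \<Rightarrow> (real \<Rightarrow> 'a measure) \<Rightarrow> real \<Rightarrow> (real \<Rightarrow> 'a \<Rightarrow> real ^ 'd) \<Rightarrow> bool" where
  "no_L2_closure_arbitrage M F T S \<longleftrightarrow>
     L2_closure M (terminal_gains M F T S) \<inter> L2_plus M = L2_zero M"

end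

(*
  Let X be the element of minimal norm in the closed affine space 1 + cl{gains}.  It is nonzero as
  soon as 1 is not a limit of gains, and then X / E[X^2] is the variance-optimal density.  Stopping
  the approximating wealth processes at their first zero does not increase the norm, by continuity
  of S, so X >= 0.

  To see X > 0, take wealth processes W_k of initial value 1 whose terminal values converge fast to
  X, and let sigma_k be the first time that W_k <= l_k, where l_k -> 0.  As
  E[X (W_k(T) - l_k); sigma_k < T] = 0, the L2 norm of X / l_k on {sigma_k < T} is controlled by
  P(sigma_k < T, X > 0), which tends to 0.  Hence from wealth 1 at time sigma_k < T one reaches a
  terminal wealth that tends to 0 in L2, while the indicator of {sigma_k < T} converges to that of
  {X = 0}.  Unless P(X = 0) = 0, this contradicts the law of one price as well as the absence of
  arbitrage on the closure.
*)
theory Submission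
  imports Defs
begin

text \<open>Two features of the hypotheses shape the proof. Simple strategies live on ordered grids,
  so gains are handled as finite sums of elementary trades on possibly overlapping intervals. This
  class is closed under sums and under restriction to events known when trading starts; sorting the
  end points leads back to simple strategies. The identity quoted for
  E[X (W_k(T) - l_k); sigma_k < T] is orthogonality of X to a gain that starts at sigma_k and is cut
  down to an event known at sigma_k. The bound for X / l_k involves P(sigma_k < T, X > 0) itself,
  but the trivial bound 1 for this probability already makes the norm bounded, and that forces the
  probability to 0. The times sigma_k are not monotone, so the law of one price is applied along
  their lower envelopes. All conditions meet in one notion, a strictly positive element of L2
  orthogonal to all gains. To reach it from a local martingale measure Q takes optional sampling,
  since localization under Q concerns times unrelated to the trading times.\<close>

section \<open>The space of square-integrable functions\<close>

lemma L2_measurable [measurable_dest]: "f \<in> L2 M \<Longrightarrow> f \<in> borel_measurable M"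
  by (simp add: L2_def)

lemma L2_integrable_square: "f \<in> L2 M \<Longrightarrow> integrable M (\<lambda>\<omega>. (f \<omega>)\<^sup>2)"
  by (simp add: L2_def)

lemma L2_integrable_mult:
  assumes "f \<in> L2 M" "g \<in> L2 M"
  shows "integrable M (\<lambda>\<omega>. f \<omega> * g \<omega>)"
proof (rule Bochner_Integration.integrable_bound)
  show "integrable M (\<lambda>\<omega>. (f \<omega>)\<^sup>2 + (g \<omega>)\<^sup>2)"
    using assms by (intro Bochner_Integration.integrable_add L2_integrable_square)
  show "(\<lambda>\<omega>. f \<omega> * g \<omega>) \<in> borel_measurable M" using assms by measurable
  have "\<bar>a * b\<bar> \<le> a\<^sup>2 + b\<^sup>2" for a b :: real
    using sum_squares_bound[of "\<bar>a\<bar>" "\<bar>b\<bar>"] mult_nonneg_nonneg[of "\<bar>a\<bar>" "\<bar>b\<bar>"]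
    unfolding abs_mult power2_abs by linarith
  then show "AE \<omega> in M. norm (f \<omega> * g \<omega>) \<le> norm ((f \<omega>)\<^sup>2 + (g \<omega>)\<^sup>2)" by simp
qed

lemma L2_dominated:
  assumes "g \<in> L2 M" "f \<in> borel_measurable M" "AE \<omega> in M. \<bar>f \<omega>\<bar> \<le> \<bar>g \<omega>\<bar>"
  shows "f \<in> L2 M"
  unfolding L2_def
proof (intro CollectI conjI assms(2) Bochner_Integration.integrable_bound[OF L2_integrable_square[OF assms(1)]])
  show "(\<lambda>\<omega>. (f \<omega>)\<^sup>2) \<in> borel_measurable M" using assms(2) by measurable
  show "AE \<omega> in M. norm ((f \<omega>)\<^sup>2) \<le> norm ((g \<omega>)\<^sup>2)"
    using assms(3) by eventually_elim (simp add: abs_le_square_iff)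
qed

lemma L2_cmult: "f \<in> L2 M \<Longrightarrow> (\<lambda>\<omega>. c * f \<omega>) \<in> L2 M"
  by (auto simp: L2_def power_mult_distrib)

lemma L2_add:
  assumes "f \<in> L2 M" "g \<in> L2 M" shows "(\<lambda>\<omega>. f \<omega> + g \<omega>) \<in> L2 M"
proof -
  have "integrable M (\<lambda>\<omega>. (f \<omega>)\<^sup>2 + (g \<omega>)\<^sup>2 + 2 * (f \<omega> * g \<omega>))"
    using L2_integrable_mult[OF assms] L2_integrable_square[OF assms(1)] L2_integrable_square[OF assms(2)]
    by (intro Bochner_Integration.integrable_add integrable_mult_right)
  then show ?thesis using assms by (auto simp: L2_def power2_sum mult.assoc)
qed

lemma L2_uminus: "f \<in> L2 M \<Longrightarrow> (\<lambda>\<omega>. - f \<omega>) \<in> L2 M"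
  by (auto simp: L2_def)

lemma L2_diff:
  assumes "f \<in> L2 M" "g \<in> L2 M" shows "(\<lambda>\<omega>. f \<omega> - g \<omega>) \<in> L2 M"
  using L2_add[OF assms(1) L2_uminus[OF assms(2)]] by simp

lemma L2_zero_fun: "(\<lambda>\<omega>. 0) \<in> L2 M"
  by (simp add: L2_def)

lemma L2_indicator_mult:
  assumes "f \<in> L2 M" "B \<in> sets M" shows "(\<lambda>\<omega>. indicator B \<omega> * f \<omega>) \<in> L2 M"
  by (rule L2_dominated[OF assms(1)]) (use assms in \<open>auto simp: indicator_def\<close>)

lemma L2_norm_nonneg: "0 \<le> L2_norm M f"
  by (simp add: L2_norm_def)

lemma L2_norm_square: "(L2_norm M f)\<^sup>2 = (\<integral>\<omega>. (f \<omega>)\<^sup>2 \<partial>M)"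
  by (simp add: L2_norm_def)

lemma L2_norm_mono:
  assumes "g \<in> L2 M" "f \<in> borel_measurable M" "AE \<omega> in M. \<bar>f \<omega>\<bar> \<le> \<bar>g \<omega>\<bar>"
  shows "L2_norm M f \<le> L2_norm M g"
  unfolding L2_norm_def
proof (intro real_sqrt_le_mono integral_mono_AE)
  show "AE \<omega> in M. (f \<omega>)\<^sup>2 \<le> (g \<omega>)\<^sup>2"
    using assms(3) by eventually_elim (simp add: abs_le_square_iff)
qed (use assms L2_dominated[OF assms] in \<open>auto intro: L2_integrable_square\<close>)

lemma L2_norm_cong:
  assumes "\<And>\<omega>. \<omega> \<in> space M \<Longrightarrow> f \<omega> = g \<omega>" shows "L2_norm M f = L2_norm M g"
  unfolding L2_norm_def by (intro arg_cong[where f=sqrt] Bochner_Integration.integral_cong) (simp_all add: assms)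

lemma L2_cong:
  assumes "\<And>\<omega>. \<omega> \<in> space M \<Longrightarrow> f \<omega> = g \<omega>" shows "f \<in> L2 M \<longleftrightarrow> g \<in> L2 M"
proof -
  have "f \<in> borel_measurable M \<longleftrightarrow> g \<in> borel_measurable M" by (intro measurable_cong assms)
  moreover have "integrable M (\<lambda>\<omega>. (f \<omega>)\<^sup>2) \<longleftrightarrow> integrable M (\<lambda>\<omega>. (g \<omega>)\<^sup>2)"
    by (intro Bochner_Integration.integrable_cong) (simp_all add: assms)
  ultimately show ?thesis by (simp add: L2_def)
qed

lemma L2_norm_cmult: "L2_norm M (\<lambda>\<omega>. c * f \<omega>) = \<bar>c\<bar> * L2_norm M f"
  by (simp add: L2_norm_def power_mult_distrib real_sqrt_mult)

lemma L2_norm_minus_commute: "L2_norm M (\<lambda>\<omega>. f \<omega> - g \<omega>) = L2_norm M (\<lambda>\<omega>. g \<omega> - f \<omega>)"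
  by (simp add: L2_norm_def power2_commute)

lemma L2_norm_eq_0_iff:
  assumes "f \<in> L2 M" shows "L2_norm M f = 0 \<longleftrightarrow> (AE \<omega> in M. f \<omega> = 0)"
  using integral_nonneg_eq_0_iff_AE[OF L2_integrable_square[OF assms]] by (simp add: L2_norm_def)

lemma L2_Cauchy_Schwarz:
  assumes f: "f \<in> L2 M" and g: "g \<in> L2 M"
  shows "\<bar>\<integral>\<omega>. f \<omega> * g \<omega> \<partial>M\<bar> \<le> L2_norm M f * L2_norm M g"
proof -
  define a b c where "a = (\<integral>\<omega>. (f \<omega>)\<^sup>2 \<partial>M)" and "b = (\<integral>\<omega>. f \<omega> * g \<omega> \<partial>M)" and "c = (\<integral>\<omega>. (g \<omega>)\<^sup>2 \<partial>M)"
  have "b\<^sup>2 \<le> a * c"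
  proof (cases "c = 0")
    case True
    then have "AE \<omega> in M. g \<omega> = 0"
      using L2_norm_eq_0_iff[OF g] by (simp add: L2_norm_def c_def)
    then have "AE \<omega> in M. f \<omega> * g \<omega> = 0" by eventually_elim simp
    then have "b = 0" unfolding b_def by (rule integral_eq_zero_AE)
    then show ?thesis using True by simp
  next
    case False
    then have c: "0 < c" by (simp add: c_def less_le)
    note int = L2_integrable_square[OF f] L2_integrable_square[OF g] L2_integrable_mult[OF f g]
    have eq: "(c * f \<omega> - b * g \<omega>)\<^sup>2 = c\<^sup>2 * (f \<omega>)\<^sup>2 + b\<^sup>2 * (g \<omega>)\<^sup>2 - 2 * c * b * (f \<omega> * g \<omega>)" for \<omega>
      by (simp add: power2_diff power_mult_distrib)
    \<comment> \<open>\<open>c * f - b * g\<close> is \<open>c\<close> times the component of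
      \<open>f\<close> orthogonal to \<open>g\<close>; non-negativity of its squared norm is the
      inequality.\<close>
    have "0 \<le> (\<integral>\<omega>. (c * f \<omega> - b * g \<omega>)\<^sup>2 \<partial>M)" by simp
    also have "\<dots> = c\<^sup>2 * a + b\<^sup>2 * c - 2 * c * b * b"
      unfolding eq using int by (simp add: a_def b_def c_def)
    also have "\<dots> = c * (a * c - b\<^sup>2)" by (simp add: power2_eq_square algebra_simps)
    finally show ?thesis using c by (simp add: zero_le_mult_iff)
  qed
  then have "sqrt (b\<^sup>2) \<le> sqrt (a * c)" by (rule real_sqrt_le_mono)
  then show ?thesis by (simp add: L2_norm_def a_def b_def c_def real_sqrt_mult)
qed

lemma L2_norm_triangle:
  assumes f: "f \<in> L2 M" and g: "g \<in> L2 M"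
  shows "L2_norm M (\<lambda>\<omega>. f \<omega> + g \<omega>) \<le> L2_norm M f + L2_norm M g"
proof (rule power2_le_imp_le)
  have "(L2_norm M (\<lambda>\<omega>. f \<omega> + g \<omega>))\<^sup>2 = (\<integral>\<omega>. (f \<omega>)\<^sup>2 + (g \<omega>)\<^sup>2 + 2 * (f \<omega> * g \<omega>) \<partial>M)"
    by (simp add: L2_norm_square power2_sum mult.assoc)
  also have "\<dots> = (L2_norm M f)\<^sup>2 + (L2_norm M g)\<^sup>2 + 2 * (\<integral>\<omega>. f \<omega> * g \<omega> \<partial>M)"
    using L2_integrable_square[OF f] L2_integrable_square[OF g] L2_integrable_mult[OF f g]
    by (simp add: L2_norm_square)
  also have "\<dots> \<le> (L2_norm M f + L2_norm M g)\<^sup>2"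
    using L2_Cauchy_Schwarz[OF f g] by (simp add: power2_sum)
  finally show "(L2_norm M (\<lambda>\<omega>. f \<omega> + g \<omega>))\<^sup>2 \<le> (L2_norm M f + L2_norm M g)\<^sup>2" .
qed (simp add: L2_norm_nonneg)

text \<open>Stated with the midpoint because an affine set such as 1 plus the gains contains it: a
  lower bound for its norm turns near-minimality of two vectors into their closeness.\<close>

lemma L2_norm_parallelogram:
  assumes f: "f \<in> L2 M" and g: "g \<in> L2 M"
  shows "(L2_norm M (\<lambda>\<omega>. f \<omega> - g \<omega>))\<^sup>2 =
    2 * (L2_norm M f)\<^sup>2 + 2 * (L2_norm M g)\<^sup>2 - 4 * (L2_norm M (\<lambda>\<omega>. (f \<omega> + g \<omega>) / 2))\<^sup>2"
proof -
  note int = L2_integrable_square[OF f] L2_integrable_square[OF g] L2_integrable_mult[OF f g]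
  have 1: "(f \<omega> - g \<omega>)\<^sup>2 = (f \<omega>)\<^sup>2 + (g \<omega>)\<^sup>2 - 2 * (f \<omega> * g \<omega>)"
    "((f \<omega> + g \<omega>) / 2)\<^sup>2 = (f \<omega>)\<^sup>2 / 4 + (g \<omega>)\<^sup>2 / 4 + (f \<omega> * g \<omega>) / 2" for \<omega>
    by (simp_all add: power2_eq_square field_simps)
  show ?thesis unfolding L2_norm_square 1 using int by simp
qed

lemma L2_tendsto_I:
  assumes "\<And>n. X n \<in> L2 M" "Y \<in> L2 M" "(\<lambda>n. L2_norm M (\<lambda>\<omega>. X n \<omega> - Y \<omega>)) \<longlonglongrightarrow> 0"
  shows "L2_tendsto M X Y"
  using assms by (auto simp: L2_tendsto_def)

lemma L2_tendsto_cong: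
  assumes "L2_tendsto M X Y" "\<And>n \<omega>. \<omega> \<in> space M \<Longrightarrow> X' n \<omega> = X n \<omega>"
  shows "L2_tendsto M X' Y"
proof (rule L2_tendsto_I)
  show "X' n \<in> L2 M" for n
    using assms(1) L2_cong[of M "X' n" "X n", OF assms(2)] by (simp add: L2_tendsto_def)
  show "Y \<in> L2 M" using assms(1) by (simp add: L2_tendsto_def)
  have "L2_norm M (\<lambda>\<omega>. X' n \<omega> - Y \<omega>) = L2_norm M (\<lambda>\<omega>. X n \<omega> - Y \<omega>)" for n
    by (intro L2_norm_cong) (simp add: assms(2))
  then show "(\<lambda>n. L2_norm M (\<lambda>\<omega>. X' n \<omega> - Y \<omega>)) \<longlonglongrightarrow> 0"
    using assms(1) by (simp add: L2_tendsto_def)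
qed

lemma L2_tendsto_inner:
  assumes X: "L2_tendsto M X Y" and Z: "Z \<in> L2 M"
  shows "(\<lambda>n. \<integral>\<omega>. Z \<omega> * X n \<omega> \<partial>M) \<longlonglongrightarrow> (\<integral>\<omega>. Z \<omega> * Y \<omega> \<partial>M)"
proof (rule Lim_transform2[OF tendsto_const])
  show "(\<lambda>n. (\<integral>\<omega>. Z \<omega> * Y \<omega> \<partial>M) - (\<integral>\<omega>. Z \<omega> * X n \<omega> \<partial>M)) \<longlonglongrightarrow> 0"
  proof (rule Lim_null_comparison)
    show "(\<lambda>n. L2_norm M Z * L2_norm M (\<lambda>\<omega>. X n \<omega> - Y \<omega>)) \<longlonglongrightarrow> 0"
      using X by (auto simp: L2_tendsto_def intro: tendsto_mult_right_zero)
    show "\<forall>\<^sub>F n in sequentially. norm ((\<integral>\<omega>. Z \<omega> * Y \<omega> \<partial>M) - (\<integral>\<omega>. Z \<omega> * X n \<omega> \<partial>M))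
        \<le> L2_norm M Z * L2_norm M (\<lambda>\<omega>. X n \<omega> - Y \<omega>)"
    proof (rule always_eventually, rule allI)
      fix n
      have XY: "X n \<in> L2 M" "Y \<in> L2 M" using X by (auto simp: L2_tendsto_def)
      have "(\<integral>\<omega>. Z \<omega> * X n \<omega> \<partial>M) - (\<integral>\<omega>. Z \<omega> * Y \<omega> \<partial>M) = (\<integral>\<omega>. Z \<omega> * (X n \<omega> - Y \<omega>) \<partial>M)"
        using L2_integrable_mult[OF Z XY(1)] L2_integrable_mult[OF Z XY(2)] by (simp add: right_diff_distrib)
      then show "norm ((\<integral>\<omega>. Z \<omega> * Y \<omega> \<partial>M) - (\<integral>\<omega>. Z \<omega> * X n \<omega> \<partial>M))
          \<le> L2_norm M Z * L2_norm M (\<lambda>\<omega>. X n \<omega> - Y \<omega>)"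
        using L2_Cauchy_Schwarz[OF Z L2_diff[OF XY]] by (simp add: abs_minus_commute)
    qed
  qed
qed

lemma L2_closure_mono: "A \<subseteq> B \<Longrightarrow> L2_closure M A \<subseteq> L2_closure M B"
  unfolding L2_closure_def by blast

lemma L2_closure_memI:
  assumes X: "L2_tendsto M X Y" and A: "\<And>n. X n \<in> A"
  shows "Y \<in> L2_closure M A"
  unfolding L2_closure_def
proof (intro CollectI conjI allI impI)
  show "Y \<in> L2 M" using X by (simp add: L2_tendsto_def)
  fix \<epsilon> :: real assume "0 < \<epsilon>"
  then have "\<forall>\<^sub>F n in sequentially. L2_norm M (\<lambda>\<omega>. X n \<omega> - Y \<omega>) < \<epsilon>"
    using X by (auto simp: L2_tendsto_def intro: order_tendstoD)
  then obtain n where "L2_norm M (\<lambda>\<omega>. X n \<omega> - Y \<omega>) < \<epsilon>" by (auto simp: eventually_sequentially)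
  then show "\<exists>g\<in>A \<inter> L2 M. L2_norm M (\<lambda>\<omega>. Y \<omega> - g \<omega>) < \<epsilon>"
    using A[of n] X by (intro bexI[of _ "X n"]) (auto simp: L2_tendsto_def L2_norm_minus_commute)
qed

lemma L2_closure_sequence:
  assumes "f \<in> L2_closure M A"
  obtains g where "\<And>n. g n \<in> A" "L2_tendsto M g f"
proof -
  have "\<exists>g\<in>A \<inter> L2 M. L2_norm M (\<lambda>\<omega>. f \<omega> - g \<omega>) < inverse (real (Suc n))" for n
    using assms by (auto simp: L2_closure_def)
  then obtain g where g: "\<And>n. g n \<in> A \<inter> L2 M" "\<And>n. L2_norm M (\<lambda>\<omega>. f \<omega> - g n \<omega>) < inverse (real (Suc n))"
    by metis
  have "(\<lambda>n. L2_norm M (\<lambda>\<omega>. g n \<omega> - f \<omega>)) \<longlonglongrightarrow> 0"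
    by (rule tendsto_sandwich[OF _ _ tendsto_const LIMSEQ_inverse_real_of_nat])
      (use g(2) in \<open>auto intro!: always_eventually less_imp_le simp: L2_norm_nonneg L2_norm_minus_commute[of _ _ f]\<close>)
  then show thesis using g(1) assms by (intro that[of g] L2_tendsto_I) (auto simp: L2_closure_def)
qed

section \<open>Random variables on a probability space: Chebyshev bounds, subsequences,
  completeness\<close>

context prob_space
begin

lemma L2_integrable: "f \<in> L2 M \<Longrightarrow> integrable M f"
  using square_integrable_imp_integrable by (auto simp: L2_def emeasure_space_1)

lemma L2_const: "(\<lambda>\<omega>. c) \<in> L2 M"
  by (simp add: L2_def)

lemma L2_indicator: "B \<in> sets M \<Longrightarrow> indicator B \<in> L2 M"
  using L2_indicator_mult[OF L2_const, of B 1] by simp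

lemma L2_norm_indicator:
  assumes "B \<in> sets M" shows "L2_norm M (indicator B) = sqrt (prob B)"
proof -
  have "(indicator B \<omega> :: real)\<^sup>2 = indicator B \<omega>" for \<omega> by (simp add: indicator_def)
  then show ?thesis using assms by (simp add: L2_norm_def)
qed

lemma L1_le_L2_norm:
  assumes "f \<in> L2 M" shows "(\<integral>\<omega>. \<bar>f \<omega>\<bar> \<partial>M) \<le> L2_norm M f"
proof -
  have "(\<lambda>\<omega>. \<bar>f \<omega>\<bar>) \<in> L2 M" using assms by (auto simp: L2_def)
  from L2_Cauchy_Schwarz[OF this L2_const[of 1]] show ?thesis
    by (simp add: L2_norm_def prob_space)
qed

text \<open>Chebyshev's inequality for second moments.\<close>

lemma L2_prob_le:
  assumes f: "f \<in> L2 M" and c: "0 < c" and B: "B \<in> sets M" "\<And>\<omega>. \<omega> \<in> B \<Longrightarrow> c \<le> \<bar>f \<omega>\<bar>"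
  shows "prob B \<le> (L2_norm M f / c)\<^sup>2"
proof -
  have "c\<^sup>2 * prob B = (\<integral>\<omega>. c\<^sup>2 * indicator B \<omega> \<partial>M)" using B by simp
  also have "\<dots> \<le> (\<integral>\<omega>. (f \<omega>)\<^sup>2 \<partial>M)"
  proof (rule integral_mono)
    fix \<omega> assume "\<omega> \<in> space M"
    show "c\<^sup>2 * indicator B \<omega> \<le> (f \<omega>)\<^sup>2"
      using B(2)[of \<omega>] c by (cases "\<omega> \<in> B") (auto simp: abs_le_square_iff[symmetric])
  qed (use B f in \<open>auto simp: L2_integrable_square less_top[symmetric]\<close>)
  finally show ?thesis using c by (simp add: power_divide L2_norm_square field_simps)
qed

lemma prob_zero_of_AE_indicator:
  assumes "A \<in> sets M" "AE \<omega> in M. indicator A \<omega> = (0::real)" shows "prob A = 0"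
proof -
  have "AE \<omega> in M. \<omega> \<notin> A" using assms(2) by eventually_elim (auto simp: indicator_def split: if_splits)
  then have "A \<in> null_sets M" using assms(1) AE_iff_null_sets by blast
  then show ?thesis by (simp add: measure_def null_sets_def)
qed

text \<open>Under a probability measure L2 convergence implies L1 convergence, which yields an
  almost surely convergent subsequence.\<close>

lemma L2_tendsto_AE_subseq:
  assumes "L2_tendsto M X Y"
  obtains r where "strict_mono r" "AE \<omega> in M. (\<lambda>n. X (r n) \<omega>) \<longlonglongrightarrow> Y \<omega>"
proof -
  have L: "(\<lambda>\<omega>. X n \<omega> - Y \<omega>) \<in> L2 M" for n using assms by (auto simp: L2_tendsto_def intro: L2_diff)
  have "(\<lambda>n. \<integral>\<omega>. norm (X n \<omega> - Y \<omega>) \<partial>M) \<longlonglongrightarrow> 0"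
  proof (rule tendsto_sandwich[OF _ _ tendsto_const])
    show "(\<lambda>n. L2_norm M (\<lambda>\<omega>. X n \<omega> - Y \<omega>)) \<longlonglongrightarrow> 0" using assms by (simp add: L2_tendsto_def)
  qed (use L1_le_L2_norm[OF L] in auto)
  from tendsto_L1_AE_subseq[OF L2_integrable[OF L] this]
  obtain r where r: "strict_mono r" "AE \<omega> in M. (\<lambda>n. X (r n) \<omega> - Y \<omega>) \<longlonglongrightarrow> 0" by auto
  have "AE \<omega> in M. (\<lambda>n. X (r n) \<omega>) \<longlonglongrightarrow> Y \<omega>"
    using r(2) by eventually_elim (simp add: LIM_zero_iff)
  then show thesis using r(1) that by blast
qed

text \<open>Riesz-Fischer. The L1 theory supplies an almost surely convergent subsequence, and
  Fatou's lemma carries the Cauchy estimates over to its limit.\<close>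

lemma L2_complete:
  assumes X: "\<And>n. X n \<in> L2 M"
    and Cauchy: "\<And>e. 0 < e \<Longrightarrow> \<exists>N. \<forall>i\<ge>N. \<forall>j\<ge>N. L2_norm M (\<lambda>\<omega>. X i \<omega> - X j \<omega>) < e"
  obtains Y where "L2_tendsto M X Y"
proof -
  have L: "(\<lambda>\<omega>. X i \<omega> - X j \<omega>) \<in> L2 M" for i j by (intro L2_diff X)
  have "\<exists>N. \<forall>i\<ge>N. \<forall>j\<ge>N. (\<integral>\<omega>. norm (X i \<omega> - X j \<omega>) \<partial>M) < e" if "0 < e" for e
    using Cauchy[OF that] L1_le_L2_norm[OF L] by (metis (no_types, lifting) ext order_le_less_trans real_norm_def)
  from cauchy_L1_AE_cauchy_subseq[OF L2_integrable[OF X] this]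
  obtain r where r: "strict_mono r" "AE \<omega> in M. Cauchy (\<lambda>i. X (r i) \<omega>)" by blast
  define Y where "Y \<omega> = lim (\<lambda>i. X (r i) \<omega>)" for \<omega>
  have lim: "AE \<omega> in M. (\<lambda>i. X (r i) \<omega>) \<longlonglongrightarrow> Y \<omega>"
    using r(2) by eventually_elim (simp add: Y_def Cauchy_convergent_iff convergent_LIMSEQ_iff)
  have [measurable]: "X n \<in> borel_measurable M" for n using X by (rule L2_measurable)
  have [measurable]: "Y \<in> borel_measurable M" unfolding Y_def by measurable
  \<comment> \<open>Fatou along the subsequence with \<open>n\<close> fixed: the Cauchy bound for
    \<open>X n - X (r i)\<close> survives the limit in \<open>i\<close>.\<close>
  have fatou: "(\<integral>\<^sup>+\<omega>. ennreal ((X n \<omega> - Y \<omega>)\<^sup>2) \<partial>M) \<le> ennreal (e\<^sup>2)"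
    if n: "\<forall>i\<ge>N. \<forall>j\<ge>N. L2_norm M (\<lambda>\<omega>. X i \<omega> - X j \<omega>) < e" "N \<le> n" "0 < e" for n N e
  proof -
    have "(\<integral>\<^sup>+\<omega>. ennreal ((X n \<omega> - Y \<omega>)\<^sup>2) \<partial>M) = (\<integral>\<^sup>+\<omega>. liminf (\<lambda>i. ennreal ((X n \<omega> - X (r i) \<omega>)\<^sup>2)) \<partial>M)"
    proof (rule nn_integral_cong_AE)
      show "AE \<omega> in M. ennreal ((X n \<omega> - Y \<omega>)\<^sup>2) = liminf (\<lambda>i. ennreal ((X n \<omega> - X (r i) \<omega>)\<^sup>2))"
        using lim
      proof eventually_elim
        case (elim \<omega>)
        then have "(\<lambda>i. ennreal ((X n \<omega> - X (r i) \<omega>)\<^sup>2)) \<longlonglongrightarrow> ennreal ((X n \<omega> - Y \<omega>)\<^sup>2)"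
          by (intro tendsto_intros)
        then show ?case by (rule lim_imp_Liminf[OF sequentially_bot, symmetric])
      qed
    qed
    also have "\<dots> \<le> liminf (\<lambda>i. \<integral>\<^sup>+\<omega>. ennreal ((X n \<omega> - X (r i) \<omega>)\<^sup>2) \<partial>M)"
      by (rule nn_integral_liminf) measurable
    also have "\<dots> \<le> ennreal (e\<^sup>2)"
    proof (rule order_trans[OF Liminf_le_Limsup[OF sequentially_bot] Limsup_bounded])
      show "\<forall>\<^sub>F i in sequentially. (\<integral>\<^sup>+\<omega>. ennreal ((X n \<omega> - X (r i) \<omega>)\<^sup>2) \<partial>M) \<le> ennreal (e\<^sup>2)"
        using eventually_ge_at_top[of N]
      proof eventually_elim
        case (elim i)
        then have "N \<le> r i" using seq_suble[OF r(1), of i] by simp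
        then have "L2_norm M (\<lambda>\<omega>. X n \<omega> - X (r i) \<omega>) \<le> e" using n by (auto intro: less_imp_le)
        then have "(L2_norm M (\<lambda>\<omega>. X n \<omega> - X (r i) \<omega>))\<^sup>2 \<le> e\<^sup>2" by (intro power_mono L2_norm_nonneg)
        then show ?case
          by (subst nn_integral_eq_integral) (auto simp: L2_norm_square intro!: L2_integrable_square L ennreal_leI)
      qed
    qed
    finally show ?thesis .
  qed
  have diff: "(\<lambda>\<omega>. X n \<omega> - Y \<omega>) \<in> L2 M \<and> L2_norm M (\<lambda>\<omega>. X n \<omega> - Y \<omega>) \<le> e"
    if n: "\<forall>i\<ge>N. \<forall>j\<ge>N. L2_norm M (\<lambda>\<omega>. X i \<omega> - X j \<omega>) < e" "N \<le> n" "0 < e" for n N e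
  proof -
    have int: "integrable M (\<lambda>\<omega>. (X n \<omega> - Y \<omega>)\<^sup>2)"
      using fatou[OF n] by (intro integrableI_bounded) (auto intro: le_less_trans)
    then have "ennreal (\<integral>\<omega>. (X n \<omega> - Y \<omega>)\<^sup>2 \<partial>M) \<le> ennreal (e\<^sup>2)"
      using fatou[OF n] by (simp add: nn_integral_eq_integral)
    then have "(\<integral>\<omega>. (X n \<omega> - Y \<omega>)\<^sup>2 \<partial>M) \<le> e\<^sup>2" by simp
    then have "L2_norm M (\<lambda>\<omega>. X n \<omega> - Y \<omega>) \<le> e"
      using n(3) by (simp add: L2_norm_def real_le_lsqrt)
    then show ?thesis using int by (simp add: L2_def)
  qed
  obtain N1 where "\<forall>i\<ge>N1. \<forall>j\<ge>N1. L2_norm M (\<lambda>\<omega>. X i \<omega> - X j \<omega>) < 1" using Cauchy[of 1] by auto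
  then have "(\<lambda>\<omega>. X N1 \<omega> - Y \<omega>) \<in> L2 M" using diff by auto
  from L2_diff[OF X[of N1] this] have Y: "Y \<in> L2 M" by simp
  have "(\<lambda>n. L2_norm M (\<lambda>\<omega>. X n \<omega> - Y \<omega>)) \<longlonglongrightarrow> 0"
  proof (rule LIMSEQ_I)
    fix e :: real assume "0 < e"
    then obtain N where "\<forall>i\<ge>N. \<forall>j\<ge>N. L2_norm M (\<lambda>\<omega>. X i \<omega> - X j \<omega>) < e / 2" using Cauchy[of "e / 2"] by auto
    then have "\<forall>n\<ge>N. L2_norm M (\<lambda>\<omega>. X n \<omega> - Y \<omega>) \<le> e / 2" using diff[of N "e / 2"] \<open>0 < e\<close> by auto
    then show "\<exists>N. \<forall>n\<ge>N. norm (L2_norm M (\<lambda>\<omega>. X n \<omega> - Y \<omega>) - 0) < e"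
      using \<open>0 < e\<close> by (intro exI[of _ N]) (auto simp: L2_norm_nonneg intro: le_less_trans)
  qed
  with X Y show thesis by (intro that L2_tendsto_I)
qed

end

section \<open>Stopping times and continuous processes\<close>

text \<open>Rounding down a time in [0,t] keeps it in [0,t], so the values of an adapted process at
  the rounded times are still known at time t.\<close>

lemma rational_below_tendsto:
  fixes u :: real
  shows "(\<lambda>n. real_of_int \<lfloor>real (Suc n) * u\<rfloor> / real (Suc n)) \<longlonglongrightarrow> u"
    and "real_of_int \<lfloor>real (Suc n) * u\<rfloor> / real (Suc n) \<le> u"
    and "real_of_int \<lfloor>real (Suc n) * u\<rfloor> / real (Suc n) \<in> \<rat>"
proof -
  have le: "real_of_int \<lfloor>real (Suc n) * u\<rfloor> / real (Suc n) \<le> u" for n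
    using of_int_floor_le[of "real (Suc n) * u"] by (simp add: divide_le_eq mult.commute)
  show "real_of_int \<lfloor>real (Suc n) * u\<rfloor> / real (Suc n) \<le> u" by (rule le)
  show "real_of_int \<lfloor>real (Suc n) * u\<rfloor> / real (Suc n) \<in> \<rat>" by (intro Rats_divide Rats_of_int Rats_of_nat)
  have ge: "u - inverse (real (Suc n)) \<le> real_of_int \<lfloor>real (Suc n) * u\<rfloor> / real (Suc n)" for n
  proof -
    have "real (Suc n) * u - 1 \<le> real_of_int \<lfloor>real (Suc n) * u\<rfloor>" by linarith
    then have "(real (Suc n) * u - 1) / real (Suc n) \<le> real_of_int \<lfloor>real (Suc n) * u\<rfloor> / real (Suc n)"
      by (rule divide_right_mono) simp
    then show ?thesis by (simp add: diff_divide_distrib inverse_eq_divide)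
  qed
  show "(\<lambda>n. real_of_int \<lfloor>real (Suc n) * u\<rfloor> / real (Suc n)) \<longlonglongrightarrow> u"
  proof (rule tendsto_sandwich[OF always_eventually always_eventually _ tendsto_const])
    show "(\<lambda>n. u - inverse (real (Suc n))) \<longlonglongrightarrow> u"
      using tendsto_diff[OF tendsto_const LIMSEQ_inverse_real_of_nat] by simp
  qed (use le ge in auto)
qed

text \<open>By continuity the value at a measurable time is a limit of values at times with
  countably many values, which are handled one by one. With \<open>N\<close> the sigma-algebra at
  time \<open>t\<close> this yields adaptedness of stopped processes.\<close>

lemma measurable_path:
  fixes X :: "real \<Rightarrow> 'a \<Rightarrow> 'b::metric_space"
  assumes c: "c \<in> borel_measurable N" "\<And>\<omega>. \<omega> \<in> space N \<Longrightarrow> 0 \<le> c \<omega> \<and> c \<omega> \<le> t"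
    and X: "\<And>s. 0 \<le> s \<Longrightarrow> s \<le> t \<Longrightarrow> X s \<in> borel_measurable N"
    and cont: "\<And>\<omega>. \<omega> \<in> space N \<Longrightarrow> continuous_on {0..t} (\<lambda>s. X s \<omega>)"
  shows "(\<lambda>\<omega>. X (c \<omega>) \<omega>) \<in> borel_measurable N"
proof (cases "0 \<le> t")
  case False
  then have "space N = {}" using c(2) by (metis (no_types, opaque_lifting) all_not_in_conv order_trans)
  then show ?thesis by (simp add: measurable_def)
next
  case True
  define d where "d n \<omega> = real_of_int \<lfloor>real (Suc n) * c \<omega>\<rfloor> / real (Suc n)" for n \<omega>
  have d: "0 \<le> d n \<omega> \<and> d n \<omega> \<le> t" if "\<omega> \<in> space N" for n \<omega>
    using c(2)[OF that] rational_below_tendsto(2)[of n "c \<omega>"] by (auto simp: d_def)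
  show ?thesis
  proof (rule borel_measurable_LIMSEQ_metric)
    show "(\<lambda>\<omega>. X (d n \<omega>) \<omega>) \<in> borel_measurable N" for n
    proof -
      \<comment> \<open>Clamping to [0,t] does not change \<open>d n\<close>, but the rule for
        countable compositions asks for measurability at every integer \<open>i\<close>.\<close>
      have "(\<lambda>\<omega>. X (max 0 (min t (real_of_int \<lfloor>real (Suc n) * c \<omega>\<rfloor> / real (Suc n)))) \<omega>) \<in> borel_measurable N"
      proof (rule measurable_compose_countable[where f="\<lambda>i \<omega>. X (max 0 (min t (real_of_int i / real (Suc n)))) \<omega>"])
        show "(\<lambda>\<omega>. \<lfloor>real (Suc n) * c \<omega>\<rfloor>) \<in> measurable N (count_space UNIV)" using c(1) by measurable
        show "(\<lambda>\<omega>. X (max 0 (min t (real_of_int i / real (Suc n)))) \<omega>) \<in> borel_measurable N" for i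
          using True by (intro X) auto
      qed
      also have "?this \<longleftrightarrow> ?thesis"
        using d unfolding d_def by (intro measurable_cong) auto
      finally show ?thesis .
    qed
    show "(\<lambda>n. X (d n \<omega>) \<omega>) \<longlonglongrightarrow> X (c \<omega>) \<omega>" if "\<omega> \<in> space N" for \<omega>
      using d[OF that] c(2)[OF that] rational_below_tendsto(1)[of "c \<omega>"]
      by (intro continuous_on_tendsto_compose[OF cont[OF that]]) (auto simp: d_def)
  qed
qed

section \<open>Stopping times and their sigma-algebras\<close>

context usual_filtered_prob_space
begin

abbreviation ST :: "('a \<Rightarrow> real) set" where "ST \<equiv> stopping_times M F T"

lemma sets_F_subset: "sets (F t) \<subseteq> sets M"
  using sets_F_mono[of t "max t T"] sets_F_horizon[of "max t T"] by simp

lemma measurable_F_M: "f \<in> borel_measurable (F t) \<Longrightarrow> f \<in> borel_measurable M"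
  using sets_F_subset[of t] by (auto simp: measurable_def space_F)

lemma measurable_F_mono: "f \<in> borel_measurable (F s) \<Longrightarrow> s \<le> t \<Longrightarrow> f \<in> borel_measurable (F t)"
  using sets_F_mono[of s t] by (auto simp: measurable_def space_F)

lemma STD:
  assumes "\<tau> \<in> ST"
  shows "stopping_time F \<tau>" "\<And>\<omega>. \<omega> \<in> space M \<Longrightarrow> 0 \<le> \<tau> \<omega>" "\<And>\<omega>. \<omega> \<in> space M \<Longrightarrow> \<tau> \<omega> \<le> T"
    "\<tau> \<in> borel_measurable M"
proof -
  show st: "stopping_time F \<tau>" using assms by (simp add: stopping_times_def)
  show "\<tau> \<in> borel_measurable M"
    by (rule measurable_stopping_time[OF st sets_F_subset]) (simp add: space_F)
qed (use assms in \<open>auto simp: stopping_times_def\<close>)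

text \<open>Only times in [0,T) carry a condition: before 0 the event is empty, from
  \<open>T\<close> on it is the whole space.\<close>

lemma ST_I:
  assumes "\<And>\<omega>. \<omega> \<in> space M \<Longrightarrow> 0 \<le> \<tau> \<omega> \<and> \<tau> \<omega> \<le> T"
    and "\<And>t. 0 \<le> t \<Longrightarrow> t < T \<Longrightarrow> {\<omega>\<in>space M. \<tau> \<omega> \<le> t} \<in> sets (F t)"
  shows "\<tau> \<in> ST"
  unfolding stopping_times_def stopping_time_def
proof (intro CollectI conjI allI)
  fix t
  have "{\<omega>\<in>space M. \<tau> \<omega> \<le> t} \<in> sets (F t)"
  proof -
    consider "t < 0" | "0 \<le> t" "t < T" | "T \<le> t" by linarith
    then show ?thesis
    proof cases
      case 1
      then have "{\<omega>\<in>space M. \<tau> \<omega> \<le> t} = {}" using assms(1) by (force simp: not_le)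
      then show ?thesis by (simp only: sets.empty_sets)
    next
      case 3
      then have "{\<omega>\<in>space M. \<tau> \<omega> \<le> t} = space (F t)" using assms(1) by (force simp: space_F)
      then show ?thesis by (simp only: sets.top)
    next
      case 2
      then show ?thesis by (rule assms(2))
    qed
  qed
  then show "Measurable.pred (F t) (\<lambda>\<omega>. \<tau> \<omega> \<le> t)" by (simp add: pred_def space_F)
qed (use assms(1) in auto)

lemma ST_le_sets: "\<tau> \<in> ST \<Longrightarrow> {\<omega>\<in>space M. \<tau> \<omega> \<le> t} \<in> sets (F t)"
  using stopping_timeD[OF STD(1)] by (simp add: pred_def space_F)

lemma ST_const: "0 \<le> c \<Longrightarrow> c \<le> T \<Longrightarrow> (\<lambda>\<omega>. c) \<in> ST"
  by (simp add: stopping_times_def stopping_time_const)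

lemma ST_horizon: "(\<lambda>\<omega>. T) \<in> ST"
  using horizon_pos by (intro ST_const) auto

lemma ST_min: "\<sigma> \<in> ST \<Longrightarrow> \<tau> \<in> ST \<Longrightarrow> (\<lambda>\<omega>. min (\<sigma> \<omega>) (\<tau> \<omega>)) \<in> ST"
  by (auto simp: stopping_times_def stopping_time_min min_le_iff_disj)

lemma ST_max: "\<sigma> \<in> ST \<Longrightarrow> \<tau> \<in> ST \<Longrightarrow> (\<lambda>\<omega>. max (\<sigma> \<omega>) (\<tau> \<omega>)) \<in> ST"
  by (auto simp: stopping_times_def stopping_time_max le_max_iff_disj)

lemma sets_pre_sigma_subset:
  assumes "\<tau> \<in> ST" "B \<in> sets (pre_sigma \<tau>)" shows "B \<in> sets M"
proof -
  have "B \<subseteq> space M" using sets.sets_into_space[OF assms(2)] by (simp add: space_pre_sigma)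
  then have "{\<omega>\<in>B. \<tau> \<omega> \<le> T} = B" using STD(3)[OF assms(1)] by auto
  then show ?thesis
    using sets_pre_sigmaD[OF STD(1)[OF assms(1)] assms(2), of T] sets_F_horizon[of T] by simp
qed

lemma measurable_pre_sigma_M:
  assumes "\<tau> \<in> ST" "f \<in> borel_measurable (pre_sigma \<tau>)" shows "f \<in> borel_measurable M"
  by (rule measurable_from_subalg[OF _ assms(2)])
    (use sets_pre_sigma_subset[OF assms(1)] in \<open>auto simp: subalgebra_def space_pre_sigma\<close>)

text \<open>Makes stopping times comparable with each other inside the sigma-algebra of a fixed time
  \<open>t\<close>.\<close>

lemma stopping_time_min_const_measurable:
  assumes "stopping_time F \<sigma>" shows "(\<lambda>\<omega>. min (\<sigma> \<omega>) t) \<in> borel_measurable (F t)"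
proof (rule borel_measurableI_le)
  fix a
  show "{\<omega> \<in> space (F t). min (\<sigma> \<omega>) t \<le> a} \<in> sets (F t)"
  proof (cases "t \<le> a")
    case True
    then show ?thesis by (simp add: min_le_iff_disj)
  next
    case False
    then have "Measurable.pred (F t) (\<lambda>\<omega>. \<sigma> \<omega> \<le> a)" by (intro stopping_time_le_const[OF assms]) auto
    then show ?thesis using False by (simp add: pred_def min_le_iff_disj)
  qed
qed

lemma pre_sigma_le_Int:
  assumes \<sigma>: "\<sigma> \<in> ST" and \<tau>: "\<tau> \<in> ST" and B: "B \<in> sets (pre_sigma \<sigma>)"
  shows "{\<omega>\<in>B. \<sigma> \<omega> \<le> \<tau> \<omega>} \<in> sets (pre_sigma \<tau>)"
proof (rule sets_pre_sigmaI[OF STD(1)[OF \<tau>]])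
  fix t
  note [measurable] = stopping_time_min_const_measurable[OF STD(1)[OF \<sigma>], of t]
    stopping_time_min_const_measurable[OF STD(1)[OF \<tau>], of t]
  have "B \<subseteq> space M" using sets.sets_into_space[OF B] by (simp add: space_pre_sigma)
  \<comment> \<open>Once \<tau> is at most \<open>t\<close>, comparing the two times involves only
    their truncations at \<open>t\<close>, and \<sigma> is at most \<open>t\<close> as well.\<close>
  then have "{\<omega> \<in> {\<omega>\<in>B. \<sigma> \<omega> \<le> \<tau> \<omega>}. \<tau> \<omega> \<le> t} = {\<omega>\<in>B. \<sigma> \<omega> \<le> t} \<inter>
      ({\<omega>\<in>space M. \<tau> \<omega> \<le> t} \<inter> {\<omega>\<in>space (F t). min (\<sigma> \<omega>) t \<le> min (\<tau> \<omega>) t})"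
    by (auto simp: space_F)
  also have "\<dots> \<in> sets (F t)"
  proof (intro sets.Int)
    show "{\<omega>\<in>B. \<sigma> \<omega> \<le> t} \<in> sets (F t)" by (rule sets_pre_sigmaD[OF STD(1)[OF \<sigma>] B])
    show "{\<omega>\<in>space M. \<tau> \<omega> \<le> t} \<in> sets (F t)" by (rule ST_le_sets[OF \<tau>])
    show "{\<omega>\<in>space (F t). min (\<sigma> \<omega>) t \<le> min (\<tau> \<omega>) t} \<in> sets (F t)" by measurable
  qed
  finally show "{\<omega> \<in> {\<omega>\<in>B. \<sigma> \<omega> \<le> \<tau> \<omega>}. \<tau> \<omega> \<le> t} \<in> sets (F t)" .
qed

lemma pre_sigma_space: "space M \<in> sets (pre_sigma \<sigma>)"
  using sets.top[of "pre_sigma \<sigma>"] by (simp add: space_pre_sigma)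

lemma pre_sigma_mono:
  assumes "\<sigma> \<in> ST" "\<tau> \<in> ST" "B \<in> sets (pre_sigma \<sigma>)" "\<And>\<omega>. \<omega> \<in> space M \<Longrightarrow> \<sigma> \<omega> \<le> \<tau> \<omega>"
  shows "B \<in> sets (pre_sigma \<tau>)"
  using mono_pre_sigma[OF STD(1)[OF assms(1)] STD(1)[OF assms(2)] assms(4)] assms(3) by auto

lemma pre_sigma_less:
  assumes "\<sigma> \<in> ST" "\<tau> \<in> ST" shows "{\<omega>\<in>space M. \<sigma> \<omega> < \<tau> \<omega>} \<in> sets (pre_sigma \<sigma>)"
  using stopping_time_less[OF STD(1)[OF assms(1)] STD(1)[OF assms(2)]] by (simp add: pred_def space_pre_sigma)

lemma pre_sigma_const: "sets (pre_sigma (\<lambda>\<omega>. t)) = sets (F t)"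
proof -
  have st: "stopping_time F (\<lambda>\<omega>. t)" by (rule stopping_time_const)
  have "A \<in> sets (F t) \<longleftrightarrow> (\<forall>s. {\<omega>\<in>A. t \<le> s} \<in> sets (F s))" for A
  proof
    assume A: "A \<in> sets (F t)"
    have "{\<omega>\<in>A. t \<le> s} \<in> sets (F s)" for s
      using A sets_F_mono[of t s] by (cases "t \<le> s") auto
    then show "\<forall>s. {\<omega>\<in>A. t \<le> s} \<in> sets (F s)" by blast
  next
    assume "\<forall>s. {\<omega>\<in>A. t \<le> s} \<in> sets (F s)"
    then have "{\<omega>\<in>A. t \<le> t} \<in> sets (F t)" by blast
    then show "A \<in> sets (F t)" by simp
  qed
  then show ?thesis unfolding sets_pre_sigma[OF st] by blast
qed

text \<open>A quantity chosen at \<sigma> is known at \<tau> once it is set to 0 where \<sigma>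
  comes after \<tau>. This is how holdings are transported between stopping times that are not
  ordered.\<close>

lemma measurable_pre_sigma_restrict:
  fixes \<xi> :: "'a \<Rightarrow> 'b::real_normed_vector"
  assumes \<sigma>: "\<sigma> \<in> ST" and \<tau>: "\<tau> \<in> ST" and \<xi>: "\<xi> \<in> borel_measurable (pre_sigma \<sigma>)"
    and B: "B \<in> sets (pre_sigma \<sigma>)"
  shows "(\<lambda>\<omega>. indicator {\<omega>\<in>B. \<sigma> \<omega> \<le> \<tau> \<omega>} \<omega> *\<^sub>R \<xi> \<omega>) \<in> borel_measurable (pre_sigma \<tau>)"
    (is "?f \<in> _")
proof (rule measurableI)
  fix C :: "'b set" assume C: "C \<in> sets borel"
  let ?B = "{\<omega>\<in>B. \<sigma> \<omega> \<le> \<tau> \<omega>}"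
  have BM: "B \<subseteq> space M" using sets.sets_into_space[OF B] by (simp add: space_pre_sigma)
  have "\<xi> -` C \<inter> space (pre_sigma \<sigma>) \<inter> B \<in> sets (pre_sigma \<sigma>)"
    using measurable_sets[OF \<xi> C] B by auto
  from pre_sigma_le_Int[OF \<sigma> \<tau> this]
  have 1: "{\<omega> \<in> \<xi> -` C \<inter> space (pre_sigma \<sigma>) \<inter> B. \<sigma> \<omega> \<le> \<tau> \<omega>} \<in> sets (pre_sigma \<tau>)" .
  have 2: "space M - ?B \<in> sets (pre_sigma \<tau>)"
    by (intro sets.Diff pre_sigma_space pre_sigma_le_Int[OF \<sigma> \<tau> B])
  have f: "?f \<omega> = (if \<omega> \<in> ?B then \<xi> \<omega> else 0)" for \<omega> by simp
  have "?f -` C \<inter> space (pre_sigma \<tau>) =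
      {\<omega> \<in> \<xi> -` C \<inter> space (pre_sigma \<sigma>) \<inter> B. \<sigma> \<omega> \<le> \<tau> \<omega>} \<union> (if 0 \<in> C then space M - ?B else {})"
    using BM unfolding f vimage_def by (auto simp: space_pre_sigma split: if_splits)
  also have "\<dots> \<in> sets (pre_sigma \<tau>)" using 1 2 by auto
  finally show "?f -` C \<inter> space (pre_sigma \<tau>) \<in> sets (pre_sigma \<tau>)" .
qed simp

lemma measurable_pre_sigma_mono:
  fixes \<xi> :: "'a \<Rightarrow> 'b::real_normed_vector"
  assumes "\<sigma> \<in> ST" "\<tau> \<in> ST" "\<xi> \<in> borel_measurable (pre_sigma \<sigma>)" "\<And>\<omega>. \<omega> \<in> space M \<Longrightarrow> \<sigma> \<omega> \<le> \<tau> \<omega>"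
  shows "\<xi> \<in> borel_measurable (pre_sigma \<tau>)"
  by (rule measurable_from_subalg[OF _ assms(3)])
    (use pre_sigma_mono[OF assms(1,2) _ assms(4)] in \<open>auto simp: subalgebra_def space_pre_sigma\<close>)

lemma ST_SUP:
  fixes \<sigma> :: "nat \<Rightarrow> 'a \<Rightarrow> real"
  assumes "\<And>k. \<sigma> k \<in> ST" shows "(\<lambda>\<omega>. SUP k. \<sigma> k \<omega>) \<in> ST"
proof (rule ST_I)
  have bdd: "bdd_above (range (\<lambda>k. \<sigma> k \<omega>))" if "\<omega> \<in> space M" for \<omega>
    using STD(3)[OF assms that] by (intro bdd_aboveI[of _ T]) auto
  show "0 \<le> (SUP k. \<sigma> k \<omega>) \<and> (SUP k. \<sigma> k \<omega>) \<le> T" if "\<omega> \<in> space M" for \<omega>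
    using STD(2,3)[OF assms that] by (auto intro: cSUP_least cSUP_upper2[OF bdd[OF that]])
  fix t
  have "{\<omega>\<in>space M. (SUP k. \<sigma> k \<omega>) \<le> t} = (\<Inter>k. {\<omega>\<in>space M. \<sigma> k \<omega> \<le> t})"
    using bdd by (auto simp: cSUP_le_iff)
  also have "\<dots> \<in> sets (F t)" by (intro sets.countable_INT') (auto intro!: ST_le_sets assms)
  finally show "{\<omega>\<in>space M. (SUP k. \<sigma> k \<omega>) \<le> t} \<in> sets (F t)" .
qed

text \<open>Whether an infimum is at most \<open>t\<close> is decided only immediately after
  \<open>t\<close>: the infimum need not be attained. For each \<open>s > t\<close> the event is
  expressed through strict inequalities at times \<open>e n\<close> that decrease to
  \<open>t\<close> inside \<open>(t,s]\<close>, and right-continuity of the filtration brings it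
  down to \<open>t\<close>.\<close>

lemma ST_INF:
  fixes \<sigma> :: "nat \<Rightarrow> 'a \<Rightarrow> real"
  assumes "\<And>k. \<sigma> k \<in> ST" shows "(\<lambda>\<omega>. INF j\<in>{k..}. \<sigma> j \<omega>) \<in> ST"
proof (rule ST_I)
  have bdd: "bdd_below ((\<lambda>j. \<sigma> j \<omega>) ` {k..})" if "\<omega> \<in> space M" for \<omega>
    using STD(2)[OF assms that] by (intro bdd_belowI[of _ 0]) auto
  show "0 \<le> (INF j\<in>{k..}. \<sigma> j \<omega>) \<and> (INF j\<in>{k..}. \<sigma> j \<omega>) \<le> T" if "\<omega> \<in> space M" for \<omega>
    using STD(2,3)[OF assms that] by (auto intro!: cINF_greatest cINF_lower2[OF bdd[OF that], of k])
  fix t assume t: "0 \<le> t" "t < T"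
  have "{\<omega>\<in>space M. (INF j\<in>{k..}. \<sigma> j \<omega>) \<le> t} \<in> sets (F s)" if s: "t < s" for s
  proof -
    define e where "e n = t + (s - t) / real (Suc n)" for n
    have e: "t < e n" "e n \<le> s" for n
    proof -
      have "(s - t) / real (Suc n) \<le> (s - t) / 1" using s by (intro divide_left_mono) auto
      then show "e n \<le> s" by (simp add: e_def)
      show "t < e n" using s by (simp add: e_def)
    qed
    have elim: "e \<longlonglongrightarrow> t + 0"
      unfolding e_def using LIMSEQ_inverse_real_of_nat
      by (intro tendsto_add tendsto_const) (auto simp: divide_inverse intro: tendsto_mult_right_zero)
    have "(INF j\<in>{k..}. \<sigma> j \<omega>) \<le> t \<longleftrightarrow> (\<forall>n. \<exists>j\<in>{k..}. \<sigma> j \<omega> < e n)" if \<omega>: "\<omega> \<in> space M" for \<omega>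
    proof -
      have "(INF j\<in>{k..}. \<sigma> j \<omega>) \<le> t \<longleftrightarrow> (\<forall>n. (INF j\<in>{k..}. \<sigma> j \<omega>) < e n)"
      proof
        assume "(INF j\<in>{k..}. \<sigma> j \<omega>) \<le> t"
        then show "\<forall>n. (INF j\<in>{k..}. \<sigma> j \<omega>) < e n" using e(1) by (auto intro: le_less_trans)
      next
        assume "\<forall>n. (INF j\<in>{k..}. \<sigma> j \<omega>) < e n"
        then have "(INF j\<in>{k..}. \<sigma> j \<omega>) \<le> t + 0"
          by (intro LIMSEQ_le_const[OF elim]) (auto intro: less_imp_le)
        then show "(INF j\<in>{k..}. \<sigma> j \<omega>) \<le> t" by simp
      qed
      then show ?thesis using bdd[OF \<omega>] by (subst (asm) cINF_less_iff) auto
    qed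
    then have "{\<omega>\<in>space M. (INF j\<in>{k..}. \<sigma> j \<omega>) \<le> t} = (\<Inter>n. \<Union>j\<in>{k..}. {\<omega>\<in>space M. \<sigma> j \<omega> < e n})"
      by auto
    also have "\<dots> \<in> sets (F s)"
    proof -
      have "{\<omega>\<in>space M. \<sigma> j \<omega> < e n} \<in> sets (F s)" for n j
      proof -
        have "{\<omega>\<in>space M. \<sigma> j \<omega> < e n} \<in> sets (F (e n))"
          using stopping_time_less_const[OF STD(1)[OF assms[of j]], of "e n"] by (simp add: pred_def space_F)
        then show "{\<omega>\<in>space M. \<sigma> j \<omega> < e n} \<in> sets (F s)" using sets_F_mono[OF e(2)[of n]] by auto
      qed
      then show ?thesis by (intro sets.countable_INT' sets.countable_UN' image_subsetI) auto
    qed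
    finally show ?thesis .
  qed
  then show "{\<omega>\<in>space M. (INF j\<in>{k..}. \<sigma> j \<omega>) \<le> t} \<in> sets (F t)"
    using right_continuous[OF t] t by auto
qed

section \<open>Hitting times of continuous processes\<close>

definition hitting_time :: "(real \<Rightarrow> 'a \<Rightarrow> real) \<Rightarrow> real \<Rightarrow> 'a \<Rightarrow> real" where
  "hitting_time Y l \<omega> = Inf (insert T {t\<in>{0..T}. Y t \<omega> \<le> l})"

text \<open>The value \<open>T\<close> stands both for a first hit at \<open>T\<close> and for no
  hit at all, whence the case distinctions. The level set is closed, so the infimum is a minimum;
  the intermediate value theorem excludes a jump across the level, so a path started above
  \<open>l\<close> that is stopped before \<open>T\<close> is stopped exactly at
  \<open>l\<close>.\<close>

lemma hitting_time_properties:
  assumes cont: "continuous_on {0..T} (\<lambda>t. Y t \<omega>)"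
  shows "0 \<le> hitting_time Y l \<omega>" "hitting_time Y l \<omega> \<le> T"
    and "t \<in> {0..T} \<Longrightarrow> Y t \<omega> \<le> l \<Longrightarrow> hitting_time Y l \<omega> \<le> t"
    and "hitting_time Y l \<omega> < T \<Longrightarrow> Y (hitting_time Y l \<omega>) \<omega> \<le> l"
    and "l \<le> Y 0 \<omega> \<Longrightarrow> l \<le> Y (hitting_time Y l \<omega>) \<omega> \<or> hitting_time Y l \<omega> = T"
    and "l < Y 0 \<omega> \<Longrightarrow> Y T \<omega> < l \<Longrightarrow> hitting_time Y l \<omega> < T"
proof -
  let ?A = "{t\<in>{0..T}. Y t \<omega> \<le> l}" and ?h = "hitting_time Y l \<omega>"
  have bdd: "bdd_below (insert T ?A)" using horizon_pos by (intro bdd_belowI[of _ 0]) auto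
  show h0: "0 \<le> ?h" unfolding hitting_time_def by (rule cInf_greatest) (use horizon_pos in auto)
  show hT: "?h \<le> T" unfolding hitting_time_def by (rule cInf_lower[OF _ bdd]) auto
  show le: "?h \<le> t" if "t \<in> {0..T}" "Y t \<omega> \<le> l" for t
    unfolding hitting_time_def by (rule cInf_lower[OF _ bdd]) (use that in auto)
  have "closed (?A)"
    using continuous_closed_preimage[OF cont closed_atLeastAtMost, of "{..l}"]
    by (simp add: vimage_def Int_def)
  then have "closed (insert T ?A)" by simp
  then have mem: "?h \<in> insert T ?A"
    unfolding hitting_time_def using bdd by (intro closed_contains_Inf) auto
  then show "Y ?h \<omega> \<le> l" if "?h < T" using that by auto
  show "?h < T" if l: "l < Y 0 \<omega>" "Y T \<omega> < l"
  proof -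
    \<comment> \<open>A path that ends strictly below \<open>l\<close> crosses \<open>l\<close>, and
      not at \<open>T\<close>, where its value differs from \<open>l\<close>.\<close>
    obtain t where t: "0 \<le> t" "t \<le> T" "Y t \<omega> = l"
      using IVT2'[of "\<lambda>t. Y t \<omega>" T l 0] l cont horizon_pos by auto
    then show ?thesis using le[of t] l(2) by (cases "t = T") auto
  qed
  show "l \<le> Y ?h \<omega> \<or> ?h = T" if l: "l \<le> Y 0 \<omega>"
  proof (rule ccontr)
    assume n: "\<not> (l \<le> Y ?h \<omega> \<or> ?h = T)"
    then have h: "0 < ?h" "Y ?h \<omega> < l" using h0 l by (auto simp: less_le)
    \<comment> \<open>A value strictly below \<open>l\<close> at the hitting time would entail an
      earlier crossing, against minimality.\<close>
    have "\<exists>t\<ge>0. t \<le> ?h \<and> Y t \<omega> = l"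
      using h l h0 hT by (intro IVT2' continuous_on_subset[OF cont]) auto
    then obtain t where "0 \<le> t" "t \<le> ?h" "Y t \<omega> = l" by blast
    then show False using le[of t] hT h by (cases "t = ?h") auto
  qed
qed

text \<open>The level is reached by time \<open>t\<close> iff the minimum over [0,t] is at most
  \<open>l\<close>, and by continuity countably many times suffice to detect this.\<close>

lemma ST_hitting_time:
  assumes Y: "\<And>t. 0 \<le> t \<Longrightarrow> t \<le> T \<Longrightarrow> Y t \<in> borel_measurable (F t)"
    and cont: "\<And>\<omega>. \<omega> \<in> space M \<Longrightarrow> continuous_on {0..T} (\<lambda>t. Y t \<omega>)"
  shows "hitting_time Y l \<in> ST"
proof (rule ST_I)
  show "0 \<le> hitting_time Y l \<omega> \<and> hitting_time Y l \<omega> \<le> T" if "\<omega> \<in> space M" for \<omega>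
    using hitting_time_properties(1,2)[of Y \<omega> l, OF cont[OF that]] by simp
  fix t assume t: "0 \<le> t" "t < T"
  \<comment> \<open>Rational fractions of \<open>t\<close> instead of rational times: they are dense
    in [0,t], include \<open>t\<close> and never exceed it.\<close>
  let ?R = "{0..1} \<inter> \<rat> :: real set"
  have eq: "hitting_time Y l \<omega> \<le> t \<longleftrightarrow> (\<forall>n. \<exists>q\<in>?R. Y (q * t) \<omega> < l + inverse (real (Suc n)))"
    if \<omega>: "\<omega> \<in> space M" for \<omega>
  proof
    let ?h = "hitting_time Y l \<omega>"
    note h = hitting_time_properties[of Y \<omega> l, OF cont[OF \<omega>]]
    assume ht: "?h \<le> t"
    then have hl: "Y ?h \<omega> \<le> l" using h(4) t by auto
    define u where "u = (if t = 0 then 0 else ?h / t)"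
    have u: "0 \<le> u" "u \<le> 1" "u * t = ?h" using ht h(1) t by (auto simp: u_def)
    define q where "q m = real_of_int \<lfloor>real (Suc m) * u\<rfloor> / real (Suc m)" for m
    have q: "q m \<in> ?R" for m
      using order_trans[OF rational_below_tendsto(2) u(2)] rational_below_tendsto(3) u(1)
      unfolding q_def by auto
    have qt: "q m * t \<in> {0..T}" for m using q[of m] t mult_left_le_one_le[of t "q m"] by auto
    have "(\<lambda>m. q m * t) \<longlonglongrightarrow> u * t"
      unfolding q_def by (intro tendsto_mult tendsto_const rational_below_tendsto(1))
    then have "(\<lambda>m. Y (q m * t) \<omega>) \<longlonglongrightarrow> Y ?h \<omega>"
      unfolding u(3) using qt h(1,2) by (intro continuous_on_tendsto_compose[OF cont[OF \<omega>]]) auto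
    then have "\<forall>\<^sub>F m in sequentially. Y (q m * t) \<omega> < l + inverse (real (Suc n))" for n
      using hl by (intro order_tendstoD(2)) (auto intro: le_less_trans)
    then have "\<exists>m. Y (q m * t) \<omega> < l + inverse (real (Suc n))" for n
      by (metis (mono_tags, lifting) eventually_sequentially order_refl)
    then show "\<forall>n. \<exists>q\<in>?R. Y (q * t) \<omega> < l + inverse (real (Suc n))" using q by blast
  next
    assume *: "\<forall>n. \<exists>q\<in>?R. Y (q * t) \<omega> < l + inverse (real (Suc n))"
    \<comment> \<open>Compactness: the minimum over [0,t] is attained, and its value is below each
      \<open>l + 1/(n+1)\<close>, hence at most \<open>l\<close>.\<close>
    obtain s where s: "s \<in> {0..t}" "\<And>r. r \<in> {0..t} \<Longrightarrow> Y s \<omega> \<le> Y r \<omega>"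
      using continuous_attains_inf[of "{0..t}" "\<lambda>r. Y r \<omega>"] continuous_on_subset[OF cont[OF \<omega>], of "{0..t}"] t
      by auto
    have "Y s \<omega> \<le> l + inverse (real (Suc n))" for n
    proof -
      obtain q where q: "q \<in> ?R" "Y (q * t) \<omega> < l + inverse (real (Suc n))" using * by blast
      then have "q * t \<in> {0..t}" using t mult_left_le_one_le[of t q] by auto
      from s(2)[OF this] q(2) show ?thesis by simp
    qed
    then have "Y s \<omega> \<le> l + 0"
      by (intro LIMSEQ_le_const[OF tendsto_add[OF tendsto_const LIMSEQ_inverse_real_of_nat]]) auto
    then show "hitting_time Y l \<omega> \<le> t"
      using hitting_time_properties(3)[of Y \<omega> s l, OF cont[OF \<omega>]] s(1) t by auto
  qed
  have "{\<omega>\<in>space M. hitting_time Y l \<omega> \<le> t} =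
      (\<Inter>n. \<Union>q\<in>?R. {\<omega>\<in>space (F t). Y (q * t) \<omega> < l + inverse (real (Suc n))})"
    using eq by (auto simp: space_F)
  also have "\<dots> \<in> sets (F t)"
  proof (intro sets.countable_INT' image_subsetI)
    fix n
    have [measurable]: "Y (q * t) \<in> borel_measurable (F t)" if "q \<in> ?R" for q
      using that t mult_left_le_one_le[of t q] by (intro measurable_F_mono[OF Y]) auto
    show "(\<Union>q\<in>?R. {\<omega>\<in>space (F t). Y (q * t) \<omega> < l + inverse (real (Suc n))}) \<in> sets (F t)"
      by (intro sets.countable_UN') (auto simp: countable_rat)
  qed auto
  finally show "{\<omega>\<in>space M. hitting_time Y l \<omega> \<le> t} \<in> sets (F t)" .
qed

end

section \<open>Gains of simple strategies\<close>

text \<open>As \<beta> is itself an entry, the entry following the last one below \<beta> equals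
  \<beta>, so the sum telescopes exactly up to \<beta>. Repeated entries contribute zero increments,
  so no strictness is asked of the list.\<close>

lemma telescope_sorted:
  fixes f :: "real \<Rightarrow> 'v::real_vector"
  assumes "sorted (y # ys)" "\<beta> \<in> set (y # ys)"
  shows "(\<Sum>i<length ys. of_bool ((y # ys) ! i < \<beta>) *\<^sub>R (f ((y # ys) ! Suc i) - f ((y # ys) ! i))) = f \<beta> - f y"
  using assms
proof (induction ys arbitrary: y)
  case Nil
  then show ?case by simp
next
  case (Cons y' ys)
  have le: "y \<le> y'" "\<forall>z\<in>set (y' # ys). y \<le> z" and sorted: "sorted (y' # ys)" using Cons.prems(1) by auto
  let ?R = "\<Sum>i<length ys. of_bool ((y' # ys) ! i < \<beta>) *\<^sub>R (f ((y' # ys) ! Suc i) - f ((y' # ys) ! i))"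
  have eq: "(\<Sum>i<length (y' # ys). of_bool ((y # y' # ys) ! i < \<beta>) *\<^sub>R
      (f ((y # y' # ys) ! Suc i) - f ((y # y' # ys) ! i))) = of_bool (y < \<beta>) *\<^sub>R (f y' - f y) + ?R"
    unfolding length_Cons sum.lessThan_Suc_shift by simp
  show ?case
  proof (cases "\<beta> \<in> set (y' # ys)")
    case True
    then have "y \<le> \<beta>" "y' \<le> \<beta>" using le sorted by auto
    then show ?thesis unfolding eq Cons.IH[OF sorted True] using le by (cases "y = \<beta>") auto
  next
    case False
    then have \<beta>: "\<beta> = y" using Cons.prems(2) by auto
    have "?R = 0"
    proof (rule sum.neutral, rule ballI)
      fix i assume "i \<in> {..<length ys}"
      then have "(y' # ys) ! i \<in> set (y' # ys)" by (intro nth_mem) auto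
      then show "of_bool ((y' # ys) ! i < \<beta>) *\<^sub>R (f ((y' # ys) ! Suc i) - f ((y' # ys) ! i)) = 0"
        using le(2) \<beta> by auto
    qed
    then show ?thesis unfolding eq using \<beta> by simp
  qed
qed

lemma telescope_sorted_between:
  fixes f :: "real \<Rightarrow> 'v::real_vector"
  assumes "sorted ys" "\<alpha> \<in> set ys" "\<beta> \<in> set ys" "\<alpha> \<le> \<beta>"
  shows "(\<Sum>i<length ys - 1. of_bool (\<alpha> \<le> ys ! i \<and> ys ! i < \<beta>) *\<^sub>R (f (ys ! Suc i) - f (ys ! i))) = f \<beta> - f \<alpha>"
proof -
  obtain y zs where ys: "ys = y # zs" using assms(2) by (cases ys) auto
  have "of_bool (\<alpha> \<le> z \<and> z < \<beta>) = (of_bool (z < \<beta>) - of_bool (z < \<alpha>) :: real)" for z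
    using assms(4) by auto
  then have "(\<Sum>i<length ys - 1. of_bool (\<alpha> \<le> ys ! i \<and> ys ! i < \<beta>) *\<^sub>R (f (ys ! Suc i) - f (ys ! i))) =
      (\<Sum>i<length zs. of_bool (ys ! i < \<beta>) *\<^sub>R (f (ys ! Suc i) - f (ys ! i))) -
      (\<Sum>i<length zs. of_bool (ys ! i < \<alpha>) *\<^sub>R (f (ys ! Suc i) - f (ys ! i)))"
    by (simp only: scaleR_left_diff_distrib sum_subtractf ys) simp
  moreover have "sorted (y # zs)" "\<alpha> \<in> set (y # zs)" "\<beta> \<in> set (y # zs)" using assms by (auto simp: ys)
  ultimately show ?thesis
    using telescope_sorted[of y zs \<alpha> f] telescope_sorted[of y zs \<beta> f] by (simp only: ys) simp
qed

text \<open>Order statistics by counting. The number of stopping times that are at most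
  \<open>t\<close> is known at \<open>t\<close>, so sorting finitely many stopping times produces
  stopping times.\<close>

lemma sort_nth_le_iff:
  fixes xs :: "'v::linorder list"
  assumes "k < length xs"
  shows "sort xs ! k \<le> t \<longleftrightarrow> k < length (filter (\<lambda>x. x \<le> t) xs)"
proof -
  let ?ys = "sort xs"
  have "mset (filter (\<lambda>x. x \<le> t) ?ys) = mset (filter (\<lambda>x. x \<le> t) xs)" by simp
  then have len: "length (filter (\<lambda>x. x \<le> t) ?ys) = length (filter (\<lambda>x. x \<le> t) xs)" by (rule mset_eq_length)
  have filter: "filter (\<lambda>x. x \<le> t) zs = takeWhile (\<lambda>x. x \<le> t) zs" if "sorted zs" for zs
    using that
  proof (induction zs)
    case (Cons z zs)
    show ?case
    proof (cases "z \<le> t")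
      case False
      then have "\<forall>x\<in>set zs. \<not> x \<le> t" using Cons.prems by auto
      then show ?thesis using False by simp
    qed (use Cons in simp)
  qed simp
  have k: "k < length ?ys" using assms by simp
  show ?thesis unfolding len[symmetric] filter[OF sorted_sort]
  proof
    assume *: "?ys ! k \<le> t"
    show "k < length (takeWhile (\<lambda>x. x \<le> t) ?ys)"
    proof (rule ccontr)
      let ?n = "length (takeWhile (\<lambda>x. x \<le> t) ?ys)"
      assume "\<not> k < ?n"
      then have n: "?n \<le> k" "?n < length ?ys" using k by auto
      then have "?ys ! ?n \<le> ?ys ! k" using k by (intro sorted_nth_mono) auto
      moreover have "\<not> ?ys ! ?n \<le> t" using nth_length_takeWhile[OF n(2)] .
      ultimately show False using * by auto
    qed
  next
    assume "k < length (takeWhile (\<lambda>x. x \<le> t) ?ys)"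
    then show "?ys ! k \<le> t" by (metis nth_mem set_takeWhileD takeWhile_nth)
  qed
qed

text \<open>The market in the form in which the arguments use it; adaptedness will be read off from
  the semimartingale decomposition.\<close>

locale continuous_market = usual_filtered_prob_space M F T
  for M :: "'a measure" and F :: "real \<Rightarrow> 'a measure" and T :: real +
  fixes S :: "real \<Rightarrow> 'a \<Rightarrow> real ^ 'd"
  assumes S_adapted: "\<And>t. 0 \<le> t \<Longrightarrow> t \<le> T \<Longrightarrow> S t \<in> borel_measurable (F t)"
    and S_continuous: "\<And>\<omega>. \<omega> \<in> space M \<Longrightarrow> continuous_on {0..T} (\<lambda>t. S t \<omega>)"
    and S_locally_square_integrable: "locally_square_integrable M F T S"
begin

section \<open>Path suprema and admissible capping times\<close>

lemma S_at_measurable: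
  assumes "c \<in> borel_measurable M" "\<And>\<omega>. \<omega> \<in> space M \<Longrightarrow> 0 \<le> c \<omega> \<and> c \<omega> \<le> T"
  shows "(\<lambda>\<omega>. S (c \<omega>) \<omega>) \<in> borel_measurable M"
  by (rule measurable_path[where t=T, OF assms]) (auto intro: measurable_F_M S_adapted S_continuous)

lemma S_min_measurable:
  assumes "\<tau> \<in> ST" "0 \<le> t" "t \<le> T"
  shows "(\<lambda>\<omega>. S (min (\<tau> \<omega>) t) \<omega>) \<in> borel_measurable (F t)"
proof (rule measurable_path[where t=t])
  show "(\<lambda>\<omega>. min (\<tau> \<omega>) t) \<in> borel_measurable (F t)"
    by (rule stopping_time_min_const_measurable[OF STD(1)[OF assms(1)]])
  show "S s \<in> borel_measurable (F t)" if "0 \<le> s" "s \<le> t" for s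
    using that assms by (intro measurable_F_mono[OF S_adapted]) auto
  show "continuous_on {0..t} (\<lambda>s. S s \<omega>)" if "\<omega> \<in> space (F t)" for \<omega>
    using that assms by (intro continuous_on_subset[OF S_continuous]) (auto simp: space_F)
qed (use assms STD(2) in \<open>auto simp: space_F\<close>)

lemma running_sup_bdd:
  assumes "\<omega> \<in> space M" "\<tau> \<omega> \<le> T" shows "bdd_above ((\<lambda>t. norm (S t \<omega>)) ` {0..\<tau> \<omega>})"
proof -
  have "compact ((\<lambda>t. norm (S t \<omega>)) ` {0..\<tau> \<omega>})"
    using assms by (intro compact_continuous_image continuous_on_norm continuous_on_subset[OF S_continuous]) auto
  then show ?thesis by (intro bounded_imp_bdd_above compact_imp_bounded)
qed

lemma running_sup_upper:
  assumes "\<omega> \<in> space M" "\<tau> \<omega> \<le> T" "0 \<le> t" "t \<le> \<tau> \<omega>"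
  shows "norm (S t \<omega>) \<le> running_sup S \<tau> \<omega>"
  unfolding running_sup_def using assms by (intro cSUP_upper running_sup_bdd) auto

lemma running_sup_nonneg:
  assumes "\<omega> \<in> space M" "0 \<le> \<tau> \<omega>" "\<tau> \<omega> \<le> T" shows "0 \<le> running_sup S \<tau> \<omega>"
  using running_sup_upper[of \<omega> \<tau> 0] assms norm_ge_zero[of "S 0 \<omega>"] by linarith

lemma running_sup_mono:
  assumes "\<omega> \<in> space M" "0 \<le> \<sigma> \<omega>" "\<sigma> \<omega> \<le> \<tau> \<omega>" "\<tau> \<omega> \<le> T"
  shows "running_sup S \<sigma> \<omega> \<le> running_sup S \<tau> \<omega>"
  unfolding running_sup_def[of S \<sigma>] using assms by (intro cSUP_least running_sup_upper) auto

text \<open>By continuity the supremum over the random interval is a supremum over its rational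
  fractions, a countable family of measurable variables.\<close>

lemma running_sup_measurable:
  assumes \<tau>: "\<tau> \<in> ST" shows "running_sup S \<tau> \<in> borel_measurable M"
proof -
  let ?R = "{0..1} \<inter> \<rat> :: real set"
  have sub: "q * \<tau> \<omega> \<in> {0..\<tau> \<omega>}" if "\<omega> \<in> space M" "q \<in> ?R" for q \<omega>
    using STD(2)[OF \<tau> that(1)] that(2) mult_left_le_one_le[of "\<tau> \<omega>" q] by auto
  have bdd: "bdd_above ((\<lambda>q. norm (S (q * \<tau> \<omega>) \<omega>)) ` ?R)" if "\<omega> \<in> space M" for \<omega>
    using sub[OF that] by (intro bdd_above_mono[OF running_sup_bdd[of \<omega> \<tau>]] that STD(3)[OF \<tau>]) auto
  have R0: "0 \<in> ?R" by auto
  have eq: "running_sup S \<tau> \<omega> = (SUP q\<in>?R. norm (S (q * \<tau> \<omega>) \<omega>))" if \<omega>: "\<omega> \<in> space M" for \<omega>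
  proof (rule antisym)
    show "(SUP q\<in>?R. norm (S (q * \<tau> \<omega>) \<omega>)) \<le> running_sup S \<tau> \<omega>"
    proof (rule cSUP_least)
      show "?R \<noteq> {}" using R0 by blast
      show "norm (S (q * \<tau> \<omega>) \<omega>) \<le> running_sup S \<tau> \<omega>" if "q \<in> ?R" for q
        using sub[OF \<omega> that] by (intro running_sup_upper \<omega> STD(3)[OF \<tau>]) auto
    qed
    show "running_sup S \<tau> \<omega> \<le> (SUP q\<in>?R. norm (S (q * \<tau> \<omega>) \<omega>))"
      unfolding running_sup_def
    proof (rule cSUP_least)
      show "{0..\<tau> \<omega>} \<noteq> {}" using STD(2)[OF \<tau> \<omega>] by auto
      fix t assume t: "t \<in> {0..\<tau> \<omega>}"
      define u where "u = (if \<tau> \<omega> = 0 then 0 else t / \<tau> \<omega>)"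
      have u: "0 \<le> u" "u \<le> 1" "u * \<tau> \<omega> = t" using t by (auto simp: u_def)
      define q where "q m = real_of_int \<lfloor>real (Suc m) * u\<rfloor> / real (Suc m)" for m
      have q: "q m \<in> ?R" for m
        using order_trans[OF rational_below_tendsto(2) u(2)] rational_below_tendsto(3) u(1)
        unfolding q_def by auto
      have "(\<lambda>m. q m * \<tau> \<omega>) \<longlonglongrightarrow> u * \<tau> \<omega>"
        unfolding q_def by (intro tendsto_mult tendsto_const rational_below_tendsto(1))
      moreover have "q m * \<tau> \<omega> \<in> {0..T}" for m using sub[OF \<omega> q[of m]] STD(3)[OF \<tau> \<omega>] by auto
      ultimately have "(\<lambda>m. norm (S (q m * \<tau> \<omega>) \<omega>)) \<longlonglongrightarrow> norm (S t \<omega>)"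
        unfolding u(3) using t STD(3)[OF \<tau> \<omega>]
        by (intro tendsto_norm continuous_on_tendsto_compose[OF S_continuous[OF \<omega>]]) auto
      then show "norm (S t \<omega>) \<le> (SUP q\<in>?R. norm (S (q * \<tau> \<omega>) \<omega>))"
        by (rule LIMSEQ_le_const2) (intro exI[of _ 0] allI impI cSUP_upper[OF q bdd[OF \<omega>]])
    qed
  qed
  have "(\<lambda>\<omega>. SUP q\<in>?R. norm (S (q * \<tau> \<omega>) \<omega>)) \<in> borel_measurable M"
  proof (rule borel_measurable_cSUP)
    show "countable ?R" using countable_rat by auto
    show "(\<lambda>\<omega>. norm (S (q * \<tau> \<omega>) \<omega>)) \<in> borel_measurable M" if q: "q \<in> ?R" for q
    proof -
      have "(\<lambda>\<omega>. q * \<tau> \<omega>) \<in> borel_measurable M" using STD(4)[OF \<tau>] by measurable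
      moreover have "0 \<le> q * \<tau> \<omega> \<and> q * \<tau> \<omega> \<le> T" if "\<omega> \<in> space M" for \<omega>
        using sub[OF that q] STD(3)[OF \<tau> that] by auto
      ultimately have "(\<lambda>\<omega>. S (q * \<tau> \<omega>) \<omega>) \<in> borel_measurable M" by (rule S_at_measurable)
      then show ?thesis by measurable
    qed
  qed (rule bdd)
  then show ?thesis using eq by (subst measurable_cong) auto
qed

text \<open>The times at which trading may be forced to end. Simple strategies refer to a member of
  a localizing sequence, but this sequence may be chosen together with the strategy, so a condition
  on one stopping time captures the same times and is stable under maxima and smaller times.\<close>

definition admissible :: "('a \<Rightarrow> real) \<Rightarrow> bool" where
  "admissible b \<longleftrightarrow> b \<in> ST \<and> running_sup S b \<in> L2 M"

lemma admissible_ST: "admissible b \<Longrightarrow> b \<in> ST"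
  by (simp add: admissible_def)

lemma admissible_mono:
  assumes c: "admissible c" and b: "b \<in> ST" and le: "\<And>\<omega>. \<omega> \<in> space M \<Longrightarrow> b \<omega> \<le> c \<omega>"
  shows "admissible b"
  unfolding admissible_def
proof (intro conjI b L2_dominated[OF _ running_sup_measurable[OF b]])
  show "running_sup S c \<in> L2 M" using c by (simp add: admissible_def)
  show "AE \<omega> in M. \<bar>running_sup S b \<omega>\<bar> \<le> \<bar>running_sup S c \<omega>\<bar>"
  proof (rule AE_I2)
    fix \<omega> assume \<omega>: "\<omega> \<in> space M"
    show "\<bar>running_sup S b \<omega>\<bar> \<le> \<bar>running_sup S c \<omega>\<bar>"
      using running_sup_mono[where \<sigma>=b and \<tau>=c, OF \<omega> STD(2)[OF b \<omega>] le[OF \<omega>] STD(3)[OF admissible_ST[OF c] \<omega>]]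
        running_sup_nonneg[where \<tau>=b, OF \<omega> STD(2,3)[OF b \<omega>]] by simp
  qed
qed

lemma admissible_max:
  assumes b: "admissible b" and c: "admissible c" shows "admissible (\<lambda>\<omega>. max (b \<omega>) (c \<omega>))"
  unfolding admissible_def
proof (intro conjI, goal_cases)
  show st: "(\<lambda>\<omega>. max (b \<omega>) (c \<omega>)) \<in> ST" using b c by (intro ST_max admissible_ST)
  case 2
  show ?case
  proof (rule L2_dominated)
    show "running_sup S (\<lambda>\<omega>. max (b \<omega>) (c \<omega>)) \<in> borel_measurable M" using st by (rule running_sup_measurable)
    show "(\<lambda>\<omega>. running_sup S b \<omega> + running_sup S c \<omega>) \<in> L2 M"
      using b c by (intro L2_add) (auto simp: admissible_def)
    show "AE \<omega> in M. \<bar>running_sup S (\<lambda>\<omega>. max (b \<omega>) (c \<omega>)) \<omega>\<bar> \<le> \<bar>running_sup S b \<omega> + running_sup S c \<omega>\<bar>"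
    proof (rule AE_I2)
      fix \<omega> assume \<omega>: "\<omega> \<in> space M"
      have "running_sup S (\<lambda>\<omega>. max (b \<omega>) (c \<omega>)) \<omega> = running_sup S b \<omega> \<or>
          running_sup S (\<lambda>\<omega>. max (b \<omega>) (c \<omega>)) \<omega> = running_sup S c \<omega>"
        by (simp add: running_sup_def max_def)
      then show "\<bar>running_sup S (\<lambda>\<omega>. max (b \<omega>) (c \<omega>)) \<omega>\<bar> \<le> \<bar>running_sup S b \<omega> + running_sup S c \<omega>\<bar>"
        using running_sup_nonneg[where \<tau>=b, OF \<omega> STD(2,3)[OF admissible_ST[OF b] \<omega>]]
          running_sup_nonneg[where \<tau>=c, OF \<omega> STD(2,3)[OF admissible_ST[OF c] \<omega>]] by auto
    qed
  qed
qed

lemma square_localizing_admissible: "square_localizing M F T S \<tau> \<Longrightarrow> admissible (\<tau> n)"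
  by (auto simp: square_localizing_def localizing_sequence_def admissible_def)

text \<open>Raising every member of a given localizing sequence to at least \<open>b\<close> keeps
  it localizing and square integrable, and makes each member, the first included, a cap for
  \<open>b\<close>.\<close>

lemma admissible_square_localizing:
  assumes b: "admissible b"
  obtains \<tau> where "square_localizing M F T S \<tau>" "\<And>n \<omega>. b \<omega> \<le> \<tau> n \<omega>"
proof -
  obtain \<tau>0 where \<tau>0: "square_localizing M F T S \<tau>0"
    using S_locally_square_integrable by (auto simp: locally_square_integrable_def)
  define \<tau> where "\<tau> n \<omega> = max (b \<omega>) (\<tau>0 n \<omega>)" for n \<omega>
  have adm: "admissible (\<tau> n)" for n
    unfolding \<tau>_def by (intro admissible_max b square_localizing_admissible[OF \<tau>0])
  have "(\<lambda>n. prob {\<omega>\<in>space M. \<tau> n \<omega> < T}) \<longlonglongrightarrow> 0"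
  proof (rule tendsto_sandwich[OF _ always_eventually tendsto_const])
    show "(\<lambda>n. prob {\<omega>\<in>space M. \<tau>0 n \<omega> < T}) \<longlonglongrightarrow> 0"
      using \<tau>0 by (simp add: square_localizing_def localizing_sequence_def)
    show "\<forall>n. prob {\<omega>\<in>space M. \<tau> n \<omega> < T} \<le> prob {\<omega>\<in>space M. \<tau>0 n \<omega> < T}"
    proof (intro allI finite_measure_mono)
      fix n
      have [measurable]: "\<tau>0 n \<in> borel_measurable M"
        using STD(4)[OF admissible_ST[OF square_localizing_admissible[OF \<tau>0]]] .
      show "{\<omega>\<in>space M. \<tau>0 n \<omega> < T} \<in> events" by measurable
    qed (auto simp: \<tau>_def)
  qed auto
  then have "square_localizing M F T S \<tau>"
    unfolding square_localizing_def localizing_sequence_def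
  proof (intro conjI allI ballI)
    show "\<tau> n \<omega> \<le> \<tau> (Suc n) \<omega>" if "\<omega> \<in> space M" for n \<omega>
      using \<tau>0 that unfolding \<tau>_def square_localizing_def localizing_sequence_def
      by (intro max.mono order_refl) auto
  qed (use adm in \<open>auto simp: admissible_def\<close>)
  then show thesis by (rule that) (simp add: \<tau>_def)
qed

lemma admissible_norm_L2:
  assumes b: "admissible b" and c: "c \<in> borel_measurable M" "\<And>\<omega>. \<omega> \<in> space M \<Longrightarrow> 0 \<le> c \<omega> \<and> c \<omega> \<le> b \<omega>"
  shows "(\<lambda>\<omega>. norm (S (c \<omega>) \<omega>)) \<in> L2 M"
proof (rule L2_dominated)
  note bST = admissible_ST[OF b]
  show "running_sup S b \<in> L2 M" using b by (simp add: admissible_def)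
  show "(\<lambda>\<omega>. norm (S (c \<omega>) \<omega>)) \<in> borel_measurable M"
  proof -
    have "0 \<le> c \<omega> \<and> c \<omega> \<le> T" if "\<omega> \<in> space M" for \<omega>
      using c(2)[OF that] STD(3)[OF bST that] by simp
    then have "(\<lambda>\<omega>. S (c \<omega>) \<omega>) \<in> borel_measurable M" by (rule S_at_measurable[OF c(1)])
    then show ?thesis by measurable
  qed
  show "AE \<omega> in M. \<bar>norm (S (c \<omega>) \<omega>)\<bar> \<le> \<bar>running_sup S b \<omega>\<bar>"
    using running_sup_upper[OF _ STD(3)[OF bST]] c(2) running_sup_nonneg[OF _ STD(2,3)[OF bST]]
    by (intro AE_I2) (simp add: abs_of_nonneg)
qed

text \<open>One trade: holding \<xi> on the interval from \<open>a\<close> to \<open>b\<close>. The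
  last clause constrains the start only where the trade is effective, so that a strategy can be
  restricted to an event by changing the holding and leaving the times alone.\<close>

definition elementary_from ::
    "('a \<Rightarrow> real) \<Rightarrow> ('a \<Rightarrow> real) \<times> ('a \<Rightarrow> real) \<times> ('a \<Rightarrow> real ^ 'd) \<Rightarrow> bool" where
  "elementary_from \<rho> = (\<lambda>(a, b, \<xi>). a \<in> ST \<and> admissible b \<and> (\<forall>\<omega>\<in>space M. a \<omega> \<le> b \<omega>) \<and>
     \<xi> \<in> borel_measurable (pre_sigma a) \<and> (\<exists>C. \<forall>\<omega>\<in>space M. norm (\<xi> \<omega>) \<le> C) \<and>
     (\<forall>\<omega>\<in>space M. a \<omega> < b \<omega> \<longrightarrow> \<xi> \<omega> \<noteq> 0 \<longrightarrow> \<rho> \<omega> \<le> a \<omega>))"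

definition elementary_gain ::
    "('a \<Rightarrow> real) \<times> ('a \<Rightarrow> real) \<times> ('a \<Rightarrow> real ^ 'd) \<Rightarrow> 'a \<Rightarrow> real" where
  "elementary_gain = (\<lambda>(a, b, \<xi>) \<omega>. \<xi> \<omega> \<bullet> (S (b \<omega>) \<omega> - S (a \<omega>) \<omega>))"

text \<open>
  \<open>gain_from \<rho> h\<close>: on \<open>space M\<close>, \<open>h\<close> is the terminal gain of a simple strategy that does not
  trade before \<open>\<rho>\<close>.  Unlike for \<^const>\<open>simple_strategies\<close>, the trading intervals may overlap.
\<close>

definition gain_from :: "('a \<Rightarrow> real) \<Rightarrow> ('a \<Rightarrow> real) \<Rightarrow> bool" where
  "gain_from \<rho> h \<longleftrightarrow> (\<exists>xs. (\<forall>x\<in>set xs. elementary_from \<rho> x) \<and>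
     (\<forall>\<omega>\<in>space M. h \<omega> = (\<Sum>x\<leftarrow>xs. elementary_gain x \<omega>)))"

section \<open>Algebra of gains and their square integrability\<close>

lemma gain_from_zero: "gain_from \<rho> (\<lambda>\<omega>. 0)"
  unfolding gain_from_def by (intro exI[of _ "[]"]) auto

lemma gain_from_cong:
  assumes "gain_from \<rho> h" "\<And>\<omega>. \<omega> \<in> space M \<Longrightarrow> h \<omega> = h' \<omega>" shows "gain_from \<rho> h'"
  using assms unfolding gain_from_def by auto

lemma gain_from_add:
  assumes "gain_from \<rho> h" "gain_from \<rho> h'" shows "gain_from \<rho> (\<lambda>\<omega>. h \<omega> + h' \<omega>)"
proof -
  obtain xs ys where "\<forall>x\<in>set xs. elementary_from \<rho> x" "\<forall>\<omega>\<in>space M. h \<omega> = (\<Sum>x\<leftarrow>xs. elementary_gain x \<omega>)"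
    "\<forall>x\<in>set ys. elementary_from \<rho> x" "\<forall>\<omega>\<in>space M. h' \<omega> = (\<Sum>x\<leftarrow>ys. elementary_gain x \<omega>)"
    using assms unfolding gain_from_def by blast
  then show ?thesis unfolding gain_from_def by (intro exI[of _ "xs @ ys"]) auto
qed

lemma elementary_gain_from:
  assumes "elementary_from \<rho> x" shows "gain_from \<rho> (elementary_gain x)"
  unfolding gain_from_def by (intro exI[of _ "[x]"]) (use assms in auto)

lemma gain_from_sum_list:
  assumes "\<And>x. x \<in> set xs \<Longrightarrow> gain_from \<rho> (h x)" shows "gain_from \<rho> (\<lambda>\<omega>. \<Sum>x\<leftarrow>xs. h x \<omega>)"
  using assms by (induction xs) (auto intro: gain_from_zero gain_from_add)

lemma gain_from_sum:
  assumes "\<And>x. x \<in> I \<Longrightarrow> gain_from \<rho> (h x)" shows "gain_from \<rho> (\<lambda>\<omega>. \<Sum>x\<in>I. h x \<omega>)"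
  using assms by (induction I rule: infinite_finite_induct) (auto intro: gain_from_zero gain_from_add)

text \<open>Transfers an operation from single trades to gains: since a gain has many
  decompositions, the operation is specified trade by trade and must commute with the sum.\<close>

lemma gain_from_cases:
  assumes "gain_from \<rho> h"
    and "\<And>x. elementary_from \<rho> x \<Longrightarrow> gain_from \<rho>' (g x)"
    and "\<And>\<omega> xs. \<omega> \<in> space M \<Longrightarrow> \<forall>x\<in>set xs. elementary_from \<rho> x \<Longrightarrow>
      h \<omega> = (\<Sum>x\<leftarrow>xs. elementary_gain x \<omega>) \<Longrightarrow> h' \<omega> = (\<Sum>x\<leftarrow>xs. g x \<omega>)"
  shows "gain_from \<rho>' h'"
proof -
  obtain xs where xs: "\<forall>x\<in>set xs. elementary_from \<rho> x" "\<forall>\<omega>\<in>space M. h \<omega> = (\<Sum>x\<leftarrow>xs. elementary_gain x \<omega>)"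
    using assms(1) unfolding gain_from_def by blast
  have "gain_from \<rho>' (\<lambda>\<omega>. \<Sum>x\<leftarrow>xs. g x \<omega>)" using xs(1) assms(2) by (intro gain_from_sum_list) auto
  then show ?thesis using xs by (elim gain_from_cong) (auto simp: assms(3))
qed

lemma gain_from_cmult:
  assumes "gain_from \<rho> h" shows "gain_from \<rho> (\<lambda>\<omega>. c * h \<omega>)"
proof (rule gain_from_cases[OF assms])
  fix x assume x: "elementary_from \<rho> x"
  obtain a b \<xi> where [simp]: "x = (a, b, \<xi>)" by (cases x)
  obtain C where C: "\<forall>\<omega>\<in>space M. norm (\<xi> \<omega>) \<le> C" using x by (auto simp: elementary_from_def)
  have "\<forall>\<omega>\<in>space M. norm (c *\<^sub>R \<xi> \<omega>) \<le> \<bar>c\<bar> * C" using C by (auto intro: mult_left_mono)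
  then have "elementary_from \<rho> (a, b, \<lambda>\<omega>. c *\<^sub>R \<xi> \<omega>)"
    using x by (auto simp: elementary_from_def)
  then have "gain_from \<rho> (elementary_gain (a, b, \<lambda>\<omega>. c *\<^sub>R \<xi> \<omega>))" by (rule elementary_gain_from)
  then show "gain_from \<rho> (\<lambda>\<omega>. c * elementary_gain x \<omega>)" by (simp add: elementary_gain_def)
qed (simp add: sum_list_const_mult)

text \<open>Whether \<open>B\<close> occurs is known at \<rho> and no effective trade starts
  earlier, so the strategy can be run on \<open>B\<close> alone. It may then be regarded as starting
  at any \<rho>' that is no later than \<rho> on \<open>B\<close>.\<close>

lemma gain_from_restrict:
  assumes \<rho>: "\<rho> \<in> ST" and h: "gain_from \<rho> h" and B: "B \<in> sets (pre_sigma \<rho>)"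
    and le: "\<And>\<omega>. \<omega> \<in> B \<Longrightarrow> \<rho>' \<omega> \<le> \<rho> \<omega>"
  shows "gain_from \<rho>' (\<lambda>\<omega>. indicator B \<omega> * h \<omega>)"
proof (rule gain_from_cases[OF h])
  fix x assume x: "elementary_from \<rho> x"
  obtain a b \<xi> where [simp]: "x = (a, b, \<xi>)" by (cases x)
  \<comment> \<open>\<open>B\<close> itself need not be known at \<open>a\<close>, only its part
    where \<rho> is at most \<open>a\<close>; elsewhere the trade has no gain anyway.\<close>
  define \<xi>' where "\<xi>' \<omega> = indicator {\<omega>\<in>B. \<rho> \<omega> \<le> a \<omega>} \<omega> *\<^sub>R \<xi> \<omega>" for \<omega>
  have a: "a \<in> ST" and \<xi>: "\<xi> \<in> borel_measurable (pre_sigma a)" using x by (auto simp: elementary_from_def)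
  obtain C where C: "\<forall>\<omega>\<in>space M. norm (\<xi> \<omega>) \<le> C" using x by (auto simp: elementary_from_def)
  have "\<xi>' \<in> borel_measurable (pre_sigma a)"
    unfolding \<xi>'_def
    by (intro borel_measurable_scaleR borel_measurable_indicator \<xi> pre_sigma_le_Int[OF \<rho> a B])
  moreover have "norm (\<xi>' \<omega>) \<le> C" if "\<omega> \<in> space M" for \<omega>
  proof -
    have "norm (\<xi>' \<omega>) \<le> norm (\<xi> \<omega>)" by (simp add: \<xi>'_def indicator_def)
    then show ?thesis using C that by (auto intro: order_trans)
  qed
  moreover have "\<rho>' \<omega> \<le> a \<omega>" if "\<xi>' \<omega> \<noteq> 0" for \<omega>
  proof -
    have "\<omega> \<in> B \<and> \<rho> \<omega> \<le> a \<omega>" using that by (rule contrapos_np) (simp add: \<xi>'_def indicator_def)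
    then show ?thesis using le[of \<omega>] by simp
  qed
  ultimately have "elementary_from \<rho>' (a, b, \<xi>')"
    using x unfolding elementary_from_def by auto
  then have "gain_from \<rho>' (elementary_gain (a, b, \<xi>'))" by (rule elementary_gain_from)
  then show "gain_from \<rho>' (\<lambda>\<omega>. indicator B \<omega> * elementary_gain x \<omega>)"
  proof (rule gain_from_cong)
    fix \<omega> assume \<omega>: "\<omega> \<in> space M"
    have "a \<omega> = b \<omega> \<or> \<xi> \<omega> = 0 \<or> \<rho> \<omega> \<le> a \<omega>" using x \<omega> by (auto simp: elementary_from_def less_le)
    then show "elementary_gain (a, b, \<xi>') \<omega> = indicator B \<omega> * elementary_gain x \<omega>"
      by (auto simp: elementary_gain_def \<xi>'_def indicator_def)
  qed
qed (simp add: sum_list_const_mult)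

lemma elementary_fromD:
  assumes "elementary_from \<rho> (a, b, \<xi>)"
  shows "a \<in> ST" "admissible b" "b \<in> ST" "\<And>\<omega>. \<omega> \<in> space M \<Longrightarrow> 0 \<le> a \<omega> \<and> a \<omega> \<le> b \<omega> \<and> b \<omega> \<le> T"
    "\<xi> \<in> borel_measurable (pre_sigma a)" "\<exists>C. \<forall>\<omega>\<in>space M. norm (\<xi> \<omega>) \<le> C"
    "\<And>\<omega>. \<omega> \<in> space M \<Longrightarrow> a \<omega> < b \<omega> \<Longrightarrow> \<xi> \<omega> \<noteq> 0 \<Longrightarrow> \<rho> \<omega> \<le> a \<omega>"
  using assms STD(2)[of a] STD(3)[of b] by (auto simp: elementary_from_def admissible_def)

lemma elementary_gain_L2:
  assumes x: "elementary_from \<rho> x" shows "elementary_gain x \<in> L2 M"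
proof -
  obtain a b \<xi> where [simp]: "x = (a, b, \<xi>)" by (cases x)
  note x = elementary_fromD[OF x[simplified]]
  obtain C where C: "\<forall>\<omega>\<in>space M. norm (\<xi> \<omega>) \<le> C" using x(6) by blast
  have ab: "0 \<le> a \<omega> \<and> a \<omega> \<le> T" "0 \<le> b \<omega> \<and> b \<omega> \<le> T" if "\<omega> \<in> space M" for \<omega>
    using x(4)[OF that] by linarith+
  note [measurable] = measurable_pre_sigma_M[OF x(1,5)]
    S_at_measurable[OF STD(4)[OF x(1)] ab(1)] S_at_measurable[OF STD(4)[OF x(3)] ab(2)]
  show ?thesis
  proof (rule L2_dominated)
    show "(\<lambda>\<omega>. C * (norm (S (b \<omega>) \<omega>) + norm (S (a \<omega>) \<omega>))) \<in> L2 M"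
      using x(4) ab by (intro L2_cmult L2_add admissible_norm_L2[OF x(2)] STD(4)[OF x(3)] STD(4)[OF x(1)]) auto
    show "elementary_gain x \<in> borel_measurable M" by (simp add: elementary_gain_def)
    show "AE \<omega> in M. \<bar>elementary_gain x \<omega>\<bar> \<le> \<bar>C * (norm (S (b \<omega>) \<omega>) + norm (S (a \<omega>) \<omega>))\<bar>"
    proof (rule AE_I2)
      fix \<omega> assume \<omega>: "\<omega> \<in> space M"
      have C0: "0 \<le> C" using C \<omega> norm_ge_zero[of "\<xi> \<omega>"] by (meson order_trans)
      have "\<bar>elementary_gain x \<omega>\<bar> \<le> norm (\<xi> \<omega>) * norm (S (b \<omega>) \<omega> - S (a \<omega>) \<omega>)"
        by (simp add: elementary_gain_def Cauchy_Schwarz_ineq2)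
      also have "\<dots> \<le> C * (norm (S (b \<omega>) \<omega>) + norm (S (a \<omega>) \<omega>))"
        using C \<omega> C0 by (intro mult_mono norm_triangle_ineq4) auto
      finally show "\<bar>elementary_gain x \<omega>\<bar> \<le> \<bar>C * (norm (S (b \<omega>) \<omega>) + norm (S (a \<omega>) \<omega>))\<bar>" by linarith
    qed
  qed
qed

lemma gain_from_L2:
  assumes "gain_from \<rho> h" shows "h \<in> L2 M"
proof -
  obtain xs where xs: "\<forall>x\<in>set xs. elementary_from \<rho> x" "\<forall>\<omega>\<in>space M. h \<omega> = (\<Sum>x\<leftarrow>xs. elementary_gain x \<omega>)"
    using assms unfolding gain_from_def by blast
  have "(\<lambda>\<omega>. \<Sum>x\<leftarrow>xs. elementary_gain x \<omega>) \<in> L2 M"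
    using xs(1) by (induction xs) (auto intro: L2_add L2_zero_fun elementary_gain_L2)
  then show ?thesis using xs(2) by (subst L2_cong) auto
qed

text \<open>The wealth process is described by the properties that stopping arguments use: what has
  been earned up to a stopping time, and what is earned after it, are again gains. All clauses are
  additive, so it suffices to verify them for single trades.\<close>

definition gain_process :: "(real \<Rightarrow> 'a \<Rightarrow> real) \<Rightarrow> bool" where
  "gain_process V \<longleftrightarrow>
     (\<forall>t\<in>{0..T}. V t \<in> borel_measurable (F t)) \<and>
     (\<forall>\<omega>\<in>space M. continuous_on {0..T} (\<lambda>t. V t \<omega>) \<and> V 0 \<omega> = 0) \<and>
     (\<forall>\<sigma>\<in>ST. gain_from (\<lambda>\<omega>. 0) (\<lambda>\<omega>. V (\<sigma> \<omega>) \<omega>) \<and> gain_from \<sigma> (\<lambda>\<omega>. V T \<omega> - V (\<sigma> \<omega>) \<omega>))"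

lemma elementary_gain_process:
  assumes x: "elementary_from \<rho> (a, b, \<xi>)"
  defines "V \<equiv> \<lambda>t \<omega>. \<xi> \<omega> \<bullet> (S (min (b \<omega>) t) \<omega> - S (min (a \<omega>) t) \<omega>)"
  shows "gain_process V" "\<And>\<omega>. \<omega> \<in> space M \<Longrightarrow> V T \<omega> = elementary_gain (a, b, \<xi>) \<omega>"
proof -
  note x = elementary_fromD[OF x]
  show VT: "V T \<omega> = elementary_gain (a, b, \<xi>) \<omega>" if "\<omega> \<in> space M" for \<omega>
    using x(4)[OF that] by (simp add: V_def elementary_gain_def min_absorb1)
  show "gain_process V" unfolding gain_process_def
  proof (intro conjI ballI)
    fix t assume t: "t \<in> {0..T}"
    note [measurable] = S_min_measurable[OF x(1), of t] S_min_measurable[OF x(3), of t]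
    have tST: "(\<lambda>\<omega>. t) \<in> ST" using t by (intro ST_const) auto
    \<comment> \<open>Where \<open>a\<close> exceeds \<open>t\<close> the increment of
      \<open>S\<close> vanishes, so the holding may be cut off there, which makes it known at
      \<open>t\<close>.\<close>
    have \<xi>: "(\<lambda>\<omega>. indicator {\<omega>\<in>space M. a \<omega> \<le> t} \<omega> *\<^sub>R \<xi> \<omega>) \<in> borel_measurable (F t)"
      using measurable_pre_sigma_restrict[OF x(1) tST x(5) pre_sigma_space]
        measurable_cong_sets[OF pre_sigma_const[of t] refl] by blast
    have "(\<lambda>\<omega>. (indicator {\<omega>\<in>space M. a \<omega> \<le> t} \<omega> *\<^sub>R \<xi> \<omega>) \<bullet>
        (S (min (b \<omega>) t) \<omega> - S (min (a \<omega>) t) \<omega>)) \<in> borel_measurable (F t)"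
      using t by (intro borel_measurable_inner \<xi> borel_measurable_diff) (auto intro: S_min_measurable x)
    moreover have "V t \<omega> = (indicator {\<omega>\<in>space M. a \<omega> \<le> t} \<omega> *\<^sub>R \<xi> \<omega>) \<bullet>
        (S (min (b \<omega>) t) \<omega> - S (min (a \<omega>) t) \<omega>)" if "\<omega> \<in> space (F t)" for \<omega>
      using that x(4)[of \<omega>] by (cases "a \<omega> \<le> t") (auto simp: V_def space_F min_absorb2)
    ultimately show "V t \<in> borel_measurable (F t)" by (subst measurable_cong) auto
  next
    fix \<omega> assume \<omega>: "\<omega> \<in> space M"
    show "V 0 \<omega> = 0" using x(4)[OF \<omega>] by (simp add: V_def min_absorb2)
    have "continuous_on {0..T} (\<lambda>t. S (min (c \<omega>) t) \<omega>)" if "c \<in> ST" for c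
      using STD(2,3)[OF that \<omega>] by (intro continuous_on_compose2[OF S_continuous[OF \<omega>]] continuous_intros) auto
    then show "continuous_on {0..T} (\<lambda>t. V t \<omega>)"
      unfolding V_def using x by (intro continuous_intros) auto
  next
    fix \<sigma> assume \<sigma>: "\<sigma> \<in> ST"
    show "gain_from (\<lambda>\<omega>. 0) (\<lambda>\<omega>. V (\<sigma> \<omega>) \<omega>)"
    proof (rule gain_from_cong[OF elementary_gain_from])
      \<comment> \<open>Stopping at \<sigma> shortens the trading interval; the outer maximum makes
        it empty rather than reversed when \<sigma> comes before \<open>a\<close>.\<close>
      let ?b = "\<lambda>\<omega>. max (a \<omega>) (min (b \<omega>) (\<sigma> \<omega>))"
      have b: "?b \<in> ST" by (intro ST_max ST_min x \<sigma>)
      have "admissible ?b" by (rule admissible_mono[OF x(2) b]) (use x(4) in auto)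
      then show "elementary_from (\<lambda>\<omega>. 0) (a, ?b, \<xi>)"
        unfolding elementary_from_def using x by auto
      show "elementary_gain (a, ?b, \<xi>) \<omega> = V (\<sigma> \<omega>) \<omega>" if "\<omega> \<in> space M" for \<omega>
        using x(4)[OF that] by (cases "\<sigma> \<omega> \<le> a \<omega>") (auto simp: V_def elementary_gain_def min_def max_def)
    qed
    show "gain_from \<sigma> (\<lambda>\<omega>. V T \<omega> - V (\<sigma> \<omega>) \<omega>)"
    proof (rule gain_from_cong[OF elementary_gain_from])
      \<comment> \<open>The remaining interval after \<sigma>; the outer minimum empties it when
        \<sigma> comes after \<open>b\<close>.\<close>
      let ?a = "\<lambda>\<omega>. min (max (a \<omega>) (\<sigma> \<omega>)) (b \<omega>)"
      have a: "?a \<in> ST" by (intro ST_max ST_min x \<sigma>)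
      have "\<xi> \<in> borel_measurable (pre_sigma ?a)"
        by (rule measurable_pre_sigma_mono[OF x(1) a x(5)]) (use x(4) in auto)
      then show "elementary_from \<sigma> (?a, b, \<xi>)"
        unfolding elementary_from_def using x a by (auto simp: min_def max_def split: if_splits)
      show "elementary_gain (?a, b, \<xi>) \<omega> = V T \<omega> - V (\<sigma> \<omega>) \<omega>" if "\<omega> \<in> space M" for \<omega>
        using x(4)[OF that] unfolding VT[OF that]
        by (cases "\<sigma> \<omega> \<le> a \<omega>"; cases "\<sigma> \<omega> \<le> b \<omega>")
          (auto simp: V_def elementary_gain_def min_def max_def inner_diff_right)
    qed
  qed
qed

lemma gain_process_zero: "gain_process (\<lambda>t \<omega>. 0)"
  by (auto simp: gain_process_def intro: gain_from_zero)

lemma gain_process_add: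
  assumes V: "gain_process V" and W: "gain_process W" shows "gain_process (\<lambda>t \<omega>. V t \<omega> + W t \<omega>)"
  unfolding gain_process_def
proof (intro conjI ballI)
  fix \<sigma> assume \<sigma>: "\<sigma> \<in> ST"
  have "gain_from \<sigma> (\<lambda>\<omega>. (V T \<omega> - V (\<sigma> \<omega>) \<omega>) + (W T \<omega> - W (\<sigma> \<omega>) \<omega>))"
    using V W \<sigma> by (intro gain_from_add) (auto simp: gain_process_def)
  then show "gain_from \<sigma> (\<lambda>\<omega>. V T \<omega> + W T \<omega> - (V (\<sigma> \<omega>) \<omega> + W (\<sigma> \<omega>) \<omega>))"
    by (rule gain_from_cong) simp
qed (use V W in \<open>auto simp: gain_process_def intro!: borel_measurable_add continuous_intros gain_from_add\<close>)

lemma gain_from_process: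
  assumes "gain_from \<rho> h"
  obtains V where "gain_process V" "\<And>\<omega>. \<omega> \<in> space M \<Longrightarrow> V T \<omega> = h \<omega>"
proof -
  obtain xs where xs: "\<forall>x\<in>set xs. elementary_from \<rho> x" "\<forall>\<omega>\<in>space M. h \<omega> = (\<Sum>x\<leftarrow>xs. elementary_gain x \<omega>)"
    using assms unfolding gain_from_def by blast
  have "\<exists>V. gain_process V \<and> (\<forall>\<omega>\<in>space M. V T \<omega> = (\<Sum>x\<leftarrow>xs. elementary_gain x \<omega>))"
    using xs(1)
  proof (induction xs)
    case Nil
    then show ?case using gain_process_zero by (intro exI[of _ "\<lambda>t \<omega>. 0"]) auto
  next
    case (Cons x xs)
    obtain a b \<xi> where x: "x = (a, b, \<xi>)" by (cases x)
    obtain V where V: "gain_process V" "\<forall>\<omega>\<in>space M. V T \<omega> = (\<Sum>x\<leftarrow>xs. elementary_gain x \<omega>)"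
      using Cons by auto
    have "elementary_from \<rho> (a, b, \<xi>)" using Cons.prems x by auto
    note W = elementary_gain_process[OF this]
    show ?case
    proof (rule exI, rule conjI, rule gain_process_add[OF W(1) V(1)], rule ballI)
      fix \<omega> assume \<omega>: "\<omega> \<in> space M"
      show "\<xi> \<omega> \<bullet> (S (min (b \<omega>) T) \<omega> - S (min (a \<omega>) T) \<omega>) + V T \<omega> = (\<Sum>x\<leftarrow>x # xs. elementary_gain x \<omega>)"
        using V(2) \<omega> unfolding W(2)[OF \<omega>] by (simp add: x)
    qed
  qed
  then show thesis using xs(2) that by auto
qed

section \<open>Passage between simple strategies and sums of elementary trades\<close>

lemma simple_strategiesE:
  assumes "\<theta> \<in> simple_strategies M F T S"
  obtains m \<sigma> \<xi> \<tau> n where "1 \<le> m"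
    and "\<theta> = (\<lambda>t \<omega>. \<Sum>i = 1..<m. indicator {\<sigma> i \<omega><..\<sigma> (Suc i) \<omega>} t *\<^sub>R \<xi> i \<omega>)"
    and "\<And>i. i \<in> {1..m} \<Longrightarrow> \<sigma> i \<in> ST"
    and "\<And>i \<omega>. i \<in> {1..<m} \<Longrightarrow> \<omega> \<in> space M \<Longrightarrow> \<sigma> i \<omega> \<le> \<sigma> (Suc i) \<omega>"
    and "square_localizing M F T S \<tau>" "\<And>\<omega>. \<omega> \<in> space M \<Longrightarrow> \<sigma> m \<omega> \<le> \<tau> n \<omega>"
    and "\<And>i. i \<in> {1..<m} \<Longrightarrow> \<xi> i \<in> borel_measurable (pre_sigma (\<sigma> i))"
    and "\<And>i. i \<in> {1..<m} \<Longrightarrow> \<exists>C. \<forall>\<omega>\<in>space M. norm (\<xi> i \<omega>) \<le> C"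
  using assms unfolding simple_strategies_def mem_Collect_eq by (elim exE conjE)
    (rule that, assumption, assumption, blast, blast, assumption, blast, blast, blast)

lemma simple_strategy_gain_from:
  assumes \<theta>: "\<theta> \<in> simple_strategies M F T S" and \<rho>: "\<rho> \<in> ST"
  shows "gain_from \<rho> (gains (start_after \<rho> T \<theta>) S T)"
proof -
  obtain m \<sigma> \<xi> \<tau> n where m: "1 \<le> m"
    and \<theta>_eq: "\<theta> = (\<lambda>t \<omega>. \<Sum>i = 1..<m. indicator {\<sigma> i \<omega><..\<sigma> (Suc i) \<omega>} t *\<^sub>R \<xi> i \<omega>)"
    and \<sigma>: "\<And>i. i \<in> {1..m} \<Longrightarrow> \<sigma> i \<in> ST"
    and mono: "\<And>i \<omega>. i \<in> {1..<m} \<Longrightarrow> \<omega> \<in> space M \<Longrightarrow> \<sigma> i \<omega> \<le> \<sigma> (Suc i) \<omega>"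
    and \<tau>: "square_localizing M F T S \<tau>" "\<And>\<omega>. \<omega> \<in> space M \<Longrightarrow> \<sigma> m \<omega> \<le> \<tau> n \<omega>"
    and \<xi>: "\<And>i. i \<in> {1..<m} \<Longrightarrow> \<xi> i \<in> borel_measurable (pre_sigma (\<sigma> i))"
      "\<And>i. i \<in> {1..<m} \<Longrightarrow> \<exists>C. \<forall>\<omega>\<in>space M. norm (\<xi> i \<omega>) \<le> C"
    by (rule simple_strategiesE[OF \<theta>]) (rule that, assumption, assumption, blast, blast, assumption, blast, blast, blast)
  have le_m: "\<sigma> (m - k) \<omega> \<le> \<sigma> m \<omega>" if "\<omega> \<in> space M" "k < m" for k \<omega>
    using that(2)
  proof (induction k)
    case (Suc k)
    then have "\<sigma> (m - Suc k) \<omega> \<le> \<sigma> (Suc (m - Suc k)) \<omega>" by (intro mono that) auto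
    also have "Suc (m - Suc k) = m - k" using Suc.prems by simp
    finally show ?case using Suc by simp
  qed simp
  have adm: "admissible (\<sigma> i)" if "i \<in> {1..m}" for i
  proof (rule admissible_mono[OF square_localizing_admissible[OF \<tau>(1)] \<sigma>[OF that]])
    show "\<sigma> i \<omega> \<le> \<tau> n \<omega>" if "\<omega> \<in> space M" for \<omega>
      using le_m[OF that, of "m - i"] \<open>i \<in> {1..m}\<close> \<tau>(2)[OF that] by auto
  qed
  \<comment> \<open>The interval clipped at \<rho>. If \<rho> lies beyond it, both end points become
    \<open>\<sigma> (Suc i)\<close> and the trade earns nothing, in agreement with the integral
    started after \<rho>.\<close>
  define x where "x i = (\<lambda>\<omega>. min (max (\<rho> \<omega>) (\<sigma> i \<omega>)) (\<sigma> (Suc i) \<omega>), \<sigma> (Suc i), \<xi> i)" for i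
  have x: "elementary_from \<rho> (x i)" if i: "i \<in> {1..<m}" for i
  proof -
    let ?a = "\<lambda>\<omega>. min (max (\<rho> \<omega>) (\<sigma> i \<omega>)) (\<sigma> (Suc i) \<omega>)"
    have a: "?a \<in> ST" using i by (intro ST_max ST_min \<sigma> \<rho>) auto
    have "\<xi> i \<in> borel_measurable (pre_sigma ?a)"
      by (rule measurable_pre_sigma_mono[OF \<sigma> a \<xi>(1)]) (use i mono[OF i] in auto)
    then show ?thesis
      unfolding elementary_from_def x_def using a adm[of "Suc i"] i \<xi>(2)[OF i] by auto
  qed
  have "gain_from \<rho> (\<lambda>\<omega>. \<Sum>i\<in>{1..<m}. elementary_gain (x i) \<omega>)"
    by (intro gain_from_sum elementary_gain_from x)
  then show ?thesis
  proof (rule gain_from_cong)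
    fix \<omega> assume \<omega>: "\<omega> \<in> space M"
    have "gains (start_after \<rho> T \<theta>) S T \<omega> =
        (\<Sum>i = 1..<m. \<xi> i \<omega> \<bullet> (S (max (\<rho> \<omega>) (\<sigma> (Suc i) \<omega>)) \<omega> - S (max (\<rho> \<omega>) (\<sigma> i \<omega>)) \<omega>))"
      by (rule gains_start_after[OF _ _ _ \<theta>_eq]) (use STD(2,3)[OF \<sigma> \<omega>] STD(2,3)[OF \<rho> \<omega>] mono \<omega> in auto)
    also have "\<dots> = (\<Sum>i\<in>{1..<m}. elementary_gain (x i) \<omega>)"
    proof (rule sum.cong[OF refl])
      fix i assume "i \<in> {1..<m}"
      then show "\<xi> i \<omega> \<bullet> (S (max (\<rho> \<omega>) (\<sigma> (Suc i) \<omega>)) \<omega> - S (max (\<rho> \<omega>) (\<sigma> i \<omega>)) \<omega>) = elementary_gain (x i) \<omega>"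
        using mono[of i \<omega>] \<omega> by (cases "\<rho> \<omega> \<le> \<sigma> (Suc i) \<omega>") (auto simp: x_def elementary_gain_def)
    qed
    finally show "(\<Sum>i\<in>{1..<m}. elementary_gain (x i) \<omega>) = gains (start_after \<rho> T \<theta>) S T \<omega>" ..
  qed
qed

lemma start_after_zero:
  assumes "\<theta> \<in> simple_strategies M F T S" "\<omega> \<in> space M"
  shows "gains (start_after (\<lambda>\<omega>. 0) T \<theta>) S T \<omega> = gains \<theta> S T \<omega>"
proof -
  obtain m \<sigma> \<xi> \<tau> n where m: "1 \<le> m"
    and \<theta>_eq: "\<theta> = (\<lambda>t \<omega>. \<Sum>i = 1..<m. indicator {\<sigma> i \<omega><..\<sigma> (Suc i) \<omega>} t *\<^sub>R \<xi> i \<omega>)"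
    and \<sigma>: "\<And>i. i \<in> {1..m} \<Longrightarrow> \<sigma> i \<in> ST"
    and mono: "\<And>i \<omega>. i \<in> {1..<m} \<Longrightarrow> \<omega> \<in> space M \<Longrightarrow> \<sigma> i \<omega> \<le> \<sigma> (Suc i) \<omega>"
    and \<tau>: "square_localizing M F T S \<tau>" "\<And>\<omega>. \<omega> \<in> space M \<Longrightarrow> \<sigma> m \<omega> \<le> \<tau> n \<omega>"
    and \<xi>: "\<And>i. i \<in> {1..<m} \<Longrightarrow> \<xi> i \<in> borel_measurable (pre_sigma (\<sigma> i))"
      "\<And>i. i \<in> {1..<m} \<Longrightarrow> \<exists>C. \<forall>\<omega>\<in>space M. norm (\<xi> i \<omega>) \<le> C"
    by (rule simple_strategiesE[OF assms(1)]) (rule that, assumption, assumption, blast, blast, assumption, blast, blast, blast)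
  have "start_after (\<lambda>\<omega>. 0) T \<theta> t \<omega> = \<theta> t \<omega>" for t
  proof (cases "t \<in> {0<..T}")
    case False
    have "indicator {\<sigma> i \<omega><..\<sigma> (Suc i) \<omega>} t *\<^sub>R \<xi> i \<omega> = 0" if "i \<in> {1..<m}" for i
      using STD(2)[OF \<sigma>, of i \<omega>] STD(3)[OF \<sigma>, of "Suc i" \<omega>] that False assms(2) by (auto simp: indicator_def)
    then have "\<theta> t \<omega> = 0" unfolding \<theta>_eq by (rule sum.neutral[OF ballI])
    then show ?thesis by (simp add: start_after_def)
  qed (simp add: start_after_def)
  then show ?thesis by (simp add: gains_def)
qed

text \<open>Sorting the end points of the overlapping trading intervals yields a grid of stopping times.\<close>

lemma gain_from_simple_strategy:
  assumes h: "gain_from \<rho> h"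
  obtains \<theta> where "\<theta> \<in> simple_strategies M F T S"
    "\<And>\<omega>. \<omega> \<in> space M \<Longrightarrow> gains (start_after \<rho> T \<theta>) S T \<omega> = h \<omega>"
    "\<And>\<omega>. \<omega> \<in> space M \<Longrightarrow> gains \<theta> S T \<omega> = h \<omega>"
proof -
  obtain xs where xs: "\<forall>x\<in>set xs. elementary_from \<rho> x" "\<forall>\<omega>\<in>space M. h \<omega> = (\<Sum>x\<leftarrow>xs. elementary_gain x \<omega>)"
    using h unfolding gain_from_def by blast
  define N where "N = length xs"
  define a b \<xi> where "a j = fst (xs ! j)" and "b j = fst (snd (xs ! j))" and "\<xi> j = snd (snd (xs ! j))" for j
  have "elementary_from \<rho> (a j, b j, \<xi> j)" if "j < N" for j
    using xs(1) that by (auto simp: a_def b_def \<xi>_def N_def)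
  note elem = elementary_fromD[OF this]
  have h_eq: "h \<omega> = (\<Sum>j<N. \<xi> j \<omega> \<bullet> (S (b j \<omega>) \<omega> - S (a j \<omega>) \<omega>))" if "\<omega> \<in> space M" for \<omega>
  proof -
    have "h \<omega> = (\<Sum>x\<leftarrow>xs. elementary_gain x \<omega>)" using xs(2) that by blast
    also have "\<dots> = (\<Sum>j<N. elementary_gain (xs ! j) \<omega>)"
      by (simp add: sum_list_sum_nth N_def atLeast0LessThan)
    finally show ?thesis
      by (simp add: elementary_gain_def a_def b_def \<xi>_def case_prod_beta)
  qed
  \<comment> \<open>The constant 0 keeps the list of grid points non-empty, so that a gain without
    any trades also yields a legitimate strategy.\<close>
  define ps :: "('a \<Rightarrow> real) list" where "ps = (\<lambda>\<omega>. 0) # map a [0..<N] @ map b [0..<N]"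
  define m where "m = length ps"
  define pts where "pts \<omega> = sort (map (\<lambda>p. p \<omega>) ps)" for \<omega>
  \<comment> \<open>Strategies number their times from 1, list positions start at 0.\<close>
  define \<sigma> where "\<sigma> i \<omega> = pts \<omega> ! (i - 1)" for i \<omega>
  have m: "1 \<le> m" by (simp add: m_def ps_def)
  have len: "length (pts \<omega>) = m" for \<omega> by (simp add: pts_def m_def)
  have set_pts: "set (pts \<omega>) = (\<lambda>p. p \<omega>) ` set ps" for \<omega> by (simp add: pts_def)
  have adm0: "admissible (\<lambda>\<omega>. 0)"
  proof -
    obtain \<tau>0 where "square_localizing M F T S \<tau>0"
      using S_locally_square_integrable by (auto simp: locally_square_integrable_def)
    from square_localizing_admissible[OF this, of 0] have "admissible (\<tau>0 0)" .
    then show ?thesis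
      by (rule admissible_mono) (use horizon_pos STD(2)[OF admissible_ST[OF \<open>admissible (\<tau>0 0)\<close>]] in \<open>auto intro: ST_const\<close>)
  qed
  have adm: "admissible p" if "p \<in> set ps" for p
    using that adm0 elem(2) admissible_mono[OF elem(2) elem(1)] elem(4) by (auto simp: ps_def)
  have \<sigma>_mem: "\<exists>p\<in>set ps. \<sigma> i \<omega> = p \<omega>" if "i \<in> {1..m}" for i \<omega>
  proof -
    have "\<sigma> i \<omega> \<in> set (pts \<omega>)" unfolding \<sigma>_def using that by (intro nth_mem) (auto simp: len)
    then show ?thesis by (auto simp: set_pts)
  qed
  have \<sigma>_ST: "\<sigma> i \<in> ST" if i: "i \<in> {1..m}" for i
  proof (rule ST_I)
    show "0 \<le> \<sigma> i \<omega> \<and> \<sigma> i \<omega> \<le> T" if "\<omega> \<in> space M" for \<omega>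
      using \<sigma>_mem[OF i, of \<omega>] STD(2,3)[OF admissible_ST[OF adm] that] by auto
    fix t
    \<comment> \<open>The sum counts the grid points that are at most \<open>t\<close>; each summand
      is measurable at time \<open>t\<close>.\<close>
    have "\<sigma> i \<omega> \<le> t \<longleftrightarrow> real (i - 1) < (\<Sum>k<m. indicator {\<omega>\<in>space M. (ps ! k) \<omega> \<le> t} \<omega>)"
      if \<omega>: "\<omega> \<in> space M" for \<omega>
    proof -
      have i': "i - 1 < length (map (\<lambda>p. p \<omega>) ps)" using i by (auto simp: m_def)
      have "(\<Sum>k<m. indicator {\<omega>\<in>space M. (ps ! k) \<omega> \<le> t} \<omega>) = real (card {k. k < m \<and> (ps ! k) \<omega> \<le> t})"
        using \<omega> by (auto simp: indicator_def Int_def simp flip: sum.inter_filter intro!: arg_cong[where f=card])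
      moreover have "length (filter (\<lambda>x. x \<le> t) (map (\<lambda>p. p \<omega>) ps)) = card {k. k < m \<and> (ps ! k) \<omega> \<le> t}"
        unfolding length_filter_conv_card by (intro arg_cong[where f=card]) (auto simp: m_def)
      ultimately show ?thesis
        unfolding \<sigma>_def pts_def sort_nth_le_iff[OF i'] by simp
    qed
    then have "{\<omega>\<in>space M. \<sigma> i \<omega> \<le> t} =
        {\<omega>\<in>space (F t). real (i - 1) < (\<Sum>k<m. indicator {\<omega>\<in>space M. (ps ! k) \<omega> \<le> t} \<omega>)}"
      by (auto simp: space_F)
    also have "\<dots> \<in> sets (F t)"
    proof -
      have "{\<omega>\<in>space M. (ps ! k) \<omega> \<le> t} \<in> sets (F t)" if "k < m" for k
        using that by (intro ST_le_sets admissible_ST adm nth_mem) (simp add: m_def)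
      then have [measurable]: "(\<lambda>\<omega>. \<Sum>k<m. indicator {\<omega>\<in>space M. (ps ! k) \<omega> \<le> t} \<omega> :: real) \<in> borel_measurable (F t)"
        by (intro borel_measurable_sum borel_measurable_indicator) auto
      show ?thesis by measurable
    qed
    finally show "{\<omega>\<in>space M. \<sigma> i \<omega> \<le> t} \<in> sets (F t)" .
  qed
  have \<sigma>_mono: "\<sigma> i \<omega> \<le> \<sigma> (Suc i) \<omega>" if "i \<in> {1..<m}" for i \<omega>
    unfolding \<sigma>_def using that by (intro sorted_nth_mono) (auto simp: len pts_def m_def)
  \<comment> \<open>All end points belong to the grid, so no trade starts or ends strictly between
    neighbours; the trades active after \<open>\<sigma> i\<close> are those that have started by
    then and have not ended.\<close>
  define \<eta> where "\<eta> i \<omega> = (\<Sum>j<N. of_bool (a j \<omega> \<le> \<sigma> i \<omega> \<and> \<sigma> i \<omega> < b j \<omega>) *\<^sub>R \<xi> j \<omega>)" for i \<omega>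
  define \<theta> where "\<theta> = (\<lambda>t \<omega>. \<Sum>i = 1..<m. indicator {\<sigma> i \<omega><..\<sigma> (Suc i) \<omega>} t *\<^sub>R \<eta> i \<omega>)"
  have \<eta>_meas: "\<eta> i \<in> borel_measurable (pre_sigma (\<sigma> i))" if i: "i \<in> {1..<m}" for i
  proof -
    have \<sigma>i: "\<sigma> i \<in> ST" using i by (intro \<sigma>_ST) auto
    have "(\<lambda>\<omega>. indicator {\<omega>\<in>space M. \<sigma> i \<omega> < b j \<omega>} \<omega> *\<^sub>R
        (indicator {\<omega>\<in>space M. a j \<omega> \<le> \<sigma> i \<omega>} \<omega> *\<^sub>R \<xi> j \<omega>)) \<in> borel_measurable (pre_sigma (\<sigma> i))" if "j < N" for j
      by (intro borel_measurable_scaleR borel_measurable_indicator pre_sigma_less \<sigma>i elem that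
        measurable_pre_sigma_restrict pre_sigma_space)
    then have "(\<lambda>\<omega>. \<Sum>j<N. indicator {\<omega>\<in>space M. \<sigma> i \<omega> < b j \<omega>} \<omega> *\<^sub>R
        (indicator {\<omega>\<in>space M. a j \<omega> \<le> \<sigma> i \<omega>} \<omega> *\<^sub>R \<xi> j \<omega>)) \<in> borel_measurable (pre_sigma (\<sigma> i))"
      by (intro borel_measurable_sum) auto
    then show ?thesis
      by (rule measurable_cong[THEN iffD1, rotated])
        (auto simp: \<eta>_def space_pre_sigma indicator_def intro!: sum.cong)
  qed
  have \<eta>_bdd: "\<exists>C. \<forall>\<omega>\<in>space M. norm (\<eta> i \<omega>) \<le> C" for i
  proof -
    obtain C where C: "\<And>j. j < N \<Longrightarrow> \<forall>\<omega>\<in>space M. norm (\<xi> j \<omega>) \<le> C j" using elem(6) by metis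
    have "norm (\<eta> i \<omega>) \<le> (\<Sum>j<N. C j)" if "\<omega> \<in> space M" for \<omega>
      unfolding \<eta>_def
    proof (rule sum_norm_le)
      fix j assume "j \<in> {..<N}"
      then have "norm (\<xi> j \<omega>) \<le> C j" using C that by auto
      then show "norm (of_bool (a j \<omega> \<le> \<sigma> i \<omega> \<and> \<sigma> i \<omega> < b j \<omega>) *\<^sub>R \<xi> j \<omega>) \<le> C j"
        using norm_ge_zero[of "\<xi> j \<omega>"] by (auto simp del: norm_ge_zero)
    qed
    then show ?thesis by blast
  qed
  \<comment> \<open>Iterated maxima give one admissible time above all grid points, and hence a
    common cap for the strategy.\<close>
  have "\<exists>c. admissible c \<and> (\<forall>p\<in>set ps'. \<forall>\<omega>. p \<omega> \<le> c \<omega>)" if "set ps' \<subseteq> set ps" for ps'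
    using that
  proof (induction ps')
    case Nil
    then show ?case using adm0 by auto
  next
    case (Cons p ps')
    then obtain c where "admissible c" "\<forall>p\<in>set ps'. \<forall>\<omega>. p \<omega> \<le> c \<omega>" by auto
    then show ?case using admissible_max[OF adm[of p], of c] Cons.prems
      by (intro exI[of _ "\<lambda>\<omega>. max (p \<omega>) (c \<omega>)"]) (auto simp: le_max_iff_disj)
  qed
  then obtain c where c: "admissible c" "\<forall>p\<in>set ps. \<forall>\<omega>. p \<omega> \<le> c \<omega>" by blast
  obtain \<tau> where \<tau>: "square_localizing M F T S \<tau>" "\<And>n \<omega>. c \<omega> \<le> \<tau> n \<omega>"
    using admissible_square_localizing[OF c(1)] by blast
  have "\<sigma> m \<omega> \<le> \<tau> 0 \<omega>" for \<omega>
    using \<sigma>_mem[of m \<omega>] m c(2) order_trans[OF _ \<tau>(2)[of \<omega> 0]] by auto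
  then have mem: "\<theta> \<in> simple_strategies M F T S"
    unfolding simple_strategies_def using m \<sigma>_ST \<sigma>_mono \<tau>(1) \<eta>_meas \<eta>_bdd
    by (intro CollectI exI[of _ m] exI[of _ \<sigma>] exI[of _ \<eta>] exI[of _ \<tau>] exI[of _ 0] conjI) (auto simp: \<theta>_def)
  have gains: "gains \<theta> S T \<omega> = h \<omega>" if \<omega>: "\<omega> \<in> space M" for \<omega>
  proof -
    have \<sigma>0T: "0 \<le> \<sigma> i \<omega> \<and> \<sigma> i \<omega> \<le> T" if "i \<in> {1..m}" for i using STD(2,3)[OF \<sigma>_ST[OF that] \<omega>] by auto
    have "gains \<theta> S T \<omega> = (\<Sum>i\<in>{1..<m}. \<eta> i \<omega> \<bullet> (S (min (\<sigma> (Suc i) \<omega>) T) \<omega> - S (min (\<sigma> i \<omega>) T) \<omega>))"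
      unfolding gains_def \<theta>_def using \<sigma>0T \<sigma>_mono horizon_pos by (intro path_integral_step) auto
    also have "\<dots> = (\<Sum>i\<in>{1..<m}. \<eta> i \<omega> \<bullet> (S (\<sigma> (Suc i) \<omega>) \<omega> - S (\<sigma> i \<omega>) \<omega>))"
      using \<sigma>0T by (intro sum.cong refl) (auto simp: min_absorb1)
    \<comment> \<open>Exchanging the sums groups the grid increments by trade, where they telescope
      to the increment over that trade's interval.\<close>
    also have "\<dots> = (\<Sum>j<N. \<xi> j \<omega> \<bullet> (\<Sum>i\<in>{1..<m}.
        of_bool (a j \<omega> \<le> \<sigma> i \<omega> \<and> \<sigma> i \<omega> < b j \<omega>) *\<^sub>R (S (\<sigma> (Suc i) \<omega>) \<omega> - S (\<sigma> i \<omega>) \<omega>)))"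
      unfolding \<eta>_def inner_sum_left inner_sum_right by (subst sum.swap) simp
    also have "\<dots> = h \<omega>" unfolding h_eq[OF \<omega>]
    proof (intro sum.cong refl arg_cong2[where f="(\<bullet>)"])
      fix j assume "j \<in> {..<N}"
      then have j: "j < N" by simp
      have "a j \<in> set ps" "b j \<in> set ps" using j by (auto simp: ps_def)
      then have "a j \<omega> \<in> set (pts \<omega>)" "b j \<omega> \<in> set (pts \<omega>)" by (auto simp: set_pts)
      then have "(\<Sum>i<length (pts \<omega>) - 1. of_bool (a j \<omega> \<le> pts \<omega> ! i \<and> pts \<omega> ! i < b j \<omega>) *\<^sub>R
          (S (pts \<omega> ! Suc i) \<omega> - S (pts \<omega> ! i) \<omega>)) = S (b j \<omega>) \<omega> - S (a j \<omega>) \<omega>"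
        using elem(4)[OF j \<omega>] by (intro telescope_sorted_between) (auto simp: pts_def)
      moreover have "{1..<m} = {Suc 0..<Suc (m - 1)}" using m by auto
      moreover have "(\<Sum>i\<in>{Suc 0..<Suc (m - 1)}. of_bool (a j \<omega> \<le> \<sigma> i \<omega> \<and> \<sigma> i \<omega> < b j \<omega>) *\<^sub>R
          (S (\<sigma> (Suc i) \<omega>) \<omega> - S (\<sigma> i \<omega>) \<omega>)) = (\<Sum>i<m - 1. of_bool (a j \<omega> \<le> pts \<omega> ! i \<and> pts \<omega> ! i < b j \<omega>) *\<^sub>R
          (S (pts \<omega> ! Suc i) \<omega> - S (pts \<omega> ! i) \<omega>))"
        unfolding sum.shift_bounds_Suc_ivl by (simp add: \<sigma>_def atLeast0LessThan)
      ultimately show "(\<Sum>i\<in>{1..<m}. of_bool (a j \<omega> \<le> \<sigma> i \<omega> \<and> \<sigma> i \<omega> < b j \<omega>) *\<^sub>R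
          (S (\<sigma> (Suc i) \<omega>) \<omega> - S (\<sigma> i \<omega>) \<omega>)) = S (b j \<omega>) \<omega> - S (a j \<omega>) \<omega>"
        unfolding len by (simp only:)
    qed
    finally show ?thesis .
  qed
  have start: "start_after \<rho> T \<theta> t \<omega> = \<theta> t \<omega>" if \<omega>: "\<omega> \<in> space M" for t \<omega>
  proof (cases "t \<in> {\<rho> \<omega><..T}")
    case False
    \<comment> \<open>Up to \<rho> every active trade has zero holding: an effective one would start
      at or after \<rho>, but it starts by \<open>\<sigma> i\<close>, which is before
      \<open>t\<close>.\<close>
    have "indicator {\<sigma> i \<omega><..\<sigma> (Suc i) \<omega>} t *\<^sub>R \<eta> i \<omega> = 0" if i: "i \<in> {1..<m}" for i
    proof (cases "t \<in> {\<sigma> i \<omega><..\<sigma> (Suc i) \<omega>}")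
      case True
      then have "t \<le> T" using STD(3)[OF \<sigma>_ST \<omega>, of "Suc i"] i by auto
      then have t: "t \<le> \<rho> \<omega>" using False by auto
      have "of_bool (a j \<omega> \<le> \<sigma> i \<omega> \<and> \<sigma> i \<omega> < b j \<omega>) *\<^sub>R \<xi> j \<omega> = 0" if "j < N" for j
        using elem(7)[OF that \<omega>] True t by (cases "\<xi> j \<omega> = 0") auto
      then have "\<eta> i \<omega> = 0" unfolding \<eta>_def by (intro sum.neutral) blast
      then show ?thesis by simp
    qed simp
    then have "\<theta> t \<omega> = 0" unfolding \<theta>_def by (rule sum.neutral[OF ballI])
    then show ?thesis by (simp add: start_after_def)
  qed (simp add: start_after_def)
  show thesis
  proof (rule that[OF mem])
    show "gains (start_after \<rho> T \<theta>) S T \<omega> = h \<omega>" if "\<omega> \<in> space M" for \<omega>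
      using gains[OF that] start[OF that] by (simp add: gains_def)
  qed (rule gains)
qed

end

section \<open>Densities orthogonal to all gains\<close>

context continuous_market
begin

text \<open>The annihilator of the gains in L2. Neither a sign nor mean 1 is imposed, so that the
  element of minimal norm qualifies before it is normalised and before it is known to be
  positive.\<close>

definition orthogonal_density :: "('a \<Rightarrow> real) \<Rightarrow> bool" where
  "orthogonal_density Z \<longleftrightarrow> Z \<in> L2 M \<and> (\<forall>\<rho> h. gain_from \<rho> h \<longrightarrow> (\<integral>\<omega>. Z \<omega> * h \<omega> \<partial>M) = 0)"

text \<open>The common pivot of the equivalences; dividing by its mean gives the density of a
  probability measure equivalent to \<open>M\<close>.\<close>

definition pricing_density :: "('a \<Rightarrow> real) \<Rightarrow> bool" where
  "pricing_density Z \<longleftrightarrow> orthogonal_density Z \<and> (AE \<omega> in M. 0 < Z \<omega>)"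

lemma simple_strategy_gain_from_0:
  assumes \<theta>: "\<theta> \<in> simple_strategies M F T S" shows "gain_from (\<lambda>\<omega>. 0) (gains \<theta> S T)"
proof -
  have "(\<lambda>\<omega>. 0) \<in> ST" using horizon_pos by (intro ST_const) auto
  from simple_strategy_gain_from[OF \<theta> this] show ?thesis
    by (rule gain_from_cong) (rule start_after_zero[OF \<theta>])
qed

lemma orthogonal_density_iff:
  "orthogonal_density Z \<longleftrightarrow>
     Z \<in> L2 M \<and> (\<forall>\<theta>\<in>simple_strategies M F T S. (\<integral>\<omega>. Z \<omega> * gains \<theta> S T \<omega> \<partial>M) = 0)"
proof -
  have "(\<integral>\<omega>. Z \<omega> * h \<omega> \<partial>M) = 0"
    if *: "\<forall>\<theta>\<in>simple_strategies M F T S. (\<integral>\<omega>. Z \<omega> * gains \<theta> S T \<omega> \<partial>M) = 0" "gain_from \<rho> h" for \<rho> h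
  proof -
    obtain \<theta> where \<theta>: "\<theta> \<in> simple_strategies M F T S" "\<And>\<omega>. \<omega> \<in> space M \<Longrightarrow> gains \<theta> S T \<omega> = h \<omega>"
      using gain_from_simple_strategy[OF *(2)] by metis
    have "(\<integral>\<omega>. Z \<omega> * h \<omega> \<partial>M) = (\<integral>\<omega>. Z \<omega> * gains \<theta> S T \<omega> \<partial>M)"
      by (intro Bochner_Integration.integral_cong) (simp_all add: \<theta>(2))
    then show ?thesis using *(1) \<theta>(1) by auto
  qed
  then show ?thesis
    unfolding orthogonal_density_def using simple_strategy_gain_from_0 by blast
qed

lemma pre_sigma_vimage:
  assumes "x \<in> borel_measurable (pre_sigma \<tau>)" "C \<in> sets borel"
  shows "{\<omega>\<in>space M. x \<omega> \<in> C} \<in> sets (pre_sigma \<tau>)"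
  using measurable_sets[OF assms] by (simp add: space_pre_sigma vimage_def Int_def conj_commute)

text \<open>The sign of \<open>x\<close> is known at \<tau>, so multiplying \<open>g\<close> by it
  gives another gain from \<tau>, which \<open>Z\<close> annihilates. Hence the price of the
  absolute value of \<open>x\<close> equals that of the signed payoff, and Cauchy-Schwarz applies.
  Convergence of payoffs to 0 thus forces the initial capital to 0.\<close>

lemma price_bound:
  assumes Z: "orthogonal_density Z" and \<tau>: "\<tau> \<in> ST" and x: "x \<in> borel_measurable (pre_sigma \<tau>)"
    and g: "gain_from \<tau> g" and xg: "(\<lambda>\<omega>. x \<omega> + g \<omega>) \<in> L2 M"
  shows "x \<in> L2 M" "(\<integral>\<omega>. Z \<omega> * \<bar>x \<omega>\<bar> \<partial>M) \<le> L2_norm M Z * L2_norm M (\<lambda>\<omega>. x \<omega> + g \<omega>)"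
proof -
  have ZL: "Z \<in> L2 M" using Z by (simp add: orthogonal_density_def)
  have gL: "g \<in> L2 M" by (rule gain_from_L2[OF g])
  show xL: "x \<in> L2 M" using L2_diff[OF xg gL] by simp
  define P N where "P = {\<omega>\<in>space M. x \<omega> \<in> {0<..}}" and "N = {\<omega>\<in>space M. x \<omega> \<in> {..<0}}"
  have PN: "P \<in> sets (pre_sigma \<tau>)" "N \<in> sets (pre_sigma \<tau>)"
    unfolding P_def N_def by (intro pre_sigma_vimage[OF x]; simp)+
  define s :: "'a \<Rightarrow> real" where "s \<omega> = indicator P \<omega> - indicator N \<omega>" for \<omega>
  have s: "\<bar>s \<omega>\<bar> \<le> 1" "\<omega> \<in> space M \<Longrightarrow> s \<omega> * x \<omega> = \<bar>x \<omega>\<bar>" for \<omega>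
    by (auto simp: s_def P_def N_def indicator_def)
  have [measurable]: "P \<in> sets M" "N \<in> sets M" using PN sets_pre_sigma_subset[OF \<tau>] by auto
  have [measurable]: "s \<in> borel_measurable M" unfolding s_def by measurable
  have "gain_from \<tau> (\<lambda>\<omega>. indicator P \<omega> * g \<omega> + (-1) * (indicator N \<omega> * g \<omega>))"
    by (intro gain_from_add gain_from_cmult gain_from_restrict[OF \<tau> g] PN) auto
  then have sg: "gain_from \<tau> (\<lambda>\<omega>. s \<omega> * g \<omega>)" by (rule gain_from_cong) (simp add: s_def left_diff_distrib)
  have sxg: "(\<lambda>\<omega>. s \<omega> * (x \<omega> + g \<omega>)) \<in> L2 M" and sxg_le: "L2_norm M (\<lambda>\<omega>. s \<omega> * (x \<omega> + g \<omega>)) \<le> L2_norm M (\<lambda>\<omega>. x \<omega> + g \<omega>)"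
    using xg s(1) by (auto intro!: L2_dominated[OF xg] L2_norm_mono[OF xg] simp: abs_mult mult_left_le_one_le)
  have "(\<integral>\<omega>. Z \<omega> * \<bar>x \<omega>\<bar> \<partial>M) = (\<integral>\<omega>. Z \<omega> * (s \<omega> * (x \<omega> + g \<omega>)) - Z \<omega> * (s \<omega> * g \<omega>) \<partial>M)"
    by (intro Bochner_Integration.integral_cong) (auto simp: algebra_simps simp flip: s(2))
  also have "\<dots> = (\<integral>\<omega>. Z \<omega> * (s \<omega> * (x \<omega> + g \<omega>)) \<partial>M) - (\<integral>\<omega>. Z \<omega> * (s \<omega> * g \<omega>) \<partial>M)"
    by (intro Bochner_Integration.integral_diff L2_integrable_mult ZL sxg gain_from_L2[OF sg])
  also have "(\<integral>\<omega>. Z \<omega> * (s \<omega> * g \<omega>) \<partial>M) = 0" using Z sg by (auto simp: orthogonal_density_def)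
  also have "(\<integral>\<omega>. Z \<omega> * (s \<omega> * (x \<omega> + g \<omega>)) \<partial>M) - 0 \<le> L2_norm M Z * L2_norm M (\<lambda>\<omega>. x \<omega> + g \<omega>)"
    using L2_Cauchy_Schwarz[OF ZL sxg] mult_left_mono[OF sxg_le L2_norm_nonneg[of M Z]] by linarith
  finally show "(\<integral>\<omega>. Z \<omega> * \<bar>x \<omega>\<bar> \<partial>M) \<le> L2_norm M Z * L2_norm M (\<lambda>\<omega>. x \<omega> + g \<omega>)" .
qed

lemma AE_zero_of_weighted_integral:
  assumes Z: "AE \<omega> in M. 0 < Z \<omega>" "Z \<in> L2 M" and f: "f \<in> L2 M" "AE \<omega> in M. 0 \<le> f \<omega>"
    and le: "(\<integral>\<omega>. Z \<omega> * f \<omega> \<partial>M) \<le> 0"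
  shows "AE \<omega> in M. f \<omega> = 0"
proof -
  have nonneg: "AE \<omega> in M. 0 \<le> Z \<omega> * f \<omega>" using Z(1) f(2) by eventually_elim simp
  then have "(\<integral>\<omega>. Z \<omega> * f \<omega> \<partial>M) = 0" using le integral_nonneg_AE[OF nonneg] by linarith
  then have "AE \<omega> in M. Z \<omega> * f \<omega> = 0"
    using integral_nonneg_eq_0_iff_AE[OF L2_integrable_mult[OF Z(2) f(1)] nonneg] by simp
  with Z(1) show ?thesis by eventually_elim auto
qed

text \<open>\<open>price_bound\<close> bounds the \<open>Z\<close>-weighted integral of the absolute
  capital by the norm of the payoff. For a fixed capital this settles the first part; for varying
  capitals the limit in probability has to be brought in.\<close>

lemma pricing_density_law_of_one_price:
  assumes "pricing_density Z" shows "law_of_one_price M F T S"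
  unfolding law_of_one_price_def
proof (intro conjI ballI allI impI)
  have Z: "orthogonal_density Z" "Z \<in> L2 M" "AE \<omega> in M. 0 < Z \<omega>"
    using assms by (auto simp: pricing_density_def orthogonal_density_def)
  {
    fix \<tau> x \<theta>
    assume \<tau>: "\<tau> \<in> ST" and x: "x \<in> borel_measurable (pre_sigma \<tau>)"
      and *: "(\<forall>n. \<theta> n \<in> simple_strategies M F T S) \<and>
        L2_tendsto M (\<lambda>n \<omega>. x \<omega> + gains (start_after \<tau> T (\<theta> n)) S T \<omega>) (\<lambda>\<omega>. 0)"
    have g: "gain_from \<tau> (gains (start_after \<tau> T (\<theta> n)) S T)" for n
      using * by (intro simple_strategy_gain_from \<tau>) auto
    have xg: "(\<lambda>\<omega>. x \<omega> + gains (start_after \<tau> T (\<theta> n)) S T \<omega>) \<in> L2 M" for n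
      using * by (auto simp: L2_tendsto_def)
    note bound = price_bound[OF Z(1) \<tau> x g xg]
    have "(\<integral>\<omega>. Z \<omega> * \<bar>x \<omega>\<bar> \<partial>M) \<le> 0"
    proof (rule LIMSEQ_le_const)
      show "(\<lambda>n. L2_norm M Z * L2_norm M (\<lambda>\<omega>. x \<omega> + gains (start_after \<tau> T (\<theta> n)) S T \<omega>)) \<longlonglongrightarrow> 0"
        using * by (intro tendsto_mult_right_zero) (simp add: L2_tendsto_def)
    qed (use bound(2) in auto)
    moreover have "(\<lambda>\<omega>. \<bar>x \<omega>\<bar>) \<in> L2 M" by (rule L2_dominated[OF bound(1)]) (use bound(1) in auto)
    ultimately have "AE \<omega> in M. \<bar>x \<omega>\<bar> = 0" by (intro AE_zero_of_weighted_integral[OF Z(3,2)]) auto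
    then show "AE \<omega> in M. x \<omega> = 0" by simp
  next
    fix \<sigma> \<sigma>s x \<theta> y
    assume *: "announcing_sequence M F T \<sigma> \<sigma>s \<and>
        (\<forall>n. x n \<in> borel_measurable (pre_sigma (\<sigma>s n))) \<and>
        (\<forall>n. \<theta> n \<in> simple_strategies M F T S) \<and>
        L2_tendsto M (\<lambda>n \<omega>. x n \<omega> + gains (start_after (\<sigma>s n) T (\<theta> n)) S T \<omega>) (\<lambda>\<omega>. 0) \<and>
        tendsto_in_probability M x y"
    have ST: "\<sigma>s n \<in> ST" and x: "x n \<in> borel_measurable (pre_sigma (\<sigma>s n))" for n
      using * by (auto simp: announcing_sequence_def)
    have g: "gain_from (\<sigma>s n) (gains (start_after (\<sigma>s n) T (\<theta> n)) S T)" for n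
      using * by (intro simple_strategy_gain_from ST) auto
    have xg: "(\<lambda>\<omega>. x n \<omega> + gains (start_after (\<sigma>s n) T (\<theta> n)) S T \<omega>) \<in> L2 M" for n
      using * by (auto simp: L2_tendsto_def)
    note bound = price_bound[OF Z(1) ST x g xg]
    have [measurable]: "x n \<in> borel_measurable M" "y \<in> borel_measurable M" for n
      using * by (auto simp: tendsto_in_probability_def)
    \<comment> \<open>The limit \<open>y\<close> need not be integrable, so it is truncated:
      \<open>v\<close> is at most the absolute value of \<open>x n\<close> plus \<open>u n\<close>,
      and the bounded \<open>u n\<close> converges to 0 in L2 because \<open>x n\<close> converges
      in probability.\<close>
    define u where "u n \<omega> = min 1 \<bar>x n \<omega> - y \<omega>\<bar>" for n \<omega>
    define v where "v \<omega> = min 1 \<bar>y \<omega>\<bar>" for \<omega>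
    have [measurable]: "u n \<in> borel_measurable M" "v \<in> borel_measurable M" for n
      unfolding u_def v_def by measurable
    have uL: "u n \<in> L2 M" and vL: "v \<in> L2 M" for n
      by (rule L2_dominated[OF L2_const[of 1]]; auto simp: u_def v_def)+
    have xL: "(\<lambda>\<omega>. \<bar>x n \<omega>\<bar>) \<in> L2 M" for n by (rule L2_dominated[OF bound(1)[of n]]) auto
    have u_le: "L2_norm M (u n) \<le> \<epsilon> + sqrt (prob {\<omega>\<in>space M. \<epsilon> < \<bar>x n \<omega> - y \<omega>\<bar>})" if "0 < \<epsilon>" for n \<epsilon>
    proof -
      let ?B = "{\<omega>\<in>space M. \<epsilon> < \<bar>x n \<omega> - y \<omega>\<bar>}"
      have B: "?B \<in> sets M" by measurable
      have "L2_norm M (u n) \<le> L2_norm M (\<lambda>\<omega>. \<epsilon> + indicator ?B \<omega>)"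
        using that by (intro L2_norm_mono L2_add L2_const L2_indicator B AE_I2)
          (auto simp: u_def indicator_def)
      also have "\<dots> \<le> L2_norm M (\<lambda>\<omega>. \<epsilon>) + L2_norm M (indicator ?B)"
        by (intro L2_norm_triangle L2_const L2_indicator B)
      also have "\<dots> = \<epsilon> + sqrt (prob ?B)"
        using that B by (simp add: L2_norm_indicator) (simp add: L2_norm_def prob_space)
      finally show ?thesis .
    qed
    have lim_u: "(\<lambda>n. L2_norm M (u n)) \<longlonglongrightarrow> 0"
    proof (rule LIMSEQ_I)
      fix e :: real assume e: "0 < e"
      have "0 < e / 2" using e by simp
      then have "(\<lambda>n. prob {\<omega>\<in>space M. e / 2 < \<bar>x n \<omega> - y \<omega>\<bar>}) \<longlonglongrightarrow> 0"
        using * unfolding tendsto_in_probability_def by blast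
      then have "(\<lambda>n. e / 2 + sqrt (prob {\<omega>\<in>space M. e / 2 < \<bar>x n \<omega> - y \<omega>\<bar>})) \<longlonglongrightarrow> e / 2 + sqrt 0"
        by (intro tendsto_intros)
      then have "\<forall>\<^sub>F n in sequentially. e / 2 + sqrt (prob {\<omega>\<in>space M. e / 2 < \<bar>x n \<omega> - y \<omega>\<bar>}) < e"
        by (rule order_tendstoD(2)) (use e in simp)
      then have "\<forall>\<^sub>F n in sequentially. norm (L2_norm M (u n) - 0) < e"
      proof eventually_elim
        case (elim n)
        then show ?case using u_le[of "e / 2" n] e by (simp add: L2_norm_nonneg)
      qed
      then show "\<exists>N. \<forall>n\<ge>N. norm (L2_norm M (u n) - 0) < e" by (simp add: eventually_sequentially)
    qed
    have "(\<integral>\<omega>. Z \<omega> * v \<omega> \<partial>M) \<le> 0"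
    proof (rule LIMSEQ_le_const)
      have "(\<lambda>n. L2_norm M Z * L2_norm M (\<lambda>\<omega>. x n \<omega> + gains (start_after (\<sigma>s n) T (\<theta> n)) S T \<omega>) +
          L2_norm M Z * L2_norm M (u n)) \<longlonglongrightarrow> 0 + 0"
        using * by (intro tendsto_add tendsto_mult_right_zero lim_u) (simp add: L2_tendsto_def)
      then show "(\<lambda>n. L2_norm M Z * L2_norm M (\<lambda>\<omega>. x n \<omega> + gains (start_after (\<sigma>s n) T (\<theta> n)) S T \<omega>) +
          L2_norm M Z * L2_norm M (u n)) \<longlonglongrightarrow> 0" by simp
      have "(\<integral>\<omega>. Z \<omega> * v \<omega> \<partial>M) \<le> L2_norm M Z * L2_norm M (\<lambda>\<omega>. x n \<omega> + gains (start_after (\<sigma>s n) T (\<theta> n)) S T \<omega>) +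
          L2_norm M Z * L2_norm M (u n)" for n
      proof -
        have "(\<integral>\<omega>. Z \<omega> * v \<omega> \<partial>M) \<le> (\<integral>\<omega>. Z \<omega> * \<bar>x n \<omega>\<bar> + Z \<omega> * u n \<omega> \<partial>M)"
        proof (rule integral_mono_AE)
          show "AE \<omega> in M. Z \<omega> * v \<omega> \<le> Z \<omega> * \<bar>x n \<omega>\<bar> + Z \<omega> * u n \<omega>"
            using Z(3)
          proof eventually_elim
            case (elim \<omega>)
            have "v \<omega> \<le> \<bar>x n \<omega>\<bar> + u n \<omega>" by (auto simp: v_def u_def)
            then have "Z \<omega> * v \<omega> \<le> Z \<omega> * (\<bar>x n \<omega>\<bar> + u n \<omega>)" using elim by (intro mult_left_mono) auto
            then show ?case by (simp add: distrib_left)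
          qed
        qed (intro Bochner_Integration.integrable_add L2_integrable_mult Z(2) xL uL vL)+
        also have "\<dots> = (\<integral>\<omega>. Z \<omega> * \<bar>x n \<omega>\<bar> \<partial>M) + (\<integral>\<omega>. Z \<omega> * u n \<omega> \<partial>M)"
          by (intro Bochner_Integration.integral_add L2_integrable_mult Z(2) xL uL)
        also have "\<dots> \<le> L2_norm M Z * L2_norm M (\<lambda>\<omega>. x n \<omega> + gains (start_after (\<sigma>s n) T (\<theta> n)) S T \<omega>) +
            L2_norm M Z * L2_norm M (u n)"
          using bound(2)[of n] L2_Cauchy_Schwarz[OF Z(2) uL[of n]] by linarith
        finally show ?thesis .
      qed
      then show "\<exists>N. \<forall>n\<ge>N. (\<integral>\<omega>. Z \<omega> * v \<omega> \<partial>M) \<le>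
          L2_norm M Z * L2_norm M (\<lambda>\<omega>. x n \<omega> + gains (start_after (\<sigma>s n) T (\<theta> n)) S T \<omega>) +
          L2_norm M Z * L2_norm M (u n)" by blast
    qed
    then have "AE \<omega> in M. v \<omega> = 0"
      by (intro AE_zero_of_weighted_integral[OF Z(3,2) vL]) (auto simp: v_def)
    then show "AE \<omega> in M. y \<omega> = 0" by eventually_elim (auto simp: v_def min_def split: if_splits)
  }
qed

lemma L2_zero_subset:
  assumes "h \<in> A \<inter> L2 M" "\<And>\<omega>. \<omega> \<in> space M \<Longrightarrow> h \<omega> = 0"
  shows "L2_zero M \<subseteq> L2_closure M A \<inter> L2_plus M"
proof
  fix f assume f: "f \<in> L2_zero M"
  then have fL: "f \<in> L2 M" "AE \<omega> in M. f \<omega> = 0" by (auto simp: L2_zero_def)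
  have "L2_norm M (\<lambda>\<omega>. f \<omega> - h \<omega>) = L2_norm M f" using assms(2) by (intro L2_norm_cong) auto
  also have "\<dots> = 0" using fL L2_norm_eq_0_iff by blast
  finally have "f \<in> L2_closure M A" using assms(1) fL by (auto simp: L2_closure_def intro!: bexI[of _ h])
  moreover have "f \<in> L2_plus M" using fL by (auto simp: L2_plus_def elim: eventually_mono)
  ultimately show "f \<in> L2_closure M A \<inter> L2_plus M" by blast
qed

lemma terminal_gains_gain_from:
  assumes "g \<in> terminal_gains M F T S" shows "gain_from (\<lambda>\<omega>. 0) g"
  using assms by (auto simp: terminal_gains_def intro: simple_strategy_gain_from_0)

text \<open>Gains are controlled on \<open>space M\<close> only, so what is available is a
  representative that vanishes there.\<close>

lemma zero_terminal_gain:
  obtains h where "h \<in> terminal_gains M F T S" "\<And>\<omega>. \<omega> \<in> space M \<Longrightarrow> h \<omega> = 0" "h \<in> L2 M"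
proof -
  obtain \<theta> where "\<theta> \<in> simple_strategies M F T S" "\<And>\<omega>. \<omega> \<in> space M \<Longrightarrow> gains \<theta> S T \<omega> = 0"
    using gain_from_simple_strategy[OF gain_from_zero] by metis
  then show thesis
    using gain_from_L2[OF simple_strategy_gain_from_0] by (intro that[of "gains \<theta> S T"]) (auto simp: terminal_gains_def)
qed

text \<open>\<open>Z\<close> gives gains price 0 and non-negative claims non-negative price. So
  every element of the closure has price at most 0, which a non-negative element can satisfy only if
  it vanishes.\<close>

lemma pricing_density_no_free_lunch:
  assumes "pricing_density Z" shows "no_L2_free_lunch M F T S"
  unfolding no_L2_free_lunch_def
proof (rule antisym)
  let ?A = "{\<lambda>\<omega>. g \<omega> - f \<omega> |g f. g \<in> terminal_gains M F T S \<and> f \<in> L2_plus M}"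
  have Z: "orthogonal_density Z" "Z \<in> L2 M" "AE \<omega> in M. 0 < Z \<omega>"
    using assms by (auto simp: pricing_density_def orthogonal_density_def)
  obtain h where h: "h \<in> terminal_gains M F T S" "\<And>\<omega>. \<omega> \<in> space M \<Longrightarrow> h \<omega> = 0" "h \<in> L2 M"
    using zero_terminal_gain by blast
  have "(\<lambda>\<omega>. 0) \<in> L2_plus M" by (simp add: L2_plus_def L2_zero_fun)
  with h(1) have "h \<in> ?A" by (intro CollectI exI[of _ h] exI[of _ "\<lambda>\<omega>. 0"]) simp
  with h(3) have "h \<in> ?A \<inter> L2 M" by (rule IntI[rotated])
  then show "L2_zero M \<subseteq> L2_closure M ?A \<inter> L2_plus M" by (rule L2_zero_subset[OF _ h(2)])
  show "L2_closure M ?A \<inter> L2_plus M \<subseteq> L2_zero M"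
  proof
    fix f assume f: "f \<in> L2_closure M ?A \<inter> L2_plus M"
    then obtain k where k: "\<And>n. k n \<in> ?A" "L2_tendsto M k f" using L2_closure_sequence by blast
    have fL: "f \<in> L2 M" "AE \<omega> in M. 0 \<le> f \<omega>" using f by (auto simp: L2_plus_def)
    have "(\<integral>\<omega>. Z \<omega> * k n \<omega> \<partial>M) \<le> 0" for n
    proof -
      obtain g f' where g: "g \<in> terminal_gains M F T S" and f': "f' \<in> L2_plus M"
        and k_eq: "k n = (\<lambda>\<omega>. g \<omega> - f' \<omega>)" using k(1)[of n] by auto
      have f'L: "f' \<in> L2 M" "AE \<omega> in M. 0 \<le> f' \<omega>" using f' by (auto simp: L2_plus_def)
      note g = terminal_gains_gain_from[OF g]
      have "(\<integral>\<omega>. Z \<omega> * k n \<omega> \<partial>M) = (\<integral>\<omega>. Z \<omega> * g \<omega> \<partial>M) - (\<integral>\<omega>. Z \<omega> * f' \<omega> \<partial>M)"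
        unfolding k_eq right_diff_distrib
        by (intro Bochner_Integration.integral_diff L2_integrable_mult Z(2) f'L gain_from_L2[OF g])
      moreover have "(\<integral>\<omega>. Z \<omega> * g \<omega> \<partial>M) = 0" using Z(1) g by (auto simp: orthogonal_density_def)
      moreover have "0 \<le> (\<integral>\<omega>. Z \<omega> * f' \<omega> \<partial>M)"
        by (rule integral_nonneg_AE) (use Z(3) f'L(2) in eventually_elim, simp)
      ultimately show ?thesis by simp
    qed
    then have "(\<integral>\<omega>. Z \<omega> * f \<omega> \<partial>M) \<le> 0"
      by (intro LIMSEQ_le_const2[OF L2_tendsto_inner[OF k(2) Z(2)]]) auto
    then have "AE \<omega> in M. f \<omega> = 0" by (rule AE_zero_of_weighted_integral[OF Z(3,2) fL])
    then show "f \<in> L2_zero M" using fL by (simp add: L2_zero_def)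
  qed
qed

lemma no_free_lunch_no_closure_arbitrage:
  assumes "no_L2_free_lunch M F T S" shows "no_L2_closure_arbitrage M F T S"
  unfolding no_L2_closure_arbitrage_def
proof (rule antisym)
  let ?A = "{\<lambda>\<omega>. g \<omega> - f \<omega> |g f. g \<in> terminal_gains M F T S \<and> f \<in> L2_plus M}"
  have "g \<in> ?A" if "g \<in> terminal_gains M F T S" for g
  proof -
    have "(\<lambda>\<omega>. 0) \<in> L2_plus M" by (simp add: L2_plus_def L2_zero_fun)
    with that show ?thesis by (intro CollectI exI[of _ g] exI[of _ "\<lambda>\<omega>. 0"]) simp
  qed
  then have "terminal_gains M F T S \<subseteq> ?A" by (rule subsetI)
  from L2_closure_mono[OF this] show "L2_closure M (terminal_gains M F T S) \<inter> L2_plus M \<subseteq> L2_zero M"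
    using assms by (auto simp: no_L2_free_lunch_def)
  obtain h where "h \<in> terminal_gains M F T S" "\<And>\<omega>. \<omega> \<in> space M \<Longrightarrow> h \<omega> = 0" "h \<in> L2 M"
    using zero_terminal_gain by blast
  then show "L2_zero M \<subseteq> L2_closure M (terminal_gains M F T S) \<inter> L2_plus M" by (intro L2_zero_subset[of h] IntI)
qed

end

section \<open>Optional sampling and equivalent local martingale measures\<close>

lemma borel_measurable_component [measurable (raw)]:
  fixes f :: "'a \<Rightarrow> real ^ 'd"
  shows "f \<in> borel_measurable N \<Longrightarrow> (\<lambda>\<omega>. f \<omega> $ i) \<in> borel_measurable N"
  by (erule measurable_compose) (intro borel_measurable_continuous_onI continuous_intros)

text \<open>Rounding up preserves stopping times: the rounded value is never earlier than the time
  from which it is computed.\<close>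

lemma rational_above_tendsto:
  fixes u :: real
  shows "(\<lambda>n. real_of_int \<lceil>real (Suc n) * u\<rceil> / real (Suc n)) \<longlonglongrightarrow> u"
    and "u \<le> real_of_int \<lceil>real (Suc n) * u\<rceil> / real (Suc n)"
  using tendsto_minus[OF rational_below_tendsto(1)[of "- u"]] rational_below_tendsto(2)[of n "- u"]
  by (simp_all add: ceiling_def)

lemma (in prob_space) integrable_truncation_tendsto:
  fixes f :: "'a \<Rightarrow> real"
  assumes f: "integrable M f" and K: "filterlim K at_top sequentially"
  shows "(\<lambda>j. \<integral>\<omega>. indicator {\<omega>. K j < \<bar>f \<omega>\<bar>} \<omega> * \<bar>f \<omega>\<bar> \<partial>M) \<longlonglongrightarrow> 0"
proof -
  have [measurable]: "f \<in> borel_measurable M" using f by measurable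
  have "(\<lambda>j. \<integral>\<omega>. indicator {\<omega>. K j < \<bar>f \<omega>\<bar>} \<omega> * \<bar>f \<omega>\<bar> \<partial>M) \<longlonglongrightarrow> (\<integral>\<omega>. 0 \<partial>M)"
  proof (rule integral_dominated_convergence[where w="\<lambda>\<omega>. \<bar>f \<omega>\<bar>"])
    show "AE \<omega> in M. (\<lambda>j. indicator {\<omega>. K j < \<bar>f \<omega>\<bar>} \<omega> * \<bar>f \<omega>\<bar>) \<longlonglongrightarrow> 0"
    proof (rule AE_I2)
      fix \<omega>
      have "\<forall>\<^sub>F j in sequentially. \<bar>f \<omega>\<bar> \<le> K j" using K by (simp add: filterlim_at_top)
      then have "\<forall>\<^sub>F j in sequentially. indicator {\<omega>. K j < \<bar>f \<omega>\<bar>} \<omega> * \<bar>f \<omega>\<bar> = 0"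
        by eventually_elim (simp add: indicator_def)
      then show "(\<lambda>j. indicator {\<omega>. K j < \<bar>f \<omega>\<bar>} \<omega> * \<bar>f \<omega>\<bar>) \<longlonglongrightarrow> 0" by (rule tendsto_eventually)
    qed
    show "(\<lambda>\<omega>. indicator {\<omega>. K j < \<bar>f \<omega>\<bar>} \<omega> * \<bar>f \<omega>\<bar>) \<in> borel_measurable M" for j by measurable
  qed (use f in \<open>auto simp: indicator_def\<close>)
  then show ?thesis by simp
qed

section \<open>Optional sampling for continuous martingales\<close>

context usual_filtered_prob_space
begin

text \<open>The martingale property is tested on events against the terminal value; in this form the
  pieces of a time with finitely many values can be summed directly.\<close>

definition continuous_martingale :: "(real \<Rightarrow> 'a \<Rightarrow> real) \<Rightarrow> bool" where
  "continuous_martingale Y \<longleftrightarrow>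
     (\<forall>t\<in>{0..T}. Y t \<in> borel_measurable (F t) \<and> integrable M (Y t) \<and>
        (\<forall>A\<in>sets (F t). (\<integral>\<omega>. indicator A \<omega> * Y t \<omega> \<partial>M) = (\<integral>\<omega>. indicator A \<omega> * Y T \<omega> \<partial>M))) \<and>
     (\<forall>\<omega>\<in>space M. continuous_on {0..T} (\<lambda>t. Y t \<omega>))"

lemma integrable_indicator_mult:
  fixes f :: "'a \<Rightarrow> real"
  assumes "integrable M f" "A \<in> sets M" shows "integrable M (\<lambda>\<omega>. indicator A \<omega> * f \<omega>)"
  using integrable_mult_indicator[OF assms(2,1)] by simp

text \<open>Optional sampling for finitely many values: split along the value of \<open>d\<close>
  and use the martingale property on each piece. The condition on \<open>D\<close> says that it
  belongs to the sigma-algebra at \<open>d\<close>.\<close>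

lemma grid_sampling:
  assumes Y: "continuous_martingale Y" and G: "finite G" "G \<subseteq> {0..T}"
    and d: "\<And>\<omega>. \<omega> \<in> space M \<Longrightarrow> d \<omega> \<in> G" "\<And>t. t \<in> G \<Longrightarrow> {\<omega>\<in>space M. d \<omega> = t} \<in> sets (F t)"
  shows "integrable M (\<lambda>\<omega>. Y (d \<omega>) \<omega>)"
    and "\<And>D. D \<subseteq> space M \<Longrightarrow> (\<And>t. t \<in> G \<Longrightarrow> {\<omega>\<in>D. d \<omega> = t} \<in> sets (F t)) \<Longrightarrow>
      D \<in> sets M \<and> (\<integral>\<omega>. indicator D \<omega> * Y (d \<omega>) \<omega> \<partial>M) = (\<integral>\<omega>. indicator D \<omega> * Y T \<omega> \<partial>M)"
proof -
  have int: "integrable M (Y t)" if "t \<in> G" for t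
    using Y G that by (auto simp: continuous_martingale_def)
  have intT: "integrable M (Y T)" using Y horizon_pos by (auto simp: continuous_martingale_def)
  have sum: "indicator D \<omega> * y (d \<omega>) = (\<Sum>t\<in>G. indicator {\<omega>\<in>D. d \<omega> = t} \<omega> * y t)"
    if "\<omega> \<in> space M" for D \<omega> and y :: "real \<Rightarrow> real"
  proof -
    have "(\<Sum>t\<in>G. indicator {\<omega>\<in>D. d \<omega> = t} \<omega> * y t) = (\<Sum>t\<in>G. if t = d \<omega> then indicator D \<omega> * y t else 0)"
      by (intro sum.cong) (auto simp: indicator_def)
    then show ?thesis using d(1)[OF that] G(1) by simp
  qed
  have sum_Y: "(\<Sum>t\<in>G. indicator {\<omega>\<in>D. d \<omega> = t} \<omega> * Y t \<omega>) = indicator D \<omega> * Y (d \<omega>) \<omega>"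
    and sum_YT: "(\<Sum>t\<in>G. indicator {\<omega>\<in>D. d \<omega> = t} \<omega> * Y T \<omega>) = indicator D \<omega> * Y T \<omega>"
    if "\<omega> \<in> space M" for D \<omega>
    using sum[OF that, of D "\<lambda>t. Y t \<omega>"] sum[OF that, of D "\<lambda>t. Y T \<omega>"] by simp_all
  have D_int: "integrable M (\<lambda>\<omega>. indicator D \<omega> * Y (d \<omega>) \<omega>)"
    if "\<And>t. t \<in> G \<Longrightarrow> {\<omega>\<in>D. d \<omega> = t} \<in> sets (F t)" for D
  proof -
    have "integrable M (\<lambda>\<omega>. \<Sum>t\<in>G. indicator {\<omega>\<in>D. d \<omega> = t} \<omega> * Y t \<omega>)"
      using that sets_F_subset by (intro Bochner_Integration.integrable_sum integrable_indicator_mult int) auto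
    then show ?thesis
      by (rule Bochner_Integration.integrable_cong[THEN iffD1, rotated 2]) (simp_all only: sum_Y)
  qed
  show "integrable M (\<lambda>\<omega>. Y (d \<omega>) \<omega>)"
    using D_int[of "space M", OF d(2)]
    by (rule Bochner_Integration.integrable_cong[THEN iffD1, rotated 2]) auto
  fix D assume D: "D \<subseteq> space M" "\<And>t. t \<in> G \<Longrightarrow> {\<omega>\<in>D. d \<omega> = t} \<in> sets (F t)"
  have "D = (\<Union>t\<in>G. {\<omega>\<in>D. d \<omega> = t})" using D(1) d(1) by auto
  also have "\<dots> \<in> sets M" using D(2) G(1) sets_F_subset by (intro sets.finite_UN) auto
  finally have DM: "D \<in> sets M" .
  have "(\<integral>\<omega>. indicator D \<omega> * Y (d \<omega>) \<omega> \<partial>M) = (\<integral>\<omega>. (\<Sum>t\<in>G. indicator {\<omega>\<in>D. d \<omega> = t} \<omega> * Y t \<omega>) \<partial>M)"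
    by (intro Bochner_Integration.integral_cong) (simp_all only: sum_Y)
  also have "\<dots> = (\<Sum>t\<in>G. \<integral>\<omega>. indicator {\<omega>\<in>D. d \<omega> = t} \<omega> * Y t \<omega> \<partial>M)"
    using D(2) sets_F_subset by (intro Bochner_Integration.integral_sum integrable_indicator_mult int) auto
  also have "\<dots> = (\<Sum>t\<in>G. \<integral>\<omega>. indicator {\<omega>\<in>D. d \<omega> = t} \<omega> * Y T \<omega> \<partial>M)"
    using Y G D(2) by (intro sum.cong) (auto simp: continuous_martingale_def)
  also have "\<dots> = (\<integral>\<omega>. (\<Sum>t\<in>G. indicator {\<omega>\<in>D. d \<omega> = t} \<omega> * Y T \<omega>) \<partial>M)"
    using D(2) sets_F_subset by (intro Bochner_Integration.integral_sum[symmetric] integrable_indicator_mult intT) auto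
  also have "\<dots> = (\<integral>\<omega>. indicator D \<omega> * Y T \<omega> \<partial>M)"
    by (intro Bochner_Integration.integral_cong) (simp_all only: sum_YT)
  finally show "D \<in> sets M \<and> (\<integral>\<omega>. indicator D \<omega> * Y (d \<omega>) \<omega> \<partial>M) = (\<integral>\<omega>. indicator D \<omega> * Y T \<omega> \<partial>M)"
    using DM by simp
qed

text \<open>The event that the sampled value exceeds \<open>K\<close> in modulus is known at
  \<open>d\<close>, and so are its parts of either sign. On each part sampling replaces the value by
  \<open>Y T\<close>, and the signs recombine into an absolute value.\<close>

lemma grid_sampling_tail:
  assumes Y: "continuous_martingale Y" and G: "finite G" "G \<subseteq> {0..T}"
    and d: "\<And>\<omega>. \<omega> \<in> space M \<Longrightarrow> d \<omega> \<in> G" "\<And>t. t \<in> G \<Longrightarrow> {\<omega>\<in>space M. d \<omega> = t} \<in> sets (F t)"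
    and K: "0 \<le> K"
  shows "{\<omega>\<in>space M. K < \<bar>Y (d \<omega>) \<omega>\<bar>} \<in> sets M"
    and "(\<integral>\<omega>. indicator {\<omega>\<in>space M. K < \<bar>Y (d \<omega>) \<omega>\<bar>} \<omega> * \<bar>Y (d \<omega>) \<omega>\<bar> \<partial>M) \<le>
      (\<integral>\<omega>. indicator {\<omega>\<in>space M. K < \<bar>Y (d \<omega>) \<omega>\<bar>} \<omega> * \<bar>Y T \<omega>\<bar> \<partial>M)"
proof -
  have sampling: "integrable M (\<lambda>\<omega>. Y (d \<omega>) \<omega>)"
    "\<And>D. D \<subseteq> space M \<Longrightarrow> (\<And>t. t \<in> G \<Longrightarrow> {\<omega>\<in>D. d \<omega> = t} \<in> sets (F t)) \<Longrightarrow>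
      D \<in> sets M \<and> (\<integral>\<omega>. indicator D \<omega> * Y (d \<omega>) \<omega> \<partial>M) = (\<integral>\<omega>. indicator D \<omega> * Y T \<omega> \<partial>M)"
    by (rule grid_sampling[OF Y G d]; assumption?; blast)+
  have intT: "integrable M (Y T)" using Y horizon_pos by (auto simp: continuous_martingale_def)
  define P N where "P = {\<omega>\<in>space M. K < Y (d \<omega>) \<omega>}" and "N = {\<omega>\<in>space M. Y (d \<omega>) \<omega> < - K}"
  have Yt[measurable]: "Y t \<in> borel_measurable (F t)" if "t \<in> G" for t
    using Y G(2) that by (auto simp: continuous_martingale_def)
  have Pt: "{\<omega>\<in>P. d \<omega> = t} \<in> sets (F t)" if "t \<in> G" for t
  proof -
    have "{\<omega>\<in>P. d \<omega> = t} = {\<omega>\<in>space M. d \<omega> = t} \<inter> {\<omega>\<in>space (F t). K < Y t \<omega>}"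
      by (auto simp: P_def space_F)
    also have "\<dots> \<in> sets (F t)" by (intro sets.Int d(2) that) (use Yt[OF that] in measurable)
    finally show ?thesis .
  qed
  have Nt: "{\<omega>\<in>N. d \<omega> = t} \<in> sets (F t)" if "t \<in> G" for t
  proof -
    have "{\<omega>\<in>N. d \<omega> = t} = {\<omega>\<in>space M. d \<omega> = t} \<inter> {\<omega>\<in>space (F t). Y t \<omega> < - K}"
      by (auto simp: N_def space_F)
    also have "\<dots> \<in> sets (F t)" by (intro sets.Int d(2) that) (use Yt[OF that] in measurable)
    finally show ?thesis .
  qed
  have P: "P \<in> sets M \<and> (\<integral>\<omega>. indicator P \<omega> * Y (d \<omega>) \<omega> \<partial>M) = (\<integral>\<omega>. indicator P \<omega> * Y T \<omega> \<partial>M)"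
    by (rule sampling(2)[OF _ Pt]) (auto simp: P_def)
  have N: "N \<in> sets M \<and> (\<integral>\<omega>. indicator N \<omega> * Y (d \<omega>) \<omega> \<partial>M) = (\<integral>\<omega>. indicator N \<omega> * Y T \<omega> \<partial>M)"
    by (rule sampling(2)[OF _ Nt]) (auto simp: N_def)
  let ?D = "{\<omega>\<in>space M. K < \<bar>Y (d \<omega>) \<omega>\<bar>}"
  have D: "?D = P \<union> N" using K by (auto simp: P_def N_def)
  then show DM: "?D \<in> sets M" using P N by auto
  have "(\<integral>\<omega>. indicator ?D \<omega> * \<bar>Y (d \<omega>) \<omega>\<bar> \<partial>M) =
      (\<integral>\<omega>. indicator P \<omega> * Y (d \<omega>) \<omega> - indicator N \<omega> * Y (d \<omega>) \<omega> \<partial>M)"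
    using K by (intro Bochner_Integration.integral_cong) (auto simp: P_def N_def indicator_def)
  also have "\<dots> = (\<integral>\<omega>. indicator P \<omega> * Y T \<omega> \<partial>M) - (\<integral>\<omega>. indicator N \<omega> * Y T \<omega> \<partial>M)"
    using P N by (subst Bochner_Integration.integral_diff) (auto intro: integrable_indicator_mult sampling(1))
  also have "\<dots> = (\<integral>\<omega>. indicator P \<omega> * Y T \<omega> - indicator N \<omega> * Y T \<omega> \<partial>M)"
    using P N by (intro Bochner_Integration.integral_diff[symmetric] integrable_indicator_mult intT) auto
  also have "\<dots> \<le> (\<integral>\<omega>. indicator ?D \<omega> * \<bar>Y T \<omega>\<bar> \<partial>M)"
  proof (rule integral_mono)
    show "indicator P \<omega> * Y T \<omega> - indicator N \<omega> * Y T \<omega> \<le> indicator ?D \<omega> * \<bar>Y T \<omega>\<bar>" if "\<omega> \<in> space M" for \<omega>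
      using that K by (auto simp: P_def N_def indicator_def)
  qed (use P N DM intT in \<open>auto intro!: integrable_indicator_mult Bochner_Integration.integrable_diff\<close>)
  finally show "(\<integral>\<omega>. indicator ?D \<omega> * \<bar>Y (d \<omega>) \<omega>\<bar> \<partial>M) \<le> (\<integral>\<omega>. indicator ?D \<omega> * \<bar>Y T \<omega>\<bar> \<partial>M)" .
qed

text \<open>
  Approximating \<open>c\<close> from above by grid-valued stopping times, the sampled values are uniformly
  integrable: on \<open>{\<bar>Y\<bar> > K}\<close>, \<open>Y\<close> may be replaced by \<open>Y T\<close>, and this event has
  probability at most \<open>E \<bar>Y T\<bar> / K\<close>.
\<close>

lemma optional_sampling:
  assumes Y: "continuous_martingale Y" and c: "c \<in> ST" and B: "B \<in> sets (pre_sigma c)"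
  shows "integrable M (\<lambda>\<omega>. Y (c \<omega>) \<omega>)"
    and "(\<integral>\<omega>. indicator B \<omega> * Y (c \<omega>) \<omega> \<partial>M) = (\<integral>\<omega>. indicator B \<omega> * Y T \<omega> \<partial>M)"
proof -
  have cont: "continuous_on {0..T} (\<lambda>t. Y t \<omega>)" if "\<omega> \<in> space M" for \<omega>
    using Y that by (auto simp: continuous_martingale_def)
  have intT: "integrable M (Y T)" using Y horizon_pos by (auto simp: continuous_martingale_def)
  define C where "C = (\<integral>\<omega>. \<bar>Y T \<omega>\<bar> \<partial>M)"
  \<comment> \<open>The next point at or after \<open>c\<close> of the grid that divides [0,T] into
    \<open>m + 1\<close> equal parts.\<close>
  define d where "d m \<omega> = T * (real_of_int \<lceil>real (Suc m) * (c \<omega> / T)\<rceil> / real (Suc m))" for m \<omega>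
  define G where "G m = (\<lambda>j. T * (real j / real (Suc m))) ` {..Suc m}" for m
  have G: "finite (G m)" "G m \<subseteq> {0..T}" for m
    using horizon_pos mult_left_le[of "real j / real (Suc m)" T for j] by (auto simp: G_def mult_left_le)
  have dG: "d m \<omega> \<in> G m" if "\<omega> \<in> space M" for m \<omega>
  proof -
    have u: "0 \<le> c \<omega> / T" "c \<omega> / T \<le> 1" using STD(2,3)[OF c that] horizon_pos by auto
    have "0 \<le> real (Suc m) * (c \<omega> / T)" using u(1) by (intro mult_nonneg_nonneg) auto
    then have "0 \<le> \<lceil>real (Suc m) * (c \<omega> / T)\<rceil>" by linarith
    moreover have "\<lceil>real (Suc m) * (c \<omega> / T)\<rceil> \<le> int (Suc m)"
      using u mult_left_mono[OF u(2), of "real (Suc m)"] by (simp add: ceiling_le_iff)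
    ultimately obtain j where "\<lceil>real (Suc m) * (c \<omega> / T)\<rceil> = int j" "j \<le> Suc m"
      by (metis nonneg_int_cases of_nat_le_iff)
    then show ?thesis unfolding d_def G_def by (intro image_eqI[of _ _ j]) simp_all
  qed
  have d0T: "0 \<le> d m \<omega> \<and> d m \<omega> \<le> T" if "\<omega> \<in> space M" for m \<omega>
    using dG[OF that] G(2) by force
  have c_le_d: "c \<omega> \<le> d m \<omega>" for m \<omega>
    using mult_left_mono[OF rational_above_tendsto(2)[of "c \<omega> / T" m], of T] horizon_pos by (simp add: d_def)
  have d_lim: "(\<lambda>m. d m \<omega>) \<longlonglongrightarrow> c \<omega>" for \<omega>
    using tendsto_mult[OF tendsto_const rational_above_tendsto(1)[of "c \<omega> / T"], of T] horizon_pos by (simp add: d_def)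
  have dB: "{\<omega>\<in>B. d m \<omega> = t} \<in> sets (F t)" if B: "B \<in> sets (pre_sigma c)" for m t B
  proof -
    have BM: "B \<subseteq> space M" using sets.sets_into_space[OF B] by (simp add: space_pre_sigma)
    note [measurable] = stopping_time_min_const_measurable[OF STD(1)[OF c], of t]
    \<comment> \<open>On this event \<open>c\<close> is at most \<open>t\<close>, so it may be
      replaced by its truncation at \<open>t\<close>, which is known at \<open>t\<close>.\<close>
    have "{\<omega>\<in>B. d m \<omega> = t} = {\<omega>\<in>B. c \<omega> \<le> t} \<inter>
        {\<omega>\<in>space (F t). T * (real_of_int \<lceil>real (Suc m) * (min (c \<omega>) t / T)\<rceil> / real (Suc m)) = t}"
      using BM c_le_d[of _ m] by (auto simp: space_F d_def min_absorb1)
    also have "\<dots> \<in> sets (F t)"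
      by (intro sets.Int sets_pre_sigmaD[OF STD(1)[OF c] B]) measurable
    finally show ?thesis .
  qed
  have sampling: "integrable M (\<lambda>\<omega>. Y (d m \<omega>) \<omega>)"
    "(\<integral>\<omega>. indicator B \<omega> * Y (d m \<omega>) \<omega> \<partial>M) = (\<integral>\<omega>. indicator B \<omega> * Y T \<omega> \<partial>M)" for m
    using grid_sampling[where G="G m" and d="d m", OF Y G dG dB[OF pre_sigma_space]] dB[OF B] sets.sets_into_space[OF B]
    by (auto simp: space_pre_sigma)
  have tail: "(\<integral>\<omega>. indicator {\<omega>\<in>space M. K < \<bar>Y (d m \<omega>) \<omega>\<bar>} \<omega> * \<bar>Y (d m \<omega>) \<omega>\<bar> \<partial>M) \<le>
      (\<integral>\<omega>. indicator {\<omega>\<in>space M. K < \<bar>Y (d m \<omega>) \<omega>\<bar>} \<omega> * \<bar>Y T \<omega>\<bar> \<partial>M)" if "0 \<le> K" for K m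
    using grid_sampling_tail(2)[where G="G m" and d="d m", OF Y G dG dB[OF pre_sigma_space] that] by auto
  have [measurable]: "(\<lambda>\<omega>. Y (d m \<omega>) \<omega>) \<in> borel_measurable M" for m using sampling(1) by measurable
  have Y_lim: "(\<lambda>m. Y (d m \<omega>) \<omega>) \<longlonglongrightarrow> Y (c \<omega>) \<omega>" if "\<omega> \<in> space M" for \<omega>
    using STD(2,3)[OF c that] d0T[OF that] by (intro continuous_on_tendsto_compose[OF cont[OF that] d_lim]) auto
  have [measurable]: "(\<lambda>\<omega>. Y (c \<omega>) \<omega>) \<in> borel_measurable M"
    by (rule borel_measurable_LIMSEQ_metric[OF _ Y_lim]) auto
  have [measurable]: "Y T \<in> borel_measurable M" using intT by measurable
  have bound_C: "(\<integral>\<omega>. \<bar>Y (d m \<omega>) \<omega>\<bar> \<partial>M) \<le> C" for m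
  proof -
    have "(\<integral>\<omega>. \<bar>Y (d m \<omega>) \<omega>\<bar> \<partial>M) = (\<integral>\<omega>. indicator {\<omega>\<in>space M. 0 < \<bar>Y (d m \<omega>) \<omega>\<bar>} \<omega> * \<bar>Y (d m \<omega>) \<omega>\<bar> \<partial>M)"
      by (intro Bochner_Integration.integral_cong) (auto simp: indicator_def)
    also have "\<dots> \<le> (\<integral>\<omega>. indicator {\<omega>\<in>space M. 0 < \<bar>Y (d m \<omega>) \<omega>\<bar>} \<omega> * \<bar>Y T \<omega>\<bar> \<partial>M)" by (rule tail) simp
    also have "\<dots> \<le> C" unfolding C_def
      using intT by (intro integral_mono integrable_indicator_mult) (auto simp: indicator_def)
    finally show ?thesis .
  qed
  \<comment> \<open>Fatou: the sampled values are bounded in L1 by \<open>C\<close>, uniformly in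
    \<open>m\<close>.\<close>
  show int: "integrable M (\<lambda>\<omega>. Y (c \<omega>) \<omega>)"
  proof (rule integrableI_bounded)
    have "(\<integral>\<^sup>+\<omega>. ennreal (norm (Y (c \<omega>) \<omega>)) \<partial>M) = (\<integral>\<^sup>+\<omega>. liminf (\<lambda>m. ennreal (norm (Y (d m \<omega>) \<omega>))) \<partial>M)"
      by (intro nn_integral_cong lim_imp_Liminf[OF sequentially_bot, symmetric] tendsto_ennrealI tendsto_norm Y_lim)
    also have "\<dots> \<le> liminf (\<lambda>m. \<integral>\<^sup>+\<omega>. ennreal (norm (Y (d m \<omega>) \<omega>)) \<partial>M)"
      by (rule nn_integral_liminf) measurable
    also have "\<dots> \<le> ennreal C"
    proof (rule order_trans[OF Liminf_le_Limsup[OF sequentially_bot] Limsup_bounded[OF always_eventually]], rule allI)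
      fix m
      have "(\<integral>\<^sup>+\<omega>. ennreal (norm (Y (d m \<omega>) \<omega>)) \<partial>M) = ennreal (\<integral>\<omega>. norm (Y (d m \<omega>) \<omega>) \<partial>M)"
        using sampling(1)[of m] by (intro nn_integral_eq_integral integrable_norm) auto
      also have "\<dots> \<le> ennreal C" using bound_C[of m] by (intro ennreal_leI) simp
      finally show "(\<integral>\<^sup>+\<omega>. ennreal (norm (Y (d m \<omega>) \<omega>)) \<partial>M) \<le> ennreal C" .
    qed
    finally show "(\<integral>\<^sup>+\<omega>. ennreal (norm (Y (c \<omega>) \<omega>)) \<partial>M) < \<infinity>" by (rule le_less_trans) simp
  qed measurable
  \<comment> \<open>With a quadratic level, \<open>{\<bar>Y d\<bar> > K j}\<close> has probability
    at most \<open>C / (j+1)^2\<close>. On it the part of \<open>Y T\<close> of size up to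
    \<open>j + 1\<close> contributes at most \<open>C / (j+1)\<close>, and the rest is a tail of the
    integrable \<open>Y T\<close>; \<open>\<delta> j\<close> collects both, uniformly in
    \<open>m\<close>.\<close>
  define K :: "nat \<Rightarrow> real" where "K j = (real (Suc j))\<^sup>2" for j
  define \<delta> where "\<delta> j = C / real (Suc j) + (\<integral>\<omega>. indicator {\<omega>. real (Suc j) < \<bar>Y T \<omega>\<bar>} \<omega> * \<bar>Y T \<omega>\<bar> \<partial>M)" for j
  define r where "r j = (\<integral>\<omega>. indicator {\<omega>. K j < \<bar>Y (c \<omega>) \<omega>\<bar>} \<omega> * \<bar>Y (c \<omega>) \<omega>\<bar> \<partial>M)" for j
  have K_pos: "0 < K j" for j by (simp add: K_def)
  have Suc_top: "filterlim (\<lambda>j. real (Suc j)) at_top sequentially"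
    by (rule filterlim_compose[OF filterlim_real_sequentially filterlim_Suc])
  have K_top: "filterlim K at_top sequentially"
    unfolding K_def by (rule filterlim_pow_at_top[OF _ Suc_top]) simp
  have \<delta>r: "(\<lambda>j. \<delta> j + r j) \<longlonglongrightarrow> 0 + 0 + 0"
    unfolding \<delta>_def r_def
  proof (intro tendsto_add integrable_truncation_tendsto intT int Suc_top K_top)
    show "(\<lambda>j. C / real (Suc j)) \<longlonglongrightarrow> 0"
      using tendsto_mult_right_zero[OF LIMSEQ_inverse_real_of_nat, of C] by (simp add: divide_inverse)
  qed
  have tail_le: "(\<integral>\<omega>. indicator {\<omega>\<in>space M. K j < \<bar>Y (d m \<omega>) \<omega>\<bar>} \<omega> * \<bar>Y (d m \<omega>) \<omega>\<bar> \<partial>M) \<le> \<delta> j" for j m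
  proof -
    let ?D = "{\<omega>\<in>space M. K j < \<bar>Y (d m \<omega>) \<omega>\<bar>}" and ?n = "real (Suc j)"
    have D: "?D \<in> sets M" by measurable
    have "K j * prob ?D = (\<integral>\<omega>. K j * indicator ?D \<omega> \<partial>M)" using D by simp
    also have "\<dots> \<le> (\<integral>\<omega>. \<bar>Y (d m \<omega>) \<omega>\<bar> \<partial>M)"
      by (intro integral_mono integrable_mult_right integrable_real_indicator integrable_abs D sampling(1))
        (auto simp: indicator_def less_top[symmetric])
    finally have "K j * prob ?D \<le> C" using bound_C[of m] by simp
    then have "?n * (?n * prob ?D) \<le> C" by (simp add: K_def power2_eq_square mult.assoc)
    then have prob_le: "?n * prob ?D \<le> C / ?n" by (subst pos_le_divide_eq) (simp_all add: mult.commute)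
    have "(\<integral>\<omega>. indicator ?D \<omega> * \<bar>Y (d m \<omega>) \<omega>\<bar> \<partial>M) \<le> (\<integral>\<omega>. indicator ?D \<omega> * \<bar>Y T \<omega>\<bar> \<partial>M)"
      using K_pos[of j] by (intro tail) simp
    also have "\<dots> \<le> (\<integral>\<omega>. ?n * indicator ?D \<omega> + indicator {\<omega>\<in>space M. ?n < \<bar>Y T \<omega>\<bar>} \<omega> * \<bar>Y T \<omega>\<bar> \<partial>M)"
      using intT
      by (intro integral_mono integrable_indicator_mult Bochner_Integration.integrable_add
          integrable_mult_right integrable_real_indicator integrable_abs D)
        (auto simp: indicator_def less_top[symmetric])
    also have "\<dots> = ?n * prob ?D + (\<integral>\<omega>. indicator {\<omega>\<in>space M. ?n < \<bar>Y T \<omega>\<bar>} \<omega> * \<bar>Y T \<omega>\<bar> \<partial>M)"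
      using intT D by (subst Bochner_Integration.integral_add)
        (auto intro!: integrable_indicator_mult simp: less_top[symmetric])
    also have "(\<integral>\<omega>. indicator {\<omega>\<in>space M. ?n < \<bar>Y T \<omega>\<bar>} \<omega> * \<bar>Y T \<omega>\<bar> \<partial>M) =
        (\<integral>\<omega>. indicator {\<omega>. ?n < \<bar>Y T \<omega>\<bar>} \<omega> * \<bar>Y T \<omega>\<bar> \<partial>M)"
      by (intro Bochner_Integration.integral_cong) (auto simp: indicator_def)
    finally show ?thesis using prob_le by (simp add: \<delta>_def)
  qed
  \<comment> \<open>Truncation at \<open>K j\<close> is bounded and continuous, so for fixed
    \<open>j\<close> dominated convergence applies as \<open>m\<close> grows; the truncation errors
    are \<open>\<delta> j\<close> for the sampled values and \<open>r j\<close> for the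
    limit.\<close>
  define \<phi> where "\<phi> j y = max (- K j) (min (K j) y)" for j and y :: real
  have \<phi>_diff: "\<bar>y - \<phi> j y\<bar> \<le> of_bool (K j < \<bar>y\<bar>) * \<bar>y\<bar>" for j y
    using K_pos[of j] by (auto simp: \<phi>_def)
  have \<phi>_bdd: "\<bar>\<phi> j y\<bar> \<le> K j" for j y using K_pos[of j] by (auto simp: \<phi>_def)
  have [measurable]: "(\<lambda>\<omega>. \<phi> j (f \<omega>)) \<in> borel_measurable M" if "f \<in> borel_measurable M" for j f
    unfolding \<phi>_def using that by measurable
  have \<phi>_int: "integrable M (\<lambda>\<omega>. \<phi> j (f \<omega>))" if "f \<in> borel_measurable M" for j f
    using that \<phi>_bdd by (intro integrable_const_bound[where B="K j"]) auto
  have [measurable]: "B \<in> sets M" by (rule sets_pre_sigma_subset[OF c B])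
  have \<phi>_approx: "\<bar>(\<integral>\<omega>. indicator B \<omega> * f \<omega> \<partial>M) - (\<integral>\<omega>. indicator B \<omega> * \<phi> j (f \<omega>) \<partial>M)\<bar> \<le>
      (\<integral>\<omega>. indicator {\<omega>\<in>space M. K j < \<bar>f \<omega>\<bar>} \<omega> * \<bar>f \<omega>\<bar> \<partial>M)" if f: "integrable M f" for f j
  proof -
    have [measurable]: "f \<in> borel_measurable M" using f by measurable
    have "(\<integral>\<omega>. indicator B \<omega> * f \<omega> \<partial>M) - (\<integral>\<omega>. indicator B \<omega> * \<phi> j (f \<omega>) \<partial>M) =
        (\<integral>\<omega>. indicator B \<omega> * (f \<omega> - \<phi> j (f \<omega>)) \<partial>M)"
      using f \<phi>_int by (simp add: right_diff_distrib integrable_indicator_mult)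
    also have "\<bar>\<dots>\<bar> \<le> (\<integral>\<omega>. \<bar>indicator B \<omega> * (f \<omega> - \<phi> j (f \<omega>))\<bar> \<partial>M)" by (rule integral_abs_bound)
    also have "\<dots> \<le> (\<integral>\<omega>. indicator {\<omega>\<in>space M. K j < \<bar>f \<omega>\<bar>} \<omega> * \<bar>f \<omega>\<bar> \<partial>M)"
    proof (rule integral_mono)
      show "\<bar>indicator B \<omega> * (f \<omega> - \<phi> j (f \<omega>))\<bar> \<le> indicator {\<omega>\<in>space M. K j < \<bar>f \<omega>\<bar>} \<omega> * \<bar>f \<omega>\<bar>"
        if "\<omega> \<in> space M" for \<omega>
        using \<phi>_diff[of "f \<omega>" j] that by (auto simp: indicator_def split: if_splits)
    qed (use f \<phi>_int in \<open>auto intro!: integrable_indicator_mult Bochner_Integration.integrable_diff\<close>)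
    finally show ?thesis .
  qed
  define D where "D = \<bar>(\<integral>\<omega>. indicator B \<omega> * Y T \<omega> \<partial>M) - (\<integral>\<omega>. indicator B \<omega> * Y (c \<omega>) \<omega> \<partial>M)\<bar>"
  have "D \<le> \<delta> j + r j" for j
  proof (rule LIMSEQ_le_const)
    have lim: "(\<lambda>m. \<integral>\<omega>. indicator B \<omega> * \<phi> j (Y (d m \<omega>) \<omega>) \<partial>M) \<longlonglongrightarrow> (\<integral>\<omega>. indicator B \<omega> * \<phi> j (Y (c \<omega>) \<omega>) \<partial>M)"
    proof (rule integral_dominated_convergence[where w="\<lambda>\<omega>. K j"])
      show "AE \<omega> in M. (\<lambda>m. indicator B \<omega> * \<phi> j (Y (d m \<omega>) \<omega>)) \<longlonglongrightarrow> indicator B \<omega> * \<phi> j (Y (c \<omega>) \<omega>)"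
        unfolding \<phi>_def by (intro AE_I2 tendsto_intros Y_lim)
      show "AE \<omega> in M. norm (indicator B \<omega> * \<phi> j (Y (d m \<omega>) \<omega>)) \<le> K j" for m
        using \<phi>_bdd K_pos[of j] by (auto simp: indicator_def less_imp_le)
    qed auto
    let ?a = "\<lambda>m. (\<integral>\<omega>. indicator B \<omega> * \<phi> j (Y (d m \<omega>) \<omega>) \<partial>M) - (\<integral>\<omega>. indicator B \<omega> * \<phi> j (Y (c \<omega>) \<omega>) \<partial>M)"
    have "(\<lambda>m. \<delta> j + \<bar>?a m\<bar> + r j) \<longlonglongrightarrow> \<delta> j + \<bar>0\<bar> + r j"
      using lim by (intro tendsto_intros) (simp add: LIM_zero_iff)
    then show "(\<lambda>m. \<delta> j + \<bar>?a m\<bar> + r j) \<longlonglongrightarrow> \<delta> j + r j" by simp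
    have "D \<le> \<delta> j + \<bar>?a m\<bar> + r j" for m
    proof -
      have 1: "(\<integral>\<omega>. indicator B \<omega> * Y (d m \<omega>) \<omega> \<partial>M) = (\<integral>\<omega>. indicator B \<omega> * Y T \<omega> \<partial>M)"
        by (rule sampling(2))
      have 2: "(\<integral>\<omega>. indicator {\<omega>\<in>space M. K j < \<bar>Y (c \<omega>) \<omega>\<bar>} \<omega> * \<bar>Y (c \<omega>) \<omega>\<bar> \<partial>M) = r j"
        unfolding r_def by (intro Bochner_Integration.integral_cong) (auto simp: indicator_def)
      show ?thesis
        using \<phi>_approx[OF sampling(1)[of m], of j] \<phi>_approx[OF int, of j] tail_le[of j m]
        unfolding 1 2 D_def by linarith
    qed
    then show "\<exists>N. \<forall>m\<ge>N. D \<le> \<delta> j + \<bar>?a m\<bar> + r j" by blast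
  qed
  then have "D \<le> 0 + 0 + 0" by (intro LIMSEQ_le_const[OF \<delta>r]) auto
  then show "(\<integral>\<omega>. indicator B \<omega> * Y (c \<omega>) \<omega> \<partial>M) = (\<integral>\<omega>. indicator B \<omega> * Y T \<omega> \<partial>M)"
    by (simp add: D_def)
qed

text \<open>Events known at \<open>a\<close> are known at \<open>b\<close>, so on each of them both
  sampled values have the integral of \<open>Y T\<close>: the increment has conditional expectation
  0 at \<open>a\<close>. A bounded factor known at \<open>a\<close> can then be pulled out.\<close>

lemma optional_sampling_increment:
  assumes Y: "continuous_martingale Y" and a: "a \<in> ST" and b: "b \<in> ST"
    and ab: "\<And>\<omega>. \<omega> \<in> space M \<Longrightarrow> a \<omega> \<le> b \<omega>"
    and f: "f \<in> borel_measurable (pre_sigma a)" "\<And>\<omega>. \<omega> \<in> space M \<Longrightarrow> \<bar>f \<omega>\<bar> \<le> C"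
  shows "(\<integral>\<omega>. f \<omega> * (Y (b \<omega>) \<omega> - Y (a \<omega>) \<omega>) \<partial>M) = 0"
proof -
  interpret sub: finite_measure_subalgebra M "pre_sigma a"
    by unfold_locales (use sets_pre_sigma_subset[OF a] in \<open>auto simp: subalgebra_def space_pre_sigma\<close>)
  have inta: "integrable M (\<lambda>\<omega>. Y (a \<omega>) \<omega>)" and intb: "integrable M (\<lambda>\<omega>. Y (b \<omega>) \<omega>)"
    using optional_sampling(1)[OF Y] a b sets.empty_sets by blast+
  have int: "integrable M (\<lambda>\<omega>. Y (b \<omega>) \<omega> - Y (a \<omega>) \<omega>)"
    using inta intb by (rule Bochner_Integration.integrable_diff[rotated])
  have [measurable]: "f \<in> borel_measurable M" by (rule measurable_pre_sigma_M[OF a f(1)])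
  have [measurable]: "(\<lambda>\<omega>. Y (b \<omega>) \<omega> - Y (a \<omega>) \<omega>) \<in> borel_measurable M" using int by measurable
  have "AE \<omega> in M. real_cond_exp M (pre_sigma a) (\<lambda>\<omega>. Y (b \<omega>) \<omega> - Y (a \<omega>) \<omega>) \<omega> = 0"
  proof (rule sub.real_cond_exp_charact[OF _ int])
    fix A assume A: "A \<in> sets (pre_sigma a)"
    have AM: "A \<in> sets M" by (rule sets_pre_sigma_subset[OF a A])
    have Ab: "A \<in> sets (pre_sigma b)" by (rule pre_sigma_mono[OF a b A ab])
    have "(\<integral>\<omega>\<in>A. (Y (b \<omega>) \<omega> - Y (a \<omega>) \<omega>) \<partial>M) =
        (\<integral>\<omega>. indicator A \<omega> * Y (b \<omega>) \<omega> - indicator A \<omega> * Y (a \<omega>) \<omega> \<partial>M)"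
      by (simp add: set_lebesgue_integral_def right_diff_distrib)
    also have "\<dots> = 0"
      using optional_sampling(2)[OF Y a A] optional_sampling(2)[OF Y b Ab]
      by (subst Bochner_Integration.integral_diff) (auto intro: integrable_indicator_mult inta intb AM)
    finally show "(\<integral>\<omega>\<in>A. (Y (b \<omega>) \<omega> - Y (a \<omega>) \<omega>) \<partial>M) = (\<integral>\<omega>\<in>A. 0 \<partial>M)"
      by (simp add: set_lebesgue_integral_def)
  qed auto
  moreover have "integrable M (\<lambda>\<omega>. f \<omega> * (Y (b \<omega>) \<omega> - Y (a \<omega>) \<omega>))"
  proof (rule Bochner_Integration.integrable_bound[OF integrable_mult_right[OF integrable_abs[OF int], of C]])
    show "AE \<omega> in M. norm (f \<omega> * (Y (b \<omega>) \<omega> - Y (a \<omega>) \<omega>)) \<le> norm (C * \<bar>Y (b \<omega>) \<omega> - Y (a \<omega>) \<omega>\<bar>)"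
    proof (rule AE_I2)
      fix \<omega> assume "\<omega> \<in> space M"
      then have "\<bar>f \<omega>\<bar> \<le> C" "0 \<le> C" using f(2)[of \<omega>] by auto
      then show "norm (f \<omega> * (Y (b \<omega>) \<omega> - Y (a \<omega>) \<omega>)) \<le> norm (C * \<bar>Y (b \<omega>) \<omega> - Y (a \<omega>) \<omega>\<bar>)"
        by (simp add: abs_mult mult_right_mono)
    qed
  qed measurable
  from sub.real_cond_exp_intg(2)[OF this f(1)]
  have "(\<integral>\<omega>. f \<omega> * (Y (b \<omega>) \<omega> - Y (a \<omega>) \<omega>) \<partial>M) =
      (\<integral>\<omega>. f \<omega> * real_cond_exp M (pre_sigma a) (\<lambda>\<omega>. Y (b \<omega>) \<omega> - Y (a \<omega>) \<omega>) \<omega> \<partial>M)" by simp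
  ultimately show ?thesis by (auto intro: integral_eq_zero_AE)
qed

end

section \<open>From an equivalent local martingale measure to a pricing density\<close>

context continuous_market
begin

text \<open>The probability of never reaching \<open>T\<close> is below that of
  \<open>\<rho> k < T\<close> for each \<open>k\<close>. By monotonicity a sequence that reaches
  \<open>T\<close> once stays there.\<close>

lemma localizing_AE_eventually:
  assumes Q: "prob_space Q" "space Q = space M" "sets Q = sets M" and \<rho>: "localizing_sequence Q F T \<rho>"
  shows "AE \<omega> in Q. \<forall>\<^sub>F k in sequentially. \<rho> k \<omega> = T"
proof -
  interpret Q: prob_space Q by (rule Q(1))
  have ST: "\<rho> k \<in> ST" for k using \<rho> Q(2) by (auto simp: localizing_sequence_def stopping_times_def)
  have [measurable]: "\<rho> k \<in> borel_measurable Q" for k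
    using STD(4)[OF ST] measurable_cong_sets[OF Q(3) refl] by blast
  have "Q.prob {\<omega>\<in>space Q. \<forall>k. \<rho> k \<omega> < T} \<le> 0"
  proof (rule LIMSEQ_le_const)
    show "(\<lambda>k. Q.prob {\<omega>\<in>space Q. \<rho> k \<omega> < T}) \<longlonglongrightarrow> 0" using \<rho> by (simp add: localizing_sequence_def)
    show "\<exists>N. \<forall>k\<ge>N. Q.prob {\<omega>\<in>space Q. \<forall>k. \<rho> k \<omega> < T} \<le> Q.prob {\<omega>\<in>space Q. \<rho> k \<omega> < T}"
      by (intro exI[of _ 0] allI impI Q.finite_measure_mono) auto
  qed
  then have "AE \<omega> in Q. \<not> (\<forall>k. \<rho> k \<omega> < T)"
    by (subst AE_iff_measurable[OF _ refl]) (auto simp: Q.emeasure_eq_measure measure_le_0_iff)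
  then show ?thesis
  proof (rule AE_mp[OF _ AE_I2], intro impI)
    fix \<omega> assume \<omega>: "\<omega> \<in> space Q" "\<not> (\<forall>k. \<rho> k \<omega> < T)"
    then obtain k where "T \<le> \<rho> k \<omega>" by (auto simp: not_less)
    moreover have "\<rho> k \<omega> \<le> \<rho> k' \<omega>" if "k \<le> k'" for k'
      using \<rho> \<omega>(1) by (intro lift_Suc_mono_le[OF _ that]) (auto simp: localizing_sequence_def)
    moreover have "\<rho> k' \<omega> \<le> T" for k' using STD(3)[OF ST] \<omega>(1) Q(2) by auto
    ultimately show "\<forall>\<^sub>F k in sequentially. \<rho> k \<omega> = T"
      by (auto simp: eventually_sequentially intro!: exI[of _ k] antisym intro: order_trans)
  qed
qed

text \<open>Under \<open>Q\<close>, \<open>S\<close> stopped at \<open>\<rho> k\<close> is a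
  martingale, so optional sampling annihilates the gains of the stopped price. Letting
  \<open>k\<close> grow removes the stopping, since for an admissible end point the path supremum
  times \<open>Z\<close> dominates.\<close>

lemma equivalent_lmm_pricing_density:
  assumes Q: "equivalent_lmm M F T S Q"
  shows "\<exists>Z. pricing_density Z"
proof -
  interpret Q: prob_space Q using Q by (simp add: equivalent_lmm_def)
  have sQ: "sets Q = sets M" and ac: "absolutely_continuous M Q" "absolutely_continuous Q M"
    using Q by (auto simp: equivalent_lmm_def)
  have space_Q: "space Q = space M" using sets_eq_imp_space_eq[OF sQ] .
  have null: "null_sets Q = null_sets M" using ac by (auto simp: absolutely_continuous_def)
  have STQ: "stopping_times Q F T = ST" by (simp add: stopping_times_def space_Q)
  \<comment> \<open>Equivalent measures have the same null sets, so completeness of the filtration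
    carries over to \<open>Q\<close>.\<close>
  interpret Q: usual_filtered_prob_space Q F T
  proof unfold_locales
    show "space (F i) = space Q" for i by (simp add: space_F space_Q)
    show "sets (F i) \<subseteq> sets (F j)" if "i \<le> j" for i j by (rule sets_F_mono[OF that])
    show "sets (F t) = sets Q" if "T \<le> t" for t using sets_F_horizon[OF that] sQ by simp
    show "A \<in> sets (F 0)" if "N \<in> null_sets Q" "A \<subseteq> N" for A N using complete that null by auto
    show "sets (F t) = (\<Inter>s\<in>{t<..T}. sets (F s))" if "0 \<le> t" "t < T" for t
      by (rule right_continuous[OF that])
  qed (rule horizon_pos)
  have pre: "Q.pre_sigma = pre_sigma" by (simp add: space_Q)
  define Z where "Z \<omega> = enn2real (RN_deriv M Q \<omega>)" for \<omega>
  have ZL: "Z \<in> L2 M" using Q by (simp add: equivalent_lmm_def Z_def[abs_def])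
  then have [measurable]: "Z \<in> borel_measurable M" by measurable
  have "AE \<omega> in M. RN_deriv M Q \<omega> \<noteq> \<infinity>"
    by (rule RN_deriv_finite[OF _ ac(1) sQ]) unfold_locales
  \<comment> \<open>The Radon-Nikodym derivative is finite almost everywhere, so passing to real
    values changes it on a null set only.\<close>
  then have "density M (\<lambda>\<omega>. ennreal (Z \<omega>)) = density M (RN_deriv M Q)"
    by (intro density_cong) (auto simp: Z_def less_top elim!: eventually_mono)
  then have dens: "density M (\<lambda>\<omega>. ennreal (Z \<omega>)) = Q" using density_RN_deriv[OF ac(1) sQ] by simp
  have Z0: "AE \<omega> in M. 0 \<le> Z \<omega>" by (simp add: Z_def)
  \<comment> \<open>\<open>Q\<close> has no mass where its density vanishes; by equivalence neither
    has \<open>M\<close>.\<close>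
  have "{\<omega>\<in>space M. Z \<omega> = 0} \<in> null_sets (density M (\<lambda>\<omega>. ennreal (Z \<omega>)))"
    by (subst null_sets_density_iff) auto
  then have "{\<omega>\<in>space M. Z \<omega> = 0} \<in> null_sets M" unfolding dens null .
  then have "AE \<omega> in M. Z \<omega> \<noteq> 0" by (rule AE_I'[of "{\<omega>\<in>space M. Z \<omega> = 0}"]) auto
  with Z0 have Zpos: "AE \<omega> in M. 0 < Z \<omega>" by eventually_elim simp
  have int_Q: "integrable Q f \<longleftrightarrow> integrable M (\<lambda>\<omega>. Z \<omega> * f \<omega>)"
    and integral_Q: "(\<integral>\<omega>. f \<omega> \<partial>Q) = (\<integral>\<omega>. Z \<omega> * f \<omega> \<partial>M)" if "f \<in> borel_measurable M" for f :: "'a \<Rightarrow> real"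
    using integrable_density[of f M Z] integral_density[of f M Z] that Z0 by (simp_all add: dens)
  obtain \<rho> where \<rho>: "localizing_sequence Q F T \<rho>" "\<And>k. martingale Q F T (stopped_process (\<rho> k) S)"
    using Q by (auto simp: equivalent_lmm_def local_martingale_def)
  have \<rho>ST: "\<rho> k \<in> ST" for k using \<rho>(1) by (auto simp: localizing_sequence_def STQ)
  define Y where "Y k i t \<omega> = stopped_process (\<rho> k) S t \<omega> $ i" for k i t \<omega>
  have Y: "Q.continuous_martingale (Y k i)" for k i
    unfolding Q.continuous_martingale_def
  proof (intro conjI ballI)
    note mart = \<rho>(2)[of k]
    fix t assume t: "t \<in> {0..T}"
    have "stopped_process (\<rho> k) S t \<in> borel_measurable (F t)"
      using mart t by (auto simp: martingale_def adapted_def)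
    then show "Y k i t \<in> borel_measurable (F t)"
      unfolding Y_def by (rule borel_measurable_component)
    have int: "integrable Q (Y k i s)" if "s \<in> {0..T}" for s
    proof -
      have "integrable Q (stopped_process (\<rho> k) S s)" using mart that by (auto simp: martingale_def)
      then show ?thesis unfolding Y_def by (rule integrable_bounded_linear[OF bounded_linear_vec_nth])
    qed
    show "integrable Q (Y k i t)" by (rule int[OF t])
    interpret sub: finite_measure_subalgebra Q "F t"
      by unfold_locales (use Q.sets_F_subset in \<open>auto simp: subalgebra_def Q.space_F\<close>)
    fix A assume A: "A \<in> sets (F t)"
    have T: "T \<in> {t..T}" "T \<in> {0..T}" using t by auto
    have "AE \<omega> in Q. real_cond_exp Q (F t) (Y k i T) \<omega> = Y k i t \<omega>"
      using mart t T unfolding martingale_def Y_def[abs_def] by blast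
    then have "(\<integral>\<omega>\<in>A. real_cond_exp Q (F t) (Y k i T) \<omega> \<partial>Q) = (\<integral>\<omega>\<in>A. Y k i t \<omega> \<partial>Q)"
      unfolding set_lebesgue_integral_def
      using A Q.sets_F_subset[of t] int[OF t]
      by (intro integral_cong_AE) (auto elim!: eventually_mono intro!: borel_measurable_scaleR)
    then show "(\<integral>\<omega>. indicator A \<omega> * Y k i t \<omega> \<partial>Q) = (\<integral>\<omega>. indicator A \<omega> * Y k i T \<omega> \<partial>Q)"
      using sub.real_cond_exp_intA[OF int[OF T(2)] A] by (simp add: set_lebesgue_integral_def)
  next
    fix \<omega> assume "\<omega> \<in> space Q"
    then have \<omega>: "\<omega> \<in> space M" by (simp add: space_Q)
    show "continuous_on {0..T} (\<lambda>t. Y k i t \<omega>)"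
      unfolding Y_def stopped_process_def using STD(2,3)[OF \<rho>ST \<omega>]
      by (intro continuous_on_component continuous_on_compose2[OF S_continuous[OF \<omega>]] continuous_intros) auto
  qed
  have elem: "(\<integral>\<omega>. Z \<omega> * elementary_gain x \<omega> \<partial>M) = 0" if x: "elementary_from \<rho>' x" for \<rho>' x
  proof -
    obtain a b \<xi> where x_eq: "x = (a, b, \<xi>)" by (cases x)
    note x = elementary_fromD[OF x[unfolded x_eq]]
    obtain C where C: "\<forall>\<omega>\<in>space M. norm (\<xi> \<omega>) \<le> C" using x(6) by blast
    \<comment> \<open>The gain is split into coordinates, since optional sampling is for real-valued
      processes; \<open>Y k i\<close> is a coordinate of the stopped price.\<close>
    define g where "g k i \<omega> = \<xi> \<omega> $ i * (Y k i (b \<omega>) \<omega> - Y k i (a \<omega>) \<omega>)" for k i \<omega>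
    have \<xi>i: "(\<lambda>\<omega>. \<xi> \<omega> $ i) \<in> borel_measurable (pre_sigma a)" for i
      by (rule borel_measurable_component[OF x(5)])
    have g0: "(\<integral>\<omega>. g k i \<omega> \<partial>Q) = 0" for k i
      unfolding g_def
    proof (rule Q.optional_sampling_increment[OF Y, where C=C])
      show "\<bar>\<xi> \<omega> $ i\<bar> \<le> C" if "\<omega> \<in> space Q" for \<omega>
        using C that component_le_norm_cart[of "\<xi> \<omega>" i] by (auto simp: space_Q intro: order_trans)
    qed (use x \<xi>i in \<open>auto simp: STQ space_Q\<close>)
    define h where "h k \<omega> = (\<Sum>i\<in>UNIV. g k i \<omega>)" for k \<omega>
    have h_eq: "h k \<omega> = \<xi> \<omega> \<bullet> (S (min (b \<omega>) (\<rho> k \<omega>)) \<omega> - S (min (a \<omega>) (\<rho> k \<omega>)) \<omega>)" for k \<omega>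
      by (simp add: h_def g_def Y_def stopped_process_def inner_vec_def)
    have ab: "0 \<le> min (a \<omega>) (\<rho> k \<omega>) \<and> min (a \<omega>) (\<rho> k \<omega>) \<le> b \<omega>"
      "0 \<le> min (b \<omega>) (\<rho> k \<omega>) \<and> min (b \<omega>) (\<rho> k \<omega>) \<le> b \<omega>" "b \<omega> \<le> T" if "\<omega> \<in> space M" for \<omega> k
      using x(4)[OF that] STD(2)[OF \<rho>ST that, of k] by auto
    have meas: "(\<lambda>\<omega>. S (min (c \<omega>) (\<rho> k \<omega>)) \<omega>) \<in> borel_measurable M" if "c \<in> ST" for c k
      using STD[OF ST_min[OF that \<rho>ST]] by (intro S_at_measurable) auto
    have [measurable]: "\<xi> \<in> borel_measurable M" by (rule measurable_pre_sigma_M[OF x(1,5)])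
    have [measurable]: "(\<lambda>\<omega>. S (min (b \<omega>) (\<rho> k \<omega>)) \<omega>) \<in> borel_measurable M"
      "(\<lambda>\<omega>. S (min (a \<omega>) (\<rho> k \<omega>)) \<omega>) \<in> borel_measurable M" for k
      by (rule meas[OF x(3)], rule meas[OF x(1)])
    have gm: "g k i \<in> borel_measurable M" for k i
      unfolding g_def Y_def stopped_process_def by measurable
    have dom: "\<bar>g k i \<omega>\<bar> \<le> 2 * C * running_sup S b \<omega>" "\<bar>h k \<omega>\<bar> \<le> 2 * C * running_sup S b \<omega>"
      if \<omega>: "\<omega> \<in> space M" for k i \<omega>
    proof -
      let ?u = "S (min (b \<omega>) (\<rho> k \<omega>)) \<omega> - S (min (a \<omega>) (\<rho> k \<omega>)) \<omega>"
      have C0: "norm (\<xi> \<omega>) \<le> C" using C \<omega> by blast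
      have C1: "0 \<le> C" by (rule order_trans[OF norm_ge_zero C0])
      have "norm ?u \<le> running_sup S b \<omega> + running_sup S b \<omega>"
        using ab(1,2)[OF \<omega>, of k] ab(3)[OF \<omega>] by (intro order_trans[OF norm_triangle_ineq4] add_mono running_sup_upper \<omega>) auto
      then have "norm (\<xi> \<omega>) * norm ?u \<le> C * (running_sup S b \<omega> + running_sup S b \<omega>)"
        using C0 C1 by (intro mult_mono) auto
      then have le: "norm (\<xi> \<omega>) * norm ?u \<le> 2 * C * running_sup S b \<omega>" by (simp add: algebra_simps)
      show "\<bar>h k \<omega>\<bar> \<le> 2 * C * running_sup S b \<omega>"
        unfolding h_eq by (rule order_trans[OF Cauchy_Schwarz_ineq2 le])
      have "\<bar>g k i \<omega>\<bar> = \<bar>\<xi> \<omega> $ i\<bar> * \<bar>?u $ i\<bar>"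
        by (simp add: g_def Y_def stopped_process_def abs_mult)
      also have "\<dots> \<le> norm (\<xi> \<omega>) * norm ?u"
        by (intro mult_mono component_le_norm_cart) auto
      finally show "\<bar>g k i \<omega>\<bar> \<le> 2 * C * running_sup S b \<omega>" using le by simp
    qed
    \<comment> \<open>The dominating variable and \<open>Z\<close> are both square integrable under
      \<open>M\<close>, so their product is integrable: here the square integrability of the density
      enters.\<close>
    have R: "(\<lambda>\<omega>. 2 * C * running_sup S b \<omega>) \<in> L2 M" using x(2) by (intro L2_cmult) (simp add: admissible_def)
    have RQ: "integrable Q (\<lambda>\<omega>. 2 * C * running_sup S b \<omega>)"
      using L2_measurable[OF R] L2_integrable_mult[OF ZL R] by (subst int_Q) auto
    have mQ: "f \<in> borel_measurable Q" if "f \<in> borel_measurable M" for f :: "'a \<Rightarrow> real"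
      using that measurable_cong_sets[OF sQ refl] by blast
    have g_int: "integrable Q (g k i)" for k i
    proof (rule Bochner_Integration.integrable_bound[OF RQ mQ[OF gm]])
      show "AE \<omega> in Q. norm (g k i \<omega>) \<le> norm (2 * C * running_sup S b \<omega>)"
        using dom(1) by (intro AE_I2) (auto simp: space_Q intro: order_trans[OF _ abs_ge_self])
    qed
    have h0: "(\<integral>\<omega>. h k \<omega> \<partial>Q) = 0" for k
      unfolding h_def using g_int g0 by (subst Bochner_Integration.integral_sum) auto
    have hm: "h k \<in> borel_measurable M" for k unfolding h_def using gm by (intro borel_measurable_sum)
    have eg: "elementary_gain x \<in> L2 M" using elementary_gain_L2 that by blast
    have "(\<lambda>k. \<integral>\<omega>. h k \<omega> \<partial>Q) \<longlonglongrightarrow> (\<integral>\<omega>. elementary_gain x \<omega> \<partial>Q)"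
    proof (rule integral_dominated_convergence[OF _ _ RQ])
      show "elementary_gain x \<in> borel_measurable Q" "h k \<in> borel_measurable Q" for k
        using eg hm by (auto intro: mQ L2_measurable)
      show "AE \<omega> in Q. (\<lambda>k. h k \<omega>) \<longlonglongrightarrow> elementary_gain x \<omega>"
        using localizing_AE_eventually[OF Q.prob_space_axioms space_Q sQ \<rho>(1)]
      proof (rule AE_mp[OF _ AE_I2], intro impI)
        fix \<omega> assume \<omega>: "\<omega> \<in> space Q" and ev: "\<forall>\<^sub>F k in sequentially. \<rho> k \<omega> = T"
        have "a \<omega> \<le> T" "b \<omega> \<le> T" using x(4)[of \<omega>] \<omega> by (auto simp: space_Q)
        then have "h k \<omega> = elementary_gain x \<omega>" if "\<rho> k \<omega> = T" for k
          using that by (simp add: h_eq elementary_gain_def x_eq min_absorb1)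
        then have "\<forall>\<^sub>F k in sequentially. h k \<omega> = elementary_gain x \<omega>" using ev by (rule eventually_mono[rotated])
        then show "(\<lambda>k. h k \<omega>) \<longlonglongrightarrow> elementary_gain x \<omega>" by (rule tendsto_eventually)
      qed
      show "AE \<omega> in Q. norm (h k \<omega>) \<le> 2 * C * running_sup S b \<omega>" for k
        using dom(2) by (intro AE_I2) (simp add: space_Q)
    qed
    then have "(\<integral>\<omega>. elementary_gain x \<omega> \<partial>Q) = 0" unfolding h0 by (simp add: LIMSEQ_const_iff)
    then show ?thesis using integral_Q[OF L2_measurable[OF eg]] by simp
  qed
  have "(\<integral>\<omega>. Z \<omega> * h \<omega> \<partial>M) = 0" if h: "gain_from \<rho>' h" for \<rho>' h
  proof -
    obtain xs where xs: "\<forall>x\<in>set xs. elementary_from \<rho>' x" "\<forall>\<omega>\<in>space M. h \<omega> = (\<Sum>x\<leftarrow>xs. elementary_gain x \<omega>)"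
      using h unfolding gain_from_def by blast
    have "(\<integral>\<omega>. Z \<omega> * (\<Sum>x\<leftarrow>xs. elementary_gain x \<omega>) \<partial>M) = 0 \<and> (\<lambda>\<omega>. \<Sum>x\<leftarrow>xs. elementary_gain x \<omega>) \<in> L2 M"
      using xs(1)
    proof (induction xs)
      case (Cons x xs)
      then have x: "elementary_from \<rho>' x" and IH: "(\<integral>\<omega>. Z \<omega> * (\<Sum>x\<leftarrow>xs. elementary_gain x \<omega>) \<partial>M) = 0"
        "(\<lambda>\<omega>. \<Sum>x\<leftarrow>xs. elementary_gain x \<omega>) \<in> L2 M" by auto
      note xL = elementary_gain_L2[OF x]
      show ?case
        using L2_integrable_mult[OF ZL xL] L2_integrable_mult[OF ZL IH(2)] elem[OF x] IH L2_add[OF xL IH(2)]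
        by (simp add: distrib_left)
    qed (simp add: L2_zero_fun)
    moreover have "(\<integral>\<omega>. Z \<omega> * h \<omega> \<partial>M) = (\<integral>\<omega>. Z \<omega> * (\<Sum>x\<leftarrow>xs. elementary_gain x \<omega>) \<partial>M)"
      using xs(2) by (intro Bochner_Integration.integral_cong) auto
    ultimately show ?thesis by simp
  qed
  then show ?thesis using ZL Zpos by (auto simp: pricing_density_def orthogonal_density_def)
qed

end

lemma cadlag_paths_of_continuous:
  assumes "\<And>\<omega>. \<omega> \<in> space N \<Longrightarrow> continuous_on {0..T} (\<lambda>t. X t \<omega>)"
  shows "cadlag_paths N T X"
  unfolding cadlag_paths_def
proof (intro ballI conjI)
  fix \<omega> t assume "\<omega> \<in> space N" and t: "t \<in> {0..<T}"
  then have "((\<lambda>u. X u \<omega>) \<longlongrightarrow> X t \<omega>) (at t within {0..T})"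
    using assms by (auto simp: continuous_on_def)
  then have "((\<lambda>u. X u \<omega>) \<longlongrightarrow> X t \<omega>) (at t within {t..T})"
    by (rule tendsto_within_subset) (use t in auto)
  then show "((\<lambda>u. X u \<omega>) \<longlongrightarrow> X t \<omega>) (at_right t)"
    using t by (simp add: at_within_Icc_at_right)
next
  fix \<omega> t assume "\<omega> \<in> space N" and t: "t \<in> {0<..T}"
  then have "((\<lambda>u. X u \<omega>) \<longlongrightarrow> X t \<omega>) (at t within {0..T})"
    using assms by (auto simp: continuous_on_def)
  then have "((\<lambda>u. X u \<omega>) \<longlongrightarrow> X t \<omega>) (at t within {0..t})"
    by (rule tendsto_within_subset) (use t in auto)
  then show "\<exists>l. ((\<lambda>u. X u \<omega>) \<longlongrightarrow> l) (at_left t)"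
    using t by (auto simp: at_within_Icc_at_left)
qed

section \<open>From a pricing density to martingale measures, equivalent and signed\<close>

context continuous_market
begin

text \<open>The normalised density defines \<open>Q\<close>. A square-localizing sequence for
  \<open>S\<close> also localizes under \<open>Q\<close>, and the martingale property of the stopped
  price, tested on an event \<open>A\<close> known at \<open>s\<close>, is orthogonality to the
  trade that holds one unit of asset \<open>i\<close> on \<open>A\<close> between \<open>s\<close>
  and \<open>t\<close>.\<close>

lemma pricing_density_equivalent_lmm:
  assumes Z: "pricing_density Z"
  shows "\<exists>Q. equivalent_lmm M F T S Q"
proof -
  have orth: "orthogonal_density Z" and ZL: "Z \<in> L2 M" and Zpos: "AE \<omega> in M. 0 < Z \<omega>"
    using Z by (auto simp: pricing_density_def orthogonal_density_def)
  define c where "c = (\<integral>\<omega>. Z \<omega> \<partial>M)"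
  have "c \<noteq> 0"
  proof
    assume "c = 0"
    then have "AE \<omega> in M. (1::real) = 0"
      by (intro AE_zero_of_weighted_integral[OF Zpos ZL L2_const]) (auto simp: c_def)
    then show False by simp
  qed
  moreover have "0 \<le> c" unfolding c_def by (rule integral_nonneg_AE) (use Zpos in \<open>auto elim!: eventually_mono\<close>)
  ultimately have c: "0 < c" by simp
  define D where "D \<omega> = Z \<omega> / c" for \<omega>
  have DL: "D \<in> L2 M" using L2_cmult[OF ZL, of "1 / c"] by (simp add: D_def[abs_def])
  then have [measurable]: "D \<in> borel_measurable M" by measurable
  have Dpos: "AE \<omega> in M. 0 < D \<omega>" using Zpos by eventually_elim (simp add: D_def c)
  then have D0: "AE \<omega> in M. 0 \<le> D \<omega>" by eventually_elim simp
  have D1: "(\<integral>\<omega>. D \<omega> \<partial>M) = 1" using c by (simp add: D_def c_def)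
  have Dorth: "(\<integral>\<omega>. D \<omega> * h \<omega> \<partial>M) = 0" if "gain_from \<rho> h" for \<rho> h
    using orth that by (simp add: D_def orthogonal_density_def)
  define Q where "Q = density M (\<lambda>\<omega>. ennreal (D \<omega>))"
  have space_Q: "space Q = space M" and sets_Q: "sets Q = sets M" by (simp_all add: Q_def)
  have "emeasure Q (space Q) = (\<integral>\<^sup>+\<omega>. ennreal (D \<omega>) \<partial>M)"
    by (subst nn_integral_density[where f="\<lambda>\<omega>. ennreal (D \<omega>)" and g="\<lambda>\<omega>. 1", simplified, symmetric])
      (simp_all add: Q_def)
  also have "\<dots> = 1" using D1 L2_integrable[OF DL] D0 by (simp add: nn_integral_eq_integral)
  finally interpret Q: prob_space Q by (rule prob_spaceI)
  have ac: "absolutely_continuous M Q" unfolding Q_def by (rule absolutely_continuousI_density) measurable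
  have ac': "absolutely_continuous Q M"
    unfolding absolutely_continuous_def Q_def
  proof
    fix A assume "A \<in> null_sets (density M (\<lambda>\<omega>. ennreal (D \<omega>)))"
    then have A: "A \<in> sets M" "AE \<omega> in M. \<omega> \<in> A \<longrightarrow> ennreal (D \<omega>) = 0"
      by (auto simp: null_sets_density_iff)
    from A(2) Dpos have "AE \<omega> in M. \<omega> \<notin> A" by eventually_elim auto
    then show "A \<in> null_sets M" using A(1) AE_iff_null_sets by blast
  qed
  have "AE \<omega> in M. ennreal (D \<omega>) = RN_deriv M Q \<omega>"
    by (rule RN_deriv_unique) (simp_all add: Q_def)
  with D0 have RN: "AE \<omega> in M. enn2real (RN_deriv M Q \<omega>) = D \<omega>" by eventually_elim (metis enn2real_ennreal)
  have RN_L2: "(\<lambda>\<omega>. enn2real (RN_deriv M Q \<omega>)) \<in> L2 M"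
    by (rule L2_dominated[OF DL]) (measurable, use RN in \<open>auto elim!: eventually_mono\<close>)
  have int_Q: "integrable Q f \<longleftrightarrow> integrable M (\<lambda>\<omega>. D \<omega> * f \<omega>)"
    and integral_Q: "(\<integral>\<omega>. f \<omega> \<partial>Q) = (\<integral>\<omega>. D \<omega> * f \<omega> \<partial>M)" if "f \<in> borel_measurable M" for f :: "'a \<Rightarrow> real"
    using integrable_density[of f M D] integral_density[of f M D] that D0 by (simp_all add: Q_def)
  have mQ: "f \<in> borel_measurable Q \<longleftrightarrow> f \<in> borel_measurable M" for f :: "'a \<Rightarrow> 'c::topological_space"
    using measurable_cong_sets[OF sets_Q refl] by blast
  obtain \<tau> where \<tau>: "square_localizing M F T S \<tau>"
    using S_locally_square_integrable by (auto simp: locally_square_integrable_def)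
  have adm: "admissible (\<tau> n)" for n by (rule square_localizing_admissible[OF \<tau>])
  note \<tau>ST = admissible_ST[OF adm]
  \<comment> \<open>By Cauchy-Schwarz events of vanishing probability under \<open>M\<close> also
    vanish under \<open>Q\<close>, in particular those on which a localizing time is below
    \<open>T\<close>.\<close>
  have Q_le: "Q.prob A \<le> L2_norm M D * sqrt (prob A)" if A: "A \<in> sets M" for A
  proof -
    have "Q.prob A = (\<integral>\<omega>. indicator A \<omega> \<partial>Q)" using A sets.sets_into_space[OF A] by (simp add: sets_Q Int_absorb2 space_Q)
    also have "\<dots> = (\<integral>\<omega>. D \<omega> * indicator A \<omega> \<partial>M)" by (intro integral_Q borel_measurable_indicator A)
    also have "\<dots> \<le> L2_norm M D * sqrt (prob A)"
      using L2_Cauchy_Schwarz[OF DL L2_indicator[OF A]] A by (simp add: L2_norm_indicator)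
    finally show ?thesis .
  qed
  have "localizing_sequence Q F T \<tau>"
    unfolding localizing_sequence_def
  proof (intro conjI allI ballI)
    show "\<tau> n \<in> stopping_times Q F T" for n using \<tau>ST by (simp add: stopping_times_def space_Q)
    show "\<tau> n \<omega> \<le> \<tau> (Suc n) \<omega>" if "\<omega> \<in> space Q" for n \<omega>
      using \<tau> that by (auto simp: square_localizing_def localizing_sequence_def space_Q)
    have [measurable]: "\<tau> n \<in> borel_measurable M" for n by (rule STD(4)[OF \<tau>ST])
    show "(\<lambda>n. Q.prob {\<omega>\<in>space Q. \<tau> n \<omega> < T}) \<longlonglongrightarrow> 0"
    proof (rule tendsto_sandwich[OF _ always_eventually tendsto_const])
      have "(\<lambda>n. prob {\<omega>\<in>space M. \<tau> n \<omega> < T}) \<longlonglongrightarrow> 0"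
        using \<tau> by (simp add: square_localizing_def localizing_sequence_def)
      then have "(\<lambda>n. sqrt (prob {\<omega>\<in>space M. \<tau> n \<omega> < T})) \<longlonglongrightarrow> sqrt 0" by (rule tendsto_real_sqrt)
      then show "(\<lambda>n. L2_norm M D * sqrt (prob {\<omega>\<in>space M. \<tau> n \<omega> < T})) \<longlonglongrightarrow> 0"
        by (intro tendsto_mult_right_zero) simp
      have "{\<omega>\<in>space M. \<tau> n \<omega> < T} \<in> sets M" for n by measurable
      from Q_le[OF this] show "\<forall>n. Q.prob {\<omega>\<in>space Q. \<tau> n \<omega> < T} \<le> L2_norm M D * sqrt (prob {\<omega>\<in>space M. \<tau> n \<omega> < T})"
        by (simp add: space_Q)
    qed auto
  qed
  moreover have "martingale Q F T (stopped_process (\<tau> n) S)" for n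
    unfolding martingale_def
  proof (intro conjI ballI allI)
    let ?X = "stopped_process (\<tau> n) S"
    have X_eq: "?X t \<omega> = S (min (\<tau> n \<omega>) t) \<omega>" for t \<omega> by (simp add: stopped_process_def min.commute)
    have Xad: "?X t \<in> borel_measurable (F t)" if "t \<in> {0..T}" for t
      unfolding X_eq[abs_def] using that by (intro S_min_measurable \<tau>ST) auto
    then show "adapted F T ?X" by (simp add: adapted_def)
    have cont: "continuous_on {0..T} (\<lambda>t. ?X t \<omega>)" if "\<omega> \<in> space Q" for \<omega>
      unfolding X_eq using that STD(2,3)[OF \<tau>ST, of \<omega> n]
      by (intro continuous_on_compose2[OF S_continuous] continuous_intros) (auto simp: space_Q)
    show "cadlag_paths Q T ?X" by (rule cadlag_paths_of_continuous[OF cont])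
    have XL: "(\<lambda>\<omega>. norm (?X t \<omega>)) \<in> L2 M" if "t \<in> {0..T}" for t
      unfolding X_eq using that STD[OF \<tau>ST] by (intro admissible_norm_L2[OF adm[of n]]) auto
    have [measurable]: "?X t \<in> borel_measurable M" if "t \<in> {0..T}" for t
      by (rule measurable_F_M[OF Xad[OF that]])
    show int: "integrable Q (?X t)" if t: "t \<in> {0..T}" for t
    proof -
      have "integrable Q (\<lambda>\<omega>. norm (?X t \<omega>))"
        using L2_integrable_mult[OF DL XL[OF t]] L2_measurable[OF XL[OF t]] by (subst int_Q) auto
      then show ?thesis using measurable_F_M[OF Xad[OF t]] by (subst (asm) integrable_norm_iff) (auto simp: mQ)
    qed
    fix s t i assume s: "s \<in> {0..T}" and t: "t \<in> {s..T}"
    then have t0: "t \<in> {0..T}" by auto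
    interpret sub: finite_measure_subalgebra Q "F s"
      by unfold_locales (use sets_F_subset in \<open>auto simp: subalgebra_def space_F space_Q sets_Q\<close>)
    have inti: "integrable Q (\<lambda>\<omega>. ?X u \<omega> $ i)" if "u \<in> {0..T}" for u
      using int[OF that] by (rule integrable_bounded_linear[OF bounded_linear_vec_nth])
    show "AE \<omega> in Q. real_cond_exp Q (F s) (\<lambda>\<omega>. ?X t \<omega> $ i) \<omega> = ?X s \<omega> $ i"
    proof (rule sub.real_cond_exp_charact[OF _ inti[OF t0] inti[OF s]])
      show "(\<lambda>\<omega>. ?X s \<omega> $ i) \<in> borel_measurable (F s)" by (rule borel_measurable_component[OF Xad[OF s]])
      fix A assume A: "A \<in> sets (F s)"
      have AM: "A \<in> sets M" using A sets_F_subset by auto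
      have sST: "(\<lambda>\<omega>. s) \<in> ST" using s by (intro ST_const) auto
      define a b where "a \<omega> = min (\<tau> n \<omega>) s" and "b \<omega> = min (\<tau> n \<omega>) t" for \<omega>
      have aST: "a \<in> ST" unfolding a_def by (intro ST_min \<tau>ST sST)
      have bST: "b \<in> ST" unfolding b_def using t0 by (intro ST_min \<tau>ST ST_const) auto
      have A': "A \<in> sets (pre_sigma (\<lambda>\<omega>. s))" using A by (simp add: pre_sigma_const)
      \<comment> \<open>\<open>s \<le> a\<close> means that \<open>\<tau> n\<close> is not before
        \<open>s\<close>; if it is, the trading interval is empty. Of \<open>A\<close>, which is
        known at \<open>s\<close>, only the part with \<open>s \<le> a\<close> is claimed to be
        known at \<open>a\<close>.\<close>
      define \<xi> :: "'a \<Rightarrow> real ^ 'd" where "\<xi> \<omega> = indicator {\<omega>\<in>A. s \<le> a \<omega>} \<omega> *\<^sub>R axis i 1" for \<omega>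
      have "\<xi> \<in> borel_measurable (pre_sigma a)"
        unfolding \<xi>_def
        by (intro borel_measurable_scaleR borel_measurable_indicator pre_sigma_le_Int[OF sST aST A'] borel_measurable_const)
      moreover have "norm (\<xi> \<omega>) \<le> 1" for \<omega> by (simp add: \<xi>_def indicator_def norm_axis_1)
      moreover have "admissible b" by (rule admissible_mono[OF adm[of n] bST]) (simp add: b_def)
      moreover have "a \<omega> \<le> b \<omega>" for \<omega> using t by (auto simp: a_def b_def)
      ultimately have "elementary_from (\<lambda>\<omega>. 0) (a, b, \<xi>)"
        using aST STD(2)[OF aST] unfolding elementary_from_def by auto
      note h = elementary_gain_from[OF this]
      have eq: "elementary_gain (a, b, \<xi>) \<omega> = indicator A \<omega> * (?X t \<omega> $ i - ?X s \<omega> $ i)" for \<omega>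
      proof (cases "s \<le> \<tau> n \<omega>")
        case True
        then show ?thesis
          by (auto simp: elementary_gain_def \<xi>_def X_eq a_def b_def inner_axis' indicator_def)
      next
        case False
        then show ?thesis using t by (simp add: elementary_gain_def \<xi>_def X_eq a_def b_def)
      qed
      have "0 = (\<integral>\<omega>. elementary_gain (a, b, \<xi>) \<omega> \<partial>Q)"
        using Dorth[OF h] integral_Q[OF L2_measurable[OF gain_from_L2[OF h]]] by simp
      also have "\<dots> = (\<integral>\<omega>. indicator A \<omega> * ?X t \<omega> $ i - indicator A \<omega> * ?X s \<omega> $ i \<partial>Q)"
        by (simp add: eq right_diff_distrib)
      also have "\<dots> = (\<integral>\<omega>. indicator A \<omega> * ?X t \<omega> $ i \<partial>Q) - (\<integral>\<omega>. indicator A \<omega> * ?X s \<omega> $ i \<partial>Q)"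
        using integrable_mult_indicator[OF _ inti[OF t0], of A] integrable_mult_indicator[OF _ inti[OF s], of A] AM
        by (intro Bochner_Integration.integral_diff) (auto simp: sets_Q)
      finally show "(\<integral>\<omega>\<in>A. ?X t \<omega> $ i \<partial>Q) = (\<integral>\<omega>\<in>A. ?X s \<omega> $ i \<partial>Q)"
        by (simp add: set_lebesgue_integral_def)
    qed
  qed
  moreover have "adapted F T S" using S_adapted by (simp add: adapted_def)
  moreover have "cadlag_paths Q T S"
    by (rule cadlag_paths_of_continuous) (auto simp: space_Q S_continuous)
  ultimately have "local_martingale Q F T S" unfolding local_martingale_def by blast
  then have "equivalent_lmm M F T S Q"
    using Q.prob_space_axioms sets_Q ac ac' RN_L2 by (simp add: equivalent_lmm_def)
  then show ?thesis by blast
qed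

lemma signed_measure_density:
  assumes Z: "integrable M Z" shows "signed_measure M (\<lambda>A. set_lebesgue_integral M A Z)"
  unfolding signed_measure_def
proof (intro conjI allI impI)
  fix A :: "nat \<Rightarrow> 'a set" assume A: "range A \<subseteq> sets M \<and> disjoint_family A"
  have AM: "A i \<in> sets M" for i using A by auto
  have [measurable]: "Z \<in> borel_measurable M" using Z by measurable
  have "(\<Sum>i<n. set_lebesgue_integral M (A i) Z) = (\<integral>\<omega>. indicator (\<Union>i<n. A i) \<omega> *\<^sub>R Z \<omega> \<partial>M)" for n
  proof -
    have "disjoint_family_on A {..<n}" using A by (auto simp: disjoint_family_on_def)
    then have "indicator (\<Union>i<n. A i) \<omega> *\<^sub>R Z \<omega> = (\<Sum>i<n. indicator (A i) \<omega> *\<^sub>R Z \<omega>)" for \<omega>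
      by (simp add: indicator_UN_disjoint sum_distrib_right)
    then show ?thesis
      unfolding set_lebesgue_integral_def
      by (simp only:) (intro Bochner_Integration.integral_sum[symmetric] integrable_mult_indicator AM Z)
  qed
  moreover have "(\<lambda>n. \<integral>\<omega>. indicator (\<Union>i<n. A i) \<omega> *\<^sub>R Z \<omega> \<partial>M) \<longlonglongrightarrow> (\<integral>\<omega>. indicator (\<Union>i. A i) \<omega> *\<^sub>R Z \<omega> \<partial>M)"
  proof (rule integral_dominated_convergence[where w="\<lambda>\<omega>. norm (Z \<omega>)"])
    show "AE \<omega> in M. (\<lambda>n. indicator (\<Union>i<n. A i) \<omega> *\<^sub>R Z \<omega>) \<longlonglongrightarrow> indicator (\<Union>i. A i) \<omega> *\<^sub>R Z \<omega>"
      by (intro AE_I2 tendsto_scaleR LIMSEQ_indicator_UN tendsto_const)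
    show "(\<lambda>\<omega>. indicator (\<Union>i<n. A i) \<omega> *\<^sub>R Z \<omega>) \<in> borel_measurable M" for n
      using AM by (intro borel_measurable_scaleR borel_measurable_indicator sets.finite_UN) auto
    show "(\<lambda>\<omega>. indicator (\<Union>i. A i) \<omega> *\<^sub>R Z \<omega>) \<in> borel_measurable M"
      using AM by (intro borel_measurable_scaleR borel_measurable_indicator sets.countable_UN) auto
  qed (use Z in \<open>auto simp: indicator_def\<close>)
  ultimately show "(\<lambda>n. set_lebesgue_integral M (A n) Z) sums set_lebesgue_integral M (\<Union>n. A n) Z"
    by (simp add: sums_def set_lebesgue_integral_def)
qed (simp add: set_lebesgue_integral_def)

lemma signed_lmmD:
  assumes "signed_lmm M F T S Q Z"
  shows "orthogonal_density Z" "(\<integral>\<omega>. Z \<omega> \<partial>M) = 1"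
proof -
  show "orthogonal_density Z" using assms by (auto simp: signed_lmm_def orthogonal_density_iff)
  have "Q (space M) = set_lebesgue_integral M (space M) Z" "Q (space M) = 1"
    using assms by (auto simp: signed_lmm_def signed_density_def)
  then have "set_lebesgue_integral M (space M) Z = 1" by simp
  then show "(\<integral>\<omega>. Z \<omega> \<partial>M) = 1"
    unfolding set_lebesgue_integral_def by (subst (asm) Bochner_Integration.integral_cong[where g=Z, OF refl]) auto
qed

lemma signed_lmmI:
  assumes Z: "orthogonal_density Z" and Z1: "(\<integral>\<omega>. Z \<omega> \<partial>M) = 1"
  shows "signed_lmm M F T S (\<lambda>A. set_lebesgue_integral M A Z) Z"
proof -
  have ZL: "Z \<in> L2 M" and orth: "\<forall>\<theta>\<in>simple_strategies M F T S. (\<integral>\<omega>. Z \<omega> * gains \<theta> S T \<omega> \<partial>M) = 0"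
    using Z by (auto simp: orthogonal_density_iff)
  have Zint: "integrable M Z" by (rule L2_integrable[OF ZL])
  have "set_lebesgue_integral M A Z = 0" if "A \<in> null_sets M" for A
    unfolding set_lebesgue_integral_def
    by (rule integral_eq_zero_AE) (use AE_not_in[OF that] in \<open>auto elim!: eventually_mono\<close>)
  moreover have "set_lebesgue_integral M (space M) Z = 1"
    unfolding set_lebesgue_integral_def Z1[symmetric] by (intro Bochner_Integration.integral_cong) auto
  ultimately show ?thesis
    unfolding signed_lmm_def signed_density_def using ZL orth Zint signed_measure_density[OF Zint] by auto
qed

text \<open>All competing densities have mean 1, so minimal variance and minimal norm are the
  same.\<close>

lemma variance_of_density:
  assumes "Z \<in> L2 M" "(\<integral>\<omega>. Z \<omega> \<partial>M) = 1"
  shows "(\<integral>\<omega>. (Z \<omega> - (\<integral>\<omega>. Z \<omega> \<partial>M))\<^sup>2 \<partial>M) = (L2_norm M Z)\<^sup>2 - 1"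
  using variance_eq[OF L2_integrable[OF assms(1)] L2_integrable_square[OF assms(1)]] assms(2)
  by (simp add: L2_norm_square)

end

section \<open>The element of minimal norm\<close>

context continuous_market
begin

text \<open>Up to the sign of the gains: 0 lies in the closure of 1 plus the gains.\<close>

definition unit_approximable :: bool where
  "unit_approximable \<longleftrightarrow> (\<exists>h. (\<forall>n. gain_from (\<lambda>\<omega>. 0) (h n)) \<and> L2_tendsto M h (\<lambda>\<omega>. 1))"

text \<open>
  By continuity, stopping the wealth \<open>1 + V\<close> at its first zero replaces its terminal value
  by \<open>0\<close> or leaves it unchanged.
\<close>

lemma stop_at_zero:
  assumes h: "gain_from (\<lambda>\<omega>. 0) h"
  obtains h' where "gain_from (\<lambda>\<omega>. 0) h'" "\<And>\<omega>. \<omega> \<in> space M \<Longrightarrow> 0 \<le> 1 + h' \<omega>"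
    "\<And>\<omega>. \<omega> \<in> space M \<Longrightarrow> \<bar>1 + h' \<omega>\<bar> \<le> \<bar>1 + h \<omega>\<bar>"
proof -
  obtain V where V: "gain_process V" "\<And>\<omega>. \<omega> \<in> space M \<Longrightarrow> V T \<omega> = h \<omega>"
    using gain_from_process[OF h] by blast
  define W where "W = (\<lambda>t \<omega>. 1 + V t \<omega>)"
  have cont: "continuous_on {0..T} (\<lambda>t. W t \<omega>)" "W 0 \<omega> = 1" if "\<omega> \<in> space M" for \<omega>
    using V(1) that by (auto simp: W_def gain_process_def intro!: continuous_intros)
  define \<sigma> where "\<sigma> = hitting_time W 0"
  have \<sigma>: "\<sigma> \<in> ST"
    unfolding \<sigma>_def using V(1) cont(1)
    by (intro ST_hitting_time) (auto simp: W_def gain_process_def intro!: borel_measurable_add)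
  show thesis
  proof (rule that[of "\<lambda>\<omega>. V (\<sigma> \<omega>) \<omega>"])
    show "gain_from (\<lambda>\<omega>. 0) (\<lambda>\<omega>. V (\<sigma> \<omega>) \<omega>)" using V(1) \<sigma> by (auto simp: gain_process_def)
    fix \<omega> assume \<omega>: "\<omega> \<in> space M"
    note hit = hitting_time_properties[of W \<omega> 0, OF cont(1)[OF \<omega>], folded \<sigma>_def]
    \<comment> \<open>A path started at 1 that is stopped before \<open>T\<close> sits exactly at 0;
      one that is not has no negative terminal value, since it would have crossed 0 earlier.\<close>
    have "(\<sigma> \<omega> < T \<and> W (\<sigma> \<omega>) \<omega> = 0) \<or> (\<sigma> \<omega> = T \<and> 0 \<le> W T \<omega>)"
      using hit(2,4-6) cont(2)[OF \<omega>] by force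
    then show "0 \<le> 1 + V (\<sigma> \<omega>) \<omega>" "\<bar>1 + V (\<sigma> \<omega>) \<omega>\<bar> \<le> \<bar>1 + h \<omega>\<bar>"
      using V(2)[OF \<omega>] by (auto simp: W_def)
  qed
qed

text \<open>The projection theorem, run with a minimising sequence of non-negative wealths, so that
  non-negativity passes to the limit along an almost surely convergent subsequence.\<close>

lemma minimal_element:
  assumes "\<not> unit_approximable"
  obtains X h where "orthogonal_density X" "AE \<omega> in M. 0 \<le> X \<omega>" "0 < (\<integral>\<omega>. (X \<omega>)\<^sup>2 \<partial>M)"
    "\<And>n. gain_from (\<lambda>\<omega>. 0) (h n)" "L2_tendsto M (\<lambda>n \<omega>. 1 + h n \<omega>) X"
proof -
  let ?N = "(\<lambda>h. L2_norm M (\<lambda>\<omega>. 1 + h \<omega>)) ` {h. gain_from (\<lambda>\<omega>. 0) h}"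
  define d where "d = Inf ?N"
  have bdd: "bdd_below ?N" by (intro bdd_belowI[of _ 0]) (auto simp: L2_norm_nonneg)
  have ne: "?N \<noteq> {}" using gain_from_zero by auto
  have gL: "(\<lambda>\<omega>. 1 + h \<omega>) \<in> L2 M" if "gain_from (\<lambda>\<omega>. 0) h" for h
    by (intro L2_add L2_const gain_from_L2[OF that])
  have d_le: "d \<le> L2_norm M (\<lambda>\<omega>. 1 + h \<omega>)" if "gain_from (\<lambda>\<omega>. 0) h" for h
    unfolding d_def using that by (intro cInf_lower bdd) auto
  have d0: "0 \<le> d" unfolding d_def using ne by (intro cInf_greatest) (auto simp: L2_norm_nonneg)
  define \<epsilon> where "\<epsilon> n = inverse (real (Suc n))" for n
  have \<epsilon>0: "\<epsilon> \<longlonglongrightarrow> 0" unfolding \<epsilon>_def by (rule LIMSEQ_inverse_real_of_nat)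
  have "\<exists>h. gain_from (\<lambda>\<omega>. 0) h \<and> (\<forall>\<omega>\<in>space M. 0 \<le> 1 + h \<omega>) \<and> L2_norm M (\<lambda>\<omega>. 1 + h \<omega>) < d + \<epsilon> n" for n
  proof -
    have "Inf ?N < d + \<epsilon> n" by (simp add: d_def \<epsilon>_def)
    from cInf_lessD[OF ne this] obtain h where h: "gain_from (\<lambda>\<omega>. 0) h" "L2_norm M (\<lambda>\<omega>. 1 + h \<omega>) < d + \<epsilon> n"
      by auto
    obtain h' where h': "gain_from (\<lambda>\<omega>. 0) h'" "\<And>\<omega>. \<omega> \<in> space M \<Longrightarrow> 0 \<le> 1 + h' \<omega>"
      "\<And>\<omega>. \<omega> \<in> space M \<Longrightarrow> \<bar>1 + h' \<omega>\<bar> \<le> \<bar>1 + h \<omega>\<bar>" using stop_at_zero[OF h(1)] by blast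
    have "L2_norm M (\<lambda>\<omega>. 1 + h' \<omega>) \<le> L2_norm M (\<lambda>\<omega>. 1 + h \<omega>)"
      using h'(3) by (intro L2_norm_mono gL[OF h(1)] L2_measurable[OF gL[OF h'(1)]] AE_I2)
    then show ?thesis using h(2) h'(1,2) by (intro exI[of _ h']) auto
  qed
  then obtain h where h: "\<And>n. gain_from (\<lambda>\<omega>. 0) (h n)" "\<And>n. \<forall>\<omega>\<in>space M. 0 \<le> 1 + h n \<omega>"
    "\<And>n. L2_norm M (\<lambda>\<omega>. 1 + h n \<omega>) < d + \<epsilon> n" by metis
  have Cauchy: "\<exists>N. \<forall>i\<ge>N. \<forall>j\<ge>N. L2_norm M (\<lambda>\<omega>. (1 + h i \<omega>) - (1 + h j \<omega>)) < e" if e: "0 < e" for e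
  proof -
    have "(\<lambda>n. 4 * (d + \<epsilon> n)\<^sup>2 - 4 * d\<^sup>2) \<longlonglongrightarrow> 4 * (d + 0)\<^sup>2 - 4 * d\<^sup>2" by (intro tendsto_intros \<epsilon>0)
    then have "\<forall>\<^sub>F n in sequentially. 4 * (d + \<epsilon> n)\<^sup>2 - 4 * d\<^sup>2 < e\<^sup>2"
      by (rule order_tendstoD(2)) (use e in simp)
    then obtain N where N: "4 * (d + \<epsilon> N)\<^sup>2 - 4 * d\<^sup>2 < e\<^sup>2" by (auto simp: eventually_sequentially)
    have sq: "(L2_norm M (\<lambda>\<omega>. 1 + h n \<omega>))\<^sup>2 \<le> (d + \<epsilon> N)\<^sup>2" if "N \<le> n" for n
    proof (rule power_mono[OF _ L2_norm_nonneg])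
      have "\<epsilon> n \<le> \<epsilon> N" using that by (simp add: \<epsilon>_def le_imp_inverse_le)
      then show "L2_norm M (\<lambda>\<omega>. 1 + h n \<omega>) \<le> d + \<epsilon> N" using h(3)[of n] by simp
    qed
    show ?thesis
    proof (intro exI[of _ N] allI impI)
      fix i j assume ij: "N \<le> i" "N \<le> j"
      have "gain_from (\<lambda>\<omega>. 0) (\<lambda>\<omega>. (1/2) * h i \<omega> + (1/2) * h j \<omega>)"
        by (intro gain_from_add gain_from_cmult h)
      from d_le[OF this] have "d \<le> L2_norm M (\<lambda>\<omega>. ((1 + h i \<omega>) + (1 + h j \<omega>)) / 2)"
        by (simp add: field_simps)
      then have le: "d\<^sup>2 \<le> (L2_norm M (\<lambda>\<omega>. ((1 + h i \<omega>) + (1 + h j \<omega>)) / 2))\<^sup>2" using d0 by (intro power_mono)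
      \<comment> \<open>Both norms are at most \<open>d + \<epsilon> N\<close> and the midpoint,
        again 1 plus a gain, has norm at least \<open>d\<close>; the parallelogram law bounds the
        squared distance by \<open>4 (d + \<epsilon> N)^2 - 4 d^2\<close>.\<close>
      have arith: "p < x" if "p = 2 * a + 2 * b - 4 * c" "a \<le> y" "b \<le> y" "4 * y - 4 * z < x" "z \<le> c"
        for p a b c x y z :: real using that by linarith
      define u where "u = (\<lambda>n \<omega>. 1 + h n \<omega>)"
      have uL: "u n \<in> L2 M" for n unfolding u_def using gL[OF h(1)] .
      note par = L2_norm_parallelogram[of "u i" M "u j", OF uL uL]
      have "(L2_norm M (\<lambda>\<omega>. u i \<omega> - u j \<omega>))\<^sup>2 < e\<^sup>2"
        by (rule arith[OF par]) (use sq[OF ij(1)] sq[OF ij(2)] N le in \<open>simp_all only: u_def\<close>)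
      then have "(L2_norm M (\<lambda>\<omega>. (1 + h i \<omega>) - (1 + h j \<omega>)))\<^sup>2 < e\<^sup>2" by (simp only: u_def)
      then show "L2_norm M (\<lambda>\<omega>. (1 + h i \<omega>) - (1 + h j \<omega>)) < e" 
        by (rule power2_less_imp_less) (use e in simp)
    qed
  qed
  obtain X where X: "L2_tendsto M (\<lambda>n \<omega>. 1 + h n \<omega>) X" using L2_complete[OF gL[OF h(1)] Cauchy] by blast
  have XL: "X \<in> L2 M" and Xlim: "(\<lambda>n. L2_norm M (\<lambda>\<omega>. 1 + h n \<omega> - X \<omega>)) \<longlonglongrightarrow> 0"
    using X by (auto simp: L2_tendsto_def)
  obtain r where r: "strict_mono r" "AE \<omega> in M. (\<lambda>n. 1 + h (r n) \<omega>) \<longlonglongrightarrow> X \<omega>"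
    using L2_tendsto_AE_subseq[OF X] by blast
  have X0: "AE \<omega> in M. 0 \<le> X \<omega>"
    using r(2) AE_space
  proof eventually_elim
    case (elim \<omega>)
    then show ?case by (intro LIMSEQ_le_const[OF elim(1)]) (use h(2) in auto)
  qed
  have X_le: "L2_norm M X \<le> d"
  proof -
    have "L2_norm M X \<le> (d + \<epsilon> n) + L2_norm M (\<lambda>\<omega>. 1 + h n \<omega> - X \<omega>)" for n
    proof -
      have "L2_norm M X = L2_norm M (\<lambda>\<omega>. (1 + h n \<omega>) + (X \<omega> - (1 + h n \<omega>)))" by simp
      also have "\<dots> \<le> L2_norm M (\<lambda>\<omega>. 1 + h n \<omega>) + L2_norm M (\<lambda>\<omega>. X \<omega> - (1 + h n \<omega>))"
        by (intro L2_norm_triangle L2_diff XL gL h)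
      finally show ?thesis using h(3)[of n] L2_norm_minus_commute[of M X "\<lambda>\<omega>. 1 + h n \<omega>"] by linarith
    qed
    moreover have "(\<lambda>n. (d + \<epsilon> n) + L2_norm M (\<lambda>\<omega>. 1 + h n \<omega> - X \<omega>)) \<longlonglongrightarrow> (d + 0) + 0"
      by (intro tendsto_intros \<epsilon>0 Xlim)
    ultimately show ?thesis using LIMSEQ_le_const by fastforce
  qed
  \<comment> \<open>\<open>X\<close> is only a limit of the affine set; \<open>1 + h n + c g\<close>
    belongs to it and tends to \<open>X + c g\<close>.\<close>
  have X_ge: "d \<le> L2_norm M (\<lambda>\<omega>. X \<omega> + c * g \<omega>)" if g: "gain_from (\<lambda>\<omega>. 0) g" for g c
  proof -
    have "d \<le> L2_norm M (\<lambda>\<omega>. X \<omega> + c * g \<omega>) + L2_norm M (\<lambda>\<omega>. 1 + h n \<omega> - X \<omega>)" for n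
    proof -
      have "d \<le> L2_norm M (\<lambda>\<omega>. 1 + (h n \<omega> + c * g \<omega>))" by (intro d_le gain_from_add gain_from_cmult h g)
      also have "\<dots> = L2_norm M (\<lambda>\<omega>. (X \<omega> + c * g \<omega>) + (1 + h n \<omega> - X \<omega>))" by (simp add: algebra_simps)
      also have "\<dots> \<le> L2_norm M (\<lambda>\<omega>. X \<omega> + c * g \<omega>) + L2_norm M (\<lambda>\<omega>. 1 + h n \<omega> - X \<omega>)"
        by (intro L2_norm_triangle L2_diff L2_add L2_cmult gain_from_L2[OF g] XL gL h)
      finally show ?thesis .
    qed
    moreover have "(\<lambda>n. L2_norm M (\<lambda>\<omega>. X \<omega> + c * g \<omega>) + L2_norm M (\<lambda>\<omega>. 1 + h n \<omega> - X \<omega>)) \<longlonglongrightarrow>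
        L2_norm M (\<lambda>\<omega>. X \<omega> + c * g \<omega>) + 0"
      by (intro tendsto_intros Xlim)
    ultimately show ?thesis using LIMSEQ_le_const by fastforce
  qed
  have orth: "(\<integral>\<omega>. X \<omega> * g \<omega> \<partial>M) = 0" if g: "gain_from (\<lambda>\<omega>. 0) g" for g
  proof -
    define b q where "b = (\<integral>\<omega>. X \<omega> * g \<omega> \<partial>M)" and "q = (\<integral>\<omega>. (g \<omega>)\<^sup>2 \<partial>M)"
    note gL2 = gain_from_L2[OF g]
    have q: "0 \<le> q" by (simp add: q_def)
    \<comment> \<open>Close to the minimiser \<open>- b / q\<close> of \<open>2 c b + c^2 q\<close>.
      Adding 1 to \<open>q\<close> avoids a zero denominator and still makes the value negative
      unless \<open>b = 0\<close>.\<close>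
    define c where "c = - b / (q + 1)"
    have "(L2_norm M X)\<^sup>2 \<le> (L2_norm M (\<lambda>\<omega>. X \<omega> + c * g \<omega>))\<^sup>2"
      using order_trans[OF X_le X_ge[OF g]] by (intro power_mono L2_norm_nonneg)
    also have "(L2_norm M (\<lambda>\<omega>. X \<omega> + c * g \<omega>))\<^sup>2 = (\<integral>\<omega>. (X \<omega>)\<^sup>2 + 2 * c * (X \<omega> * g \<omega>) + c\<^sup>2 * (g \<omega>)\<^sup>2 \<partial>M)"
      by (simp add: L2_norm_square power2_sum power_mult_distrib algebra_simps)
    also have "\<dots> = (L2_norm M X)\<^sup>2 + 2 * c * b + c\<^sup>2 * q"
      using L2_integrable_square[OF XL] L2_integrable_square[OF gL2] L2_integrable_mult[OF XL gL2]
      by (simp add: L2_norm_square b_def q_def)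
    finally have "0 \<le> 2 * c * b + c\<^sup>2 * q" by simp
    also have "2 * c * b + c\<^sup>2 * q = - (b\<^sup>2 * (q + 2)) / (q + 1)\<^sup>2"
    proof -
      have "c * (q + 1) = - b" using q by (simp add: c_def)
      then have "(2 * c * b + c\<^sup>2 * q) * (q + 1)\<^sup>2 = - (b\<^sup>2 * (q + 2))"
        by (simp add: power2_eq_square) algebra
      moreover have "(q + 1)\<^sup>2 \<noteq> 0" using q by simp
      ultimately show ?thesis by (rule nonzero_eq_divide_eq[THEN iffD2, rotated])
    qed
    finally have "b\<^sup>2 * (q + 2) / (q + 1)\<^sup>2 \<le> 0" by simp
    moreover have "0 < (q + 1)\<^sup>2" "0 < q + 2" using q by simp_all
    ultimately have "b\<^sup>2 \<le> 0" by (simp add: divide_le_0_iff mult_le_0_iff)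
    then have "b = 0" by simp
    then show ?thesis by (simp add: b_def)
  qed
  have pos: "0 < (\<integral>\<omega>. (X \<omega>)\<^sup>2 \<partial>M)"
  proof (rule ccontr)
    assume "\<not> 0 < (\<integral>\<omega>. (X \<omega>)\<^sup>2 \<partial>M)"
    then have "(L2_norm M X)\<^sup>2 \<le> 0" unfolding L2_norm_square by simp
    then have "L2_norm M X = 0" by simp
    then have "AE \<omega> in M. X \<omega> = 0" using L2_norm_eq_0_iff[OF XL] by simp
    \<comment> \<open>If \<open>X\<close> vanished, the gains \<open>- h n\<close> would tend to
      1.\<close>
    have eq: "L2_norm M (\<lambda>\<omega>. - 1 * h n \<omega> - 1) = L2_norm M (\<lambda>\<omega>. 1 + h n \<omega> - X \<omega>)" for n
      unfolding L2_norm_def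
    proof (rule arg_cong[where f=sqrt], rule integral_cong_AE)
      show "AE \<omega> in M. (- 1 * h n \<omega> - 1)\<^sup>2 = (1 + h n \<omega> - X \<omega>)\<^sup>2"
        using \<open>AE \<omega> in M. X \<omega> = 0\<close> by eventually_elim (simp add: power2_eq_square algebra_simps)
    qed (use gain_from_L2[OF h(1)[of n]] XL in measurable)
    have "L2_tendsto M (\<lambda>n \<omega>. - 1 * h n \<omega>) (\<lambda>\<omega>. 1)"
      using Xlim unfolding eq[symmetric]
      by (intro L2_tendsto_I L2_cmult gain_from_L2[OF h(1)] L2_const)
    moreover have "gain_from (\<lambda>\<omega>. 0) (\<lambda>\<omega>. - 1 * h n \<omega>)" for n by (rule gain_from_cmult[OF h(1)])
    ultimately have unit_approximable unfolding unit_approximable_def by (intro exI conjI allI)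
    with assms show False by blast
  qed
  \<comment> \<open>Stopping times are non-negative, so what starts at \<rho> also counts as
    starting at 0.\<close>
  have "gain_from (\<lambda>\<omega>. 0) g" if "gain_from \<rho> g" for \<rho> g
  proof -
    have "gain_from (\<lambda>\<omega>. 0) (elementary_gain x)" if "elementary_from \<rho> x" for x
      using that STD(2) by (intro elementary_gain_from) (auto simp: elementary_from_def)
    from gain_from_cases[OF that this] show ?thesis by auto
  qed
  then have "orthogonal_density X" using orth XL by (auto simp: orthogonal_density_def)
  then show thesis using X0 pos h(1) X by (rule that)
qed

text \<open>All approximating wealths start from 1 and \<open>Z\<close> annihilates their gains. For
  \<open>Z = X\<close> this gives \<open>E X = E X^2\<close>; for a martingale density it gives
  \<open>E[Z X] = 1\<close>.\<close>

lemma minimal_element_expectation: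
  assumes X: "orthogonal_density X" and h: "\<And>n. gain_from (\<lambda>\<omega>. 0) (h n)"
    and lim: "L2_tendsto M (\<lambda>n \<omega>. 1 + h n \<omega>) X" and Z: "orthogonal_density Z"
  shows "(\<integral>\<omega>. Z \<omega> * X \<omega> \<partial>M) = (\<integral>\<omega>. Z \<omega> \<partial>M)"
proof -
  have ZL: "Z \<in> L2 M" using Z by (simp add: orthogonal_density_def)
  have "(\<integral>\<omega>. Z \<omega> * (1 + h n \<omega>) \<partial>M) = (\<integral>\<omega>. Z \<omega> \<partial>M)" for n
  proof -
    have "(\<integral>\<omega>. Z \<omega> * (1 + h n \<omega>) \<partial>M) = (\<integral>\<omega>. Z \<omega> \<partial>M) + (\<integral>\<omega>. Z \<omega> * h n \<omega> \<partial>M)"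
      unfolding distrib_left mult_1_right
      by (intro Bochner_Integration.integral_add L2_integrable L2_integrable_mult ZL gain_from_L2[OF h])
    then show ?thesis using Z h[of n] by (auto simp: orthogonal_density_def)
  qed
  then have "(\<lambda>n. \<integral>\<omega>. Z \<omega> \<partial>M) \<longlonglongrightarrow> (\<integral>\<omega>. Z \<omega> * X \<omega> \<partial>M)"
    using L2_tendsto_inner[OF lim ZL] by simp
  then show ?thesis by (simp add: LIMSEQ_const_iff)
qed

text \<open>A competitor satisfies \<open>1 = E[Z' X]\<close>, so by Cauchy-Schwarz its norm is at
  least the reciprocal of the norm of \<open>X\<close>, and \<open>Z\<close> has exactly this
  norm.\<close>

lemma minimal_element_variance_optimal:
  assumes X: "orthogonal_density X" "0 < (\<integral>\<omega>. (X \<omega>)\<^sup>2 \<partial>M)" and h: "\<And>n. gain_from (\<lambda>\<omega>. 0) (h n)"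
    and lim: "L2_tendsto M (\<lambda>n \<omega>. 1 + h n \<omega>) X"
  defines "Z \<equiv> \<lambda>\<omega>. X \<omega> / (\<integral>\<omega>. (X \<omega>)\<^sup>2 \<partial>M)"
  shows "variance_optimal_lmm M F T S (\<lambda>A. set_lebesgue_integral M A Z) Z"
proof -
  let ?q = "\<integral>\<omega>. (X \<omega>)\<^sup>2 \<partial>M"
  have XL: "X \<in> L2 M" using X by (simp add: orthogonal_density_def)
  have Xq: "(\<integral>\<omega>. X \<omega> \<partial>M) = ?q"
    using minimal_element_expectation[OF X(1) h lim X(1)] by (simp add: power2_eq_square)
  have ZL: "Z \<in> L2 M" using L2_cmult[OF XL, of "1 / ?q"] by (simp add: Z_def)
  have Z: "orthogonal_density Z"
    using X(1) ZL by (auto simp: orthogonal_density_def Z_def)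
  have Z1: "(\<integral>\<omega>. Z \<omega> \<partial>M) = 1" using X(2) Xq by (simp add: Z_def)
  have nZ: "L2_norm M Z = 1 / L2_norm M X"
  proof -
    have "L2_norm M Z = L2_norm M X / (L2_norm M X)\<^sup>2"
      using L2_norm_cmult[of M "1 / ?q" X] X(2) by (simp add: Z_def L2_norm_square)
    then show ?thesis by (simp add: power2_eq_square)
  qed
  have "L2_norm M Z \<le> L2_norm M Z'" if Z': "signed_lmm M F T S Q' Z'" for Q' Z'
  proof -
    note Z' = signed_lmmD[OF Z']
    have Z'L: "Z' \<in> L2 M" using Z'(1) by (simp add: orthogonal_density_def)
    have "1 = (\<integral>\<omega>. Z' \<omega> * X \<omega> \<partial>M)" using minimal_element_expectation[OF X(1) h lim Z'(1)] Z'(2) by simp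
    also have "\<dots> \<le> L2_norm M Z' * L2_norm M X" using L2_Cauchy_Schwarz[OF Z'L XL] by linarith
    finally have "1 \<le> L2_norm M Z' * L2_norm M X" .
    moreover have "0 < L2_norm M X" using X(2) by (simp add: L2_norm_def)
    ultimately show ?thesis unfolding nZ by (simp add: divide_le_eq)
  qed
  then have "(L2_norm M Z)\<^sup>2 - 1 \<le> (L2_norm M Z')\<^sup>2 - 1" if "signed_lmm M F T S Q' Z'" for Q' Z'
    using that by (simp add: power_mono L2_norm_nonneg)
  moreover have "(\<integral>\<omega>. (Z' \<omega> - (\<integral>\<omega>. Z' \<omega> \<partial>M))\<^sup>2 \<partial>M) = (L2_norm M Z')\<^sup>2 - 1"
    if "signed_lmm M F T S Q' Z'" for Q' Z'
    using signed_lmmD[OF that] by (intro variance_of_density) (auto simp: orthogonal_density_def)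
  moreover note variance_of_density[OF ZL Z1]
  ultimately show ?thesis
    unfolding variance_optimal_lmm_def using signed_lmmI[OF Z Z1] by simp
qed

end

section \<open>Positivity of the minimal element\<close>

context continuous_market
begin

text \<open>Shaped for use by both the law of one price and the absence of arbitrage: where
  \<open>\<sigma> k < T\<close> the gain \<open>g k\<close> drives unit capital to 0, and these
  events approximate the zero set \<open>A\<close>.\<close>

lemma zero_set_sequence:
  assumes X: "orthogonal_density X" and h: "\<And>n. gain_from (\<lambda>\<omega>. 0) (h n)"
    and lim: "L2_tendsto M (\<lambda>n \<omega>. 1 + h n \<omega>) X"
  defines "A \<equiv> {\<omega>\<in>space M. X \<omega> = 0}"
  shows "\<exists>\<sigma> g. (\<forall>k. \<sigma> k \<in> ST \<and> gain_from (\<sigma> k) (g k)) \<and>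
    (\<lambda>k. L2_norm M (\<lambda>\<omega>. indicator {\<omega>\<in>space M. \<sigma> k \<omega> < T} \<omega> * (1 + g k \<omega>))) \<longlonglongrightarrow> 0 \<and>
    (\<lambda>k. prob ({\<omega>\<in>space M. \<sigma> k \<omega> < T} - A)) \<longlonglongrightarrow> 0 \<and>
    (\<lambda>k. prob (A - {\<omega>\<in>space M. \<sigma> k \<omega> < T})) \<longlonglongrightarrow> 0"
proof -
  have XL: "X \<in> L2 M" using X by (simp add: orthogonal_density_def)
  have [measurable]: "X \<in> borel_measurable M" by (rule L2_measurable[OF XL])
  have A[measurable]: "A \<in> sets M" unfolding A_def by measurable
  \<comment> \<open>Two scales with \<open>l = \<eta>^2\<close>: where the modulus of
    \<open>X\<close> is at least \<eta>, that of \<open>X / l\<close> is at least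
    \<open>1 / \<eta>\<close>, which tends to infinity.\<close>
  define \<eta> l :: "nat \<Rightarrow> real" where "\<eta> k = (1 / 2) ^ Suc k" and "l k = (\<eta> k)\<^sup>2" for k
  have \<eta>: "0 < \<eta> k" "\<eta> k < 1" "\<eta> (Suc k) \<le> \<eta> k" for k
  proof -
    show "0 < \<eta> k" by (simp add: \<eta>_def)
    show "\<eta> k < 1" unfolding \<eta>_def by (intro power_Suc_less_one) auto
    show "\<eta> (Suc k) \<le> \<eta> k" by (simp add: \<eta>_def)
  qed
  have l: "0 < l k" "l k < 1" for k using \<eta>[of k] by (simp_all add: l_def power_less_one_iff)
  have \<eta>_lim: "\<eta> \<longlonglongrightarrow> 0"
    unfolding \<eta>_def by (intro LIMSEQ_Suc LIMSEQ_power_zero) simp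
  have l_lim: "l \<longlonglongrightarrow> 0" using tendsto_power[OF \<eta>_lim, of 2] by (simp add: l_def[abs_def])
  \<comment> \<open>The cube leaves room for dividing by \<open>l k\<close>: the rescaled error is
    still \<open>(l k)^2\<close>.\<close>
  have "\<exists>n. L2_norm M (\<lambda>\<omega>. 1 + h n \<omega> - X \<omega>) < (l k) ^ 3" for k
  proof -
    have "(\<lambda>n. L2_norm M (\<lambda>\<omega>. 1 + h n \<omega> - X \<omega>)) \<longlonglongrightarrow> 0" using lim by (simp add: L2_tendsto_def)
    then have "\<forall>\<^sub>F n in sequentially. L2_norm M (\<lambda>\<omega>. 1 + h n \<omega> - X \<omega>) < (l k) ^ 3"
      by (rule order_tendstoD(2)) (use l in simp)
    then show ?thesis by (auto simp: eventually_sequentially)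
  qed
  then obtain n where n: "\<And>k. L2_norm M (\<lambda>\<omega>. 1 + h (n k) \<omega> - X \<omega>) < (l k) ^ 3" by metis
  have "\<exists>V. gain_process V \<and> (\<forall>\<omega>\<in>space M. V T \<omega> = h (n k) \<omega>)" for k
    using gain_from_process[OF h[of "n k"]] by metis
  then obtain V where V: "\<And>k. gain_process (V k)" "\<And>k. \<forall>\<omega>\<in>space M. V k T \<omega> = h (n k) \<omega>" by metis
  define W where "W = (\<lambda>k t \<omega>. 1 + V k t \<omega>)"
  have cont: "continuous_on {0..T} (\<lambda>t. W k t \<omega>)" "W k 0 \<omega> = 1" if "\<omega> \<in> space M" for k \<omega>
    using V(1)[of k] that by (auto simp: W_def gain_process_def intro!: continuous_intros)
  define \<sigma> where "\<sigma> k = hitting_time (W k) (l k)" for k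
  have \<sigma>: "\<sigma> k \<in> ST" for k
    unfolding \<sigma>_def using V(1)[of k] cont(1)
    by (intro ST_hitting_time) (auto simp: W_def gain_process_def intro!: borel_measurable_add)
  note [measurable] = STD(4)[OF \<sigma>]
  define A' where "A' k = {\<omega>\<in>space M. \<sigma> k \<omega> < T}" for k
  have A'[measurable]: "A' k \<in> sets M" for k unfolding A'_def by measurable
  have A'_pre: "A' k \<in> sets (pre_sigma (\<sigma> k))" for k
    unfolding A'_def by (rule pre_sigma_less[OF \<sigma> ST_horizon])
  have W_hit: "W k (\<sigma> k \<omega>) \<omega> = l k" if "\<omega> \<in> A' k" for k \<omega>
  proof -
    have \<omega>: "\<omega> \<in> space M" "\<sigma> k \<omega> < T" using that by (auto simp: A'_def)
    then show ?thesis
      using hitting_time_properties(4,5)[of "W k" \<omega> "l k", OF cont(1)[OF \<omega>(1)], folded \<sigma>_def]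
        cont(2)[OF \<omega>(1)] l[of k] by force
  qed
  have W_T: "l k \<le> W k T \<omega>" if "\<omega> \<in> space M" "\<omega> \<notin> A' k" for k \<omega>
    using hitting_time_properties(6)[of "W k" \<omega> "l k", OF cont(1)[OF that(1)], folded \<sigma>_def]
      cont(2)[OF that(1)] l[of k] that by (force simp: A'_def)
  define g where "g k \<omega> = (1 / l k) * (V k T \<omega> - V k (\<sigma> k \<omega>) \<omega>)" for k \<omega>
  have g: "gain_from (\<sigma> k) (g k)" for k
    unfolding g_def using V(1)[of k] \<sigma> by (intro gain_from_cmult) (auto simp: gain_process_def)
  have gA: "gain_from (\<sigma> k) (\<lambda>\<omega>. indicator (A' k) \<omega> * g k \<omega>)" for k
    by (rule gain_from_restrict[OF \<sigma> g A'_pre]) simp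
  have WT_L2: "W k T \<in> L2 M" for k
  proof -
    have "(\<lambda>\<omega>. 1 + h (n k) \<omega>) \<in> L2 M" by (intro L2_add L2_const gain_from_L2[OF h])
    then show ?thesis using V(2)[of k] by (subst L2_cong[where g="\<lambda>\<omega>. 1 + h (n k) \<omega>"]) (auto simp: W_def)
  qed
  have WX: "L2_norm M (\<lambda>\<omega>. W k T \<omega> - X \<omega>) \<le> (l k) ^ 3" for k
  proof -
    have "L2_norm M (\<lambda>\<omega>. W k T \<omega> - X \<omega>) = L2_norm M (\<lambda>\<omega>. 1 + h (n k) \<omega> - X \<omega>)"
      using V(2)[of k] by (intro L2_norm_cong) (simp add: W_def)
    then show ?thesis using n[of k] by simp
  qed
  have WX_L2: "(\<lambda>\<omega>. W k T \<omega> - X \<omega>) \<in> L2 M" for k by (intro L2_diff WT_L2 XL)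
  \<comment> \<open>Terminal value of unit capital invested at \<open>\<sigma> k\<close>. The wealth
    \<open>W k\<close> equals \<open>l k\<close> at that time, so this is its terminal value divided
    by \<open>l k\<close>.\<close>
  define Y where "Y = (\<lambda>k \<omega>. indicator (A' k) \<omega> * (1 + g k \<omega>))"
  have Y_eq: "Y k \<omega> = indicator (A' k) \<omega> * ((1 / l k) * W k T \<omega>)" for k \<omega>
  proof (cases "\<omega> \<in> A' k")
    case True
    have "V k T \<omega> - V k (\<sigma> k \<omega>) \<omega> = W k T \<omega> - l k" using W_hit[OF True] by (simp add: W_def)
    then show ?thesis using True l[of k] by (simp add: Y_def g_def field_simps)
  qed (simp add: Y_def)
  have YL: "Y k \<in> L2 M" for k unfolding Y_eq[abs_def] by (intro L2_indicator_mult L2_cmult WT_L2 A')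
  \<comment> \<open>\<open>Y\<close> with the limit \<open>X\<close> in place of the approximating
    terminal wealth.\<close>
  define y where "y k \<omega> = indicator (A' k) \<omega> * ((1 / l k) * X \<omega>)" for k \<omega>
  have yL: "y k \<in> L2 M" for k unfolding y_def[abs_def] by (intro L2_indicator_mult L2_cmult XL A')
  have yY: "L2_norm M (\<lambda>\<omega>. Y k \<omega> - y k \<omega>) \<le> (l k)\<^sup>2" for k
  proof -
    have "L2_norm M (\<lambda>\<omega>. Y k \<omega> - y k \<omega>) \<le> L2_norm M (\<lambda>\<omega>. (1 / l k) * (W k T \<omega> - X \<omega>))"
    proof (rule L2_norm_mono[OF L2_cmult[OF WX_L2]])
      show "(\<lambda>\<omega>. Y k \<omega> - y k \<omega>) \<in> borel_measurable M" by (rule L2_measurable[OF L2_diff[OF YL yL]])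
      show "AE \<omega> in M. \<bar>Y k \<omega> - y k \<omega>\<bar> \<le> \<bar>(1 / l k) * (W k T \<omega> - X \<omega>)\<bar>"
        by (rule AE_I2) (simp add: Y_eq y_def indicator_def right_diff_distrib)
    qed
    also have "\<dots> = (1 / l k) * L2_norm M (\<lambda>\<omega>. W k T \<omega> - X \<omega>)"
      using l[of k] by (simp only: L2_norm_cmult) simp
    also have "\<dots> \<le> (1 / l k) * (l k) ^ 3" using l[of k] by (intro mult_left_mono WX) simp
    also have "\<dots> = (l k)\<^sup>2" using l[of k] by (simp add: power3_eq_cube power2_eq_square)
    finally show ?thesis .
  qed
  define p where "p k = prob (A' k - A)" for k
  have y_le: "L2_norm M (y k) \<le> sqrt (p k) + (l k)\<^sup>2" for k
  proof -
    \<comment> \<open>\<open>X\<close> annihilates the restricted gain, so in \<open>E[y Y]\<close>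
      the factor \<open>1 + g\<close> acts like 1.\<close>
    have Y1: "(\<integral>\<omega>. y k \<omega> * Y k \<omega> \<partial>M) = (\<integral>\<omega>. y k \<omega> \<partial>M)"
    proof -
      have "(\<integral>\<omega>. y k \<omega> * Y k \<omega> \<partial>M) = (\<integral>\<omega>. y k \<omega> + (1 / l k) * (X \<omega> * (indicator (A' k) \<omega> * g k \<omega>)) \<partial>M)"
        by (intro Bochner_Integration.integral_cong refl) (simp add: y_def Y_def indicator_def algebra_simps)
      also have "\<dots> = (\<integral>\<omega>. y k \<omega> \<partial>M) + (1 / l k) * (\<integral>\<omega>. X \<omega> * (indicator (A' k) \<omega> * g k \<omega>) \<partial>M)"
        using L2_integrable[OF yL] L2_integrable_mult[OF XL gain_from_L2[OF gA]] by simp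
      also have "(\<integral>\<omega>. X \<omega> * (indicator (A' k) \<omega> * g k \<omega>) \<partial>M) = 0"
        using X gA by (auto simp: orthogonal_density_def)
      finally show ?thesis by simp
    qed
    have "(L2_norm M (y k))\<^sup>2 = (\<integral>\<omega>. y k \<omega> * Y k \<omega> - y k \<omega> * (Y k \<omega> - y k \<omega>) \<partial>M)"
      unfolding L2_norm_square
      by (intro Bochner_Integration.integral_cong) (simp_all add: power2_eq_square right_diff_distrib)
    also have "\<dots> = (\<integral>\<omega>. y k \<omega> * Y k \<omega> \<partial>M) - (\<integral>\<omega>. y k \<omega> * (Y k \<omega> - y k \<omega>) \<partial>M)"
      by (intro Bochner_Integration.integral_diff L2_integrable_mult L2_diff yL YL)
    \<comment> \<open>\<open>X\<close> vanishes on \<open>A\<close>, so only \<open>A' k - A\<close>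
      contributes; Cauchy-Schwarz then leaves a factor \<open>L2_norm M (y k)\<close> on both sides
      to be cancelled.\<close>
    also have "(\<integral>\<omega>. y k \<omega> * Y k \<omega> \<partial>M) = (\<integral>\<omega>. y k \<omega> * indicator (A' k - A) \<omega> \<partial>M)"
      unfolding Y1 by (intro Bochner_Integration.integral_cong refl) (auto simp: y_def A_def indicator_def)
    also have "(\<integral>\<omega>. y k \<omega> * indicator (A' k - A) \<omega> \<partial>M) - (\<integral>\<omega>. y k \<omega> * (Y k \<omega> - y k \<omega>) \<partial>M)
        \<le> L2_norm M (y k) * sqrt (p k) + L2_norm M (y k) * (l k)\<^sup>2"
      using L2_Cauchy_Schwarz[OF yL[of k] L2_indicator[of "A' k - A"]]
        L2_Cauchy_Schwarz[OF yL[of k] L2_diff[OF YL[of k] yL[of k]]]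
        mult_left_mono[OF yY[of k] L2_norm_nonneg[of M "y k"]] L2_norm_indicator[of "A' k - A"]
      by (simp add: p_def)
    finally have "L2_norm M (y k) * L2_norm M (y k) \<le> L2_norm M (y k) * (sqrt (p k) + (l k)\<^sup>2)"
      by (simp add: power2_eq_square distrib_left)
    then show ?thesis
      using L2_norm_nonneg[of M "y k"] l[of k]
      by (cases "L2_norm M (y k) = 0") (auto simp: p_def mult_le_cancel_left)
  qed
  \<comment> \<open>The bound for \<open>y k\<close> contains \<open>p k\<close>, but
    \<open>p k \<le> 1\<close> already bounds the norm by 2. On the part of \<open>A' k\<close>
    where the modulus of \<open>X\<close> is at least \<open>\<eta> k\<close>, that of
    \<open>y k\<close> is at least \<open>1 / \<eta> k\<close>, so Chebyshev gives
    \<open>(2 \<eta> k)^2 = 4 l k\<close>.\<close>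
  have p_le: "p k \<le> prob {\<omega>\<in>space M. 0 < \<bar>X \<omega>\<bar> \<and> \<bar>X \<omega>\<bar> < \<eta> k} + 4 * l k" for k
  proof -
    let ?S = "{\<omega>\<in>space M. 0 < \<bar>X \<omega>\<bar> \<and> \<bar>X \<omega>\<bar> < \<eta> k}" and ?B = "{\<omega>\<in>A' k. \<eta> k \<le> \<bar>X \<omega>\<bar>}"
    have B: "?B \<in> sets M"
    proof -
      have "?B = A' k \<inter> {\<omega>\<in>space M. \<eta> k \<le> \<bar>X \<omega>\<bar>}" by (auto simp: A'_def)
      then show ?thesis by simp
    qed
    have "p k \<le> 1" by (simp add: p_def)
    then have "sqrt (p k) \<le> 1" by simp
    moreover have "(l k)\<^sup>2 \<le> 1" using l[of k] by (simp add: power_le_one)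
    ultimately have y2: "L2_norm M (y k) \<le> 2" using y_le[of k] by linarith
    have "prob ?B \<le> (L2_norm M (y k) / (\<eta> k / l k))\<^sup>2"
    proof (rule L2_prob_le[OF yL _ B])
      show "0 < \<eta> k / l k" using l \<eta> by simp
      show "\<eta> k / l k \<le> \<bar>y k \<omega>\<bar>" if "\<omega> \<in> ?B" for \<omega>
        using that l[of k] by (auto simp: y_def abs_mult intro!: divide_right_mono)
    qed
    also have "\<dots> = (\<eta> k * L2_norm M (y k))\<^sup>2" using \<eta>(1)[of k] by (simp add: l_def power2_eq_square)
    also have "\<dots> \<le> (\<eta> k * 2)\<^sup>2"
      using y2 \<eta>(1)[of k] L2_norm_nonneg[of M "y k"] by (intro power_mono mult_left_mono) auto
    also have "\<dots> = 4 * l k" by (simp add: l_def power_mult_distrib)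
    finally have "prob ?B \<le> 4 * l k" .
    moreover have "p k \<le> prob (?S \<union> ?B)"
      unfolding p_def using B by (intro finite_measure_mono) (auto simp: A_def A'_def)
    moreover have "prob (?S \<union> ?B) \<le> prob ?S + prob ?B" using B by (intro measure_Un_le) auto
    ultimately show ?thesis by linarith
  qed
  have small: "(\<lambda>k. prob {\<omega>\<in>space M. 0 < \<bar>X \<omega>\<bar> \<and> \<bar>X \<omega>\<bar> < \<eta> k}) \<longlonglongrightarrow> 0"
  proof -
    have "(\<lambda>k. prob {\<omega>\<in>space M. 0 < \<bar>X \<omega>\<bar> \<and> \<bar>X \<omega>\<bar> < \<eta> k}) \<longlonglongrightarrow>
        prob (\<Inter>k. {\<omega>\<in>space M. 0 < \<bar>X \<omega>\<bar> \<and> \<bar>X \<omega>\<bar> < \<eta> k})"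
    proof (rule finite_Lim_measure_decseq)
      show "range (\<lambda>k. {\<omega>\<in>space M. 0 < \<bar>X \<omega>\<bar> \<and> \<bar>X \<omega>\<bar> < \<eta> k}) \<subseteq> sets M" by auto
      show "decseq (\<lambda>k. {\<omega>\<in>space M. 0 < \<bar>X \<omega>\<bar> \<and> \<bar>X \<omega>\<bar> < \<eta> k})"
        by (rule decseq_SucI) (use \<eta>(3) in \<open>auto intro: less_le_trans\<close>)
    qed
    also have "(\<Inter>k. {\<omega>\<in>space M. 0 < \<bar>X \<omega>\<bar> \<and> \<bar>X \<omega>\<bar> < \<eta> k}) = {}"
    proof (rule ccontr)
      assume "(\<Inter>k. {\<omega>\<in>space M. 0 < \<bar>X \<omega>\<bar> \<and> \<bar>X \<omega>\<bar> < \<eta> k}) \<noteq> {}"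
      then obtain \<omega> where \<omega>: "0 < \<bar>X \<omega>\<bar>" "\<And>k. \<bar>X \<omega>\<bar> < \<eta> k" by auto
      have "\<bar>X \<omega>\<bar> \<le> 0" by (rule LIMSEQ_le_const[OF \<eta>_lim]) (use \<omega>(2) in \<open>auto intro: less_imp_le\<close>)
      with \<omega>(1) show False by simp
    qed
    finally show ?thesis by simp
  qed
  have p_lim: "p \<longlonglongrightarrow> 0"
  proof (rule tendsto_sandwich[OF _ always_eventually tendsto_const])
    show "(\<lambda>k. prob {\<omega>\<in>space M. 0 < \<bar>X \<omega>\<bar> \<and> \<bar>X \<omega>\<bar> < \<eta> k} + 4 * l k) \<longlonglongrightarrow> 0"
      using tendsto_add[OF small tendsto_mult_right_zero[OF l_lim, of 4]] by simp
  qed (use p_le in \<open>auto simp: p_def\<close>)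
  have Y_lim: "(\<lambda>k. L2_norm M (Y k)) \<longlonglongrightarrow> 0"
  proof (rule tendsto_sandwich[OF _ always_eventually tendsto_const])
    have "(\<lambda>k. sqrt (p k) + 2 * (l k)\<^sup>2) \<longlonglongrightarrow> sqrt 0 + 2 * 0\<^sup>2" by (intro tendsto_intros p_lim l_lim)
    then show "(\<lambda>k. sqrt (p k) + 2 * (l k)\<^sup>2) \<longlonglongrightarrow> 0" by simp
    show "\<forall>k. L2_norm M (Y k) \<le> sqrt (p k) + 2 * (l k)\<^sup>2"
    proof
      fix k
      have "L2_norm M (Y k) = L2_norm M (\<lambda>\<omega>. y k \<omega> + (Y k \<omega> - y k \<omega>))" by simp
      also have "\<dots> \<le> L2_norm M (y k) + L2_norm M (\<lambda>\<omega>. Y k \<omega> - y k \<omega>)"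
        by (intro L2_norm_triangle L2_diff yL YL)
      finally show "L2_norm M (Y k) \<le> sqrt (p k) + 2 * (l k)\<^sup>2" using y_le[of k] yY[of k] by linarith
    qed
  qed (simp add: L2_norm_nonneg)
  \<comment> \<open>On \<open>A - A' k\<close> the wealth ends at \<open>l k\<close> or more while
    \<open>X\<close> is 0, although the two are within \<open>(l k)^3\<close> in norm.\<close>
  have AA'_lim: "(\<lambda>k. prob (A - A' k)) \<longlonglongrightarrow> 0"
  proof (rule tendsto_sandwich[OF _ always_eventually tendsto_const])
    show "\<forall>k. prob (A - A' k) \<le> (l k)\<^sup>2"
    proof
      fix k
      have "prob (A - A' k) \<le> (L2_norm M (\<lambda>\<omega>. W k T \<omega> - X \<omega>) / l k)\<^sup>2"
      proof (rule L2_prob_le[OF WX_L2 l(1)])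
        show "l k \<le> \<bar>W k T \<omega> - X \<omega>\<bar>" if "\<omega> \<in> A - A' k" for \<omega>
          using W_T[of \<omega> k] that by (auto simp: A_def)
      qed simp
      also have "\<dots> \<le> ((l k) ^ 3 / l k)\<^sup>2"
        using WX[of k] l[of k] by (intro power_mono divide_right_mono) (auto simp: L2_norm_nonneg)
      also have "\<dots> \<le> (l k)\<^sup>2"
        using l[of k] by (intro power_mono) (auto simp: power3_eq_cube mult_left_le_one_le)
      finally show "prob (A - A' k) \<le> (l k)\<^sup>2" .
    qed
    show "(\<lambda>k. (l k)\<^sup>2) \<longlonglongrightarrow> 0" using tendsto_power[OF l_lim, of 2] by simp
  qed simp
  show ?thesis
    by (intro exI[of _ \<sigma>] exI[of _ g]) (use \<sigma> g Y_lim p_lim AA'_lim in \<open>simp_all add: Y_def p_def[abs_def] A'_def\<close>)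
qed

text \<open>The Borel-Cantelli estimate: geometric rates keep the union over all later indices
  small, which is what permits taking infima over later times.\<close>

lemma geometric_union_bound:
  assumes "\<And>k. E k \<in> sets M" "\<And>k. prob (E k) \<le> (1 / 2) ^ k"
  shows "prob (\<Union>j\<in>{k..}. E j) \<le> 2 * (1 / 2) ^ k"
proof -
  have sums: "(\<lambda>i. (1 / 2 :: real) ^ (i + k)) sums (2 * (1 / 2) ^ k)"
    using sums_mult2[OF geometric_sums[of "1 / 2 :: real"], of "(1 / 2) ^ k"] by (simp add: power_add)
  have summable: "summable (\<lambda>i. prob (E (i + k)))"
    using assms(2) by (intro summable_comparison_test'[OF sums_summable[OF sums], of 0]) auto
  have "prob (\<Union>j\<in>{k..}. E j) = prob (\<Union>i. E (i + k))"
  proof -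
    have "{k..} = range (\<lambda>i. i + k)"
    proof safe
      fix j assume "k \<le> j"
      then show "j \<in> range (\<lambda>i. i + k)" by (intro range_eqI[of _ _ "j - k"]) simp
    qed simp
    then show ?thesis by (simp add: image_image)
  qed
  also have "\<dots> \<le> (\<Sum>i. prob (E (i + k)))"
    using assms(1) summable by (intro finite_measure_subadditive_countably) auto
  also have "\<dots> \<le> (\<Sum>i. (1 / 2) ^ (i + k))"
    using assms(2) by (intro suminf_le summable sums_summable[OF sums]) auto
  finally show ?thesis using sums_unique[OF sums] by simp
qed

text \<open>Unit capital is held on \<open>C k\<close> and invested on \<open>B k\<close> only.
  Where it is invested it nearly vanishes; on \<open>C k - B k\<close> it stays 1, at the cost of
  the square root of a probability.\<close>

lemma L2_indicator_split:
  assumes g: "\<And>k. gain_from (\<sigma> k) (g k)" and A': "\<And>k. A' k \<in> sets M"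
    and B: "\<And>k. B k \<in> sets M" "\<And>k. B k \<subseteq> A' k" "\<And>k. B k \<subseteq> C k" and C: "\<And>k. C k \<in> sets M"
    and Y: "(\<lambda>k. L2_norm M (\<lambda>\<omega>. indicator (A' k) \<omega> * (1 + g k \<omega>))) \<longlonglongrightarrow> 0"
    and CB: "(\<lambda>k. prob (C k - B k)) \<longlonglongrightarrow> 0"
  shows "L2_tendsto M (\<lambda>k \<omega>. indicator (C k) \<omega> + indicator (B k) \<omega> * g k \<omega>) (\<lambda>\<omega>. 0)"
proof (rule L2_tendsto_I)
  have gL: "g k \<in> L2 M" for k by (rule gain_from_L2[OF g])
  have YL: "(\<lambda>\<omega>. indicator (A' k) \<omega> * (1 + g k \<omega>)) \<in> L2 M" for k
    by (intro L2_indicator_mult L2_add L2_const gL A')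
  have BL: "(\<lambda>\<omega>. indicator (B k) \<omega> * (indicator (A' k) \<omega> * (1 + g k \<omega>))) \<in> L2 M" for k
    by (intro L2_indicator_mult YL B)
  have CBL: "indicator (C k - B k) \<in> L2 M" for k by (intro L2_indicator sets.Diff B C)
  have eq: "indicator (C k) \<omega> + indicator (B k) \<omega> * g k \<omega> =
      indicator (B k) \<omega> * (indicator (A' k) \<omega> * (1 + g k \<omega>)) + indicator (C k - B k) \<omega>" for k \<omega>
    using B(2,3)[of k] by (auto simp: indicator_def)
  show "(\<lambda>\<omega>. indicator (C k) \<omega> + indicator (B k) \<omega> * g k \<omega>) \<in> L2 M" for k
    unfolding eq by (intro L2_add BL CBL)
  have bound: "L2_norm M (\<lambda>\<omega>. indicator (C k) \<omega> + indicator (B k) \<omega> * g k \<omega>) \<le>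
      L2_norm M (\<lambda>\<omega>. indicator (A' k) \<omega> * (1 + g k \<omega>)) + sqrt (prob (C k - B k))" for k
  proof -
    have "L2_norm M (\<lambda>\<omega>. indicator (B k) \<omega> * (indicator (A' k) \<omega> * (1 + g k \<omega>))) \<le>
        L2_norm M (\<lambda>\<omega>. indicator (A' k) \<omega> * (1 + g k \<omega>))"
      by (intro L2_norm_mono YL L2_measurable[OF BL] AE_I2) (simp add: indicator_def)
    moreover have "L2_norm M (indicator (C k - B k)) = sqrt (prob (C k - B k))"
      using B(1) C by (intro L2_norm_indicator) auto
    ultimately show ?thesis unfolding eq using L2_norm_triangle[OF BL CBL, of k k] by linarith
  qed
  have "(\<lambda>k. L2_norm M (\<lambda>\<omega>. indicator (A' k) \<omega> * (1 + g k \<omega>)) + sqrt (prob (C k - B k))) \<longlonglongrightarrow> 0 + sqrt 0"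
    by (intro tendsto_intros Y CB)
  then have lim: "(\<lambda>k. L2_norm M (\<lambda>\<omega>. indicator (A' k) \<omega> * (1 + g k \<omega>)) + sqrt (prob (C k - B k))) \<longlonglongrightarrow> 0"
    by simp
  have "(\<lambda>k. L2_norm M (\<lambda>\<omega>. indicator (C k) \<omega> + indicator (B k) \<omega> * g k \<omega>)) \<longlonglongrightarrow> 0"
    by (rule tendsto_sandwich[OF always_eventually always_eventually tendsto_const lim])
      (simp_all only: L2_norm_nonneg bound simp_thms)
  then show "(\<lambda>k. L2_norm M (\<lambda>\<omega>. indicator (C k) \<omega> + indicator (B k) \<omega> * g k \<omega> - 0)) \<longlonglongrightarrow> 0" by simp
qed (rule L2_zero_fun)

section \<open>The law of one price forces the zero set to be null\<close>

lemma law_of_one_priceD: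
  assumes "law_of_one_price M F T S" "\<tau> \<in> ST" "x \<in> borel_measurable (pre_sigma \<tau>)"
    and "\<And>n. \<theta> n \<in> simple_strategies M F T S"
    and "L2_tendsto M (\<lambda>n \<omega>. x \<omega> + gains (start_after \<tau> T (\<theta> n)) S T \<omega>) (\<lambda>\<omega>. 0)"
  shows "AE \<omega> in M. x \<omega> = 0"
  using assms(1)[unfolded law_of_one_price_def, THEN conjunct1, rule_format, OF assms(2,3), of \<theta>] assms(4,5)
  by blast

lemma law_of_one_price_predictableD:
  assumes "law_of_one_price M F T S" "\<sigma> \<in> ST" "announcing_sequence M F T \<sigma> \<sigma>s"
    and "\<And>n. x n \<in> borel_measurable (pre_sigma (\<sigma>s n))"
    and "\<And>n. \<theta> n \<in> simple_strategies M F T S"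
    and "L2_tendsto M (\<lambda>n \<omega>. x n \<omega> + gains (start_after (\<sigma>s n) T (\<theta> n)) S T \<omega>) (\<lambda>\<omega>. 0)"
    and "tendsto_in_probability M x y"
  shows "AE \<omega> in M. y \<omega> = 0"
proof -
  have "\<sigma> \<in> predictable_times M F T" using assms(2,3) by (auto simp: predictable_times_def)
  then show ?thesis
    using assms(1)[unfolded law_of_one_price_def, THEN conjunct2, rule_format, of \<sigma> \<sigma>s x \<theta> y] assms(3-7)
    by blast
qed

text \<open>
  The times \<open>\<sigma> k\<close> need not be monotone.  Let \<open>i k\<close> be the infimum of the \<open>\<sigma> j\<close> with \<open>j \<ge> k\<close>, and \<open>s\<close>
  the limit of the \<open>i k\<close>.  On the event \<open>R\<close> that \<open>i k = s < T\<close> for some \<open>k\<close>, waiting from \<open>s\<close> until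
  \<open>\<sigma> k\<close> contradicts the first part of the law of one price.  Off \<open>R\<close>, \<open>s\<close> is announced by \<open>i k\<close>
  (capped by deterministic times \<open>t k < T\<close>) and the second part applies.
\<close>

lemma law_of_one_price_null:
  assumes LOP: "law_of_one_price M F T S" and \<sigma>: "\<And>k. \<sigma> k \<in> ST"
    and g: "\<And>k. gain_from (\<sigma> k) (g k)" and A: "A \<in> sets M"
    and Y: "(\<lambda>k. L2_norm M (\<lambda>\<omega>. indicator {\<omega>\<in>space M. \<sigma> k \<omega> < T} \<omega> * (1 + g k \<omega>))) \<longlonglongrightarrow> 0"
    and A1: "\<And>k. prob ({\<omega>\<in>space M. \<sigma> k \<omega> < T} - A) \<le> (1 / 2) ^ k"
    and A2: "\<And>k. prob (A - {\<omega>\<in>space M. \<sigma> k \<omega> < T}) \<le> (1 / 2) ^ k"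
  shows "prob A = 0"
proof -
  define A' where "A' k = {\<omega>\<in>space M. \<sigma> k \<omega> < T}" for k
  note [measurable] = A STD(4)[OF \<sigma>]
  have A'[measurable]: "A' k \<in> sets M" for k unfolding A'_def by measurable
  have A'_pre: "A' k \<in> sets (pre_sigma (\<sigma> k))" for k
    unfolding A'_def by (rule pre_sigma_less[OF \<sigma> ST_horizon])
  have half: "(\<lambda>k. c * (1 / 2 :: real) ^ k) \<longlonglongrightarrow> 0" for c
    by (intro tendsto_mult_right_zero LIMSEQ_power_zero) simp
  define i where "i k \<omega> = (INF j\<in>{k..}. \<sigma> j \<omega>)" for k \<omega>
  define s where "s \<omega> = (SUP k. i k \<omega>)" for \<omega>
  have iST: "i k \<in> ST" for k unfolding i_def[abs_def] by (rule ST_INF[OF \<sigma>])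
  have sST: "s \<in> ST" unfolding s_def[abs_def] by (rule ST_SUP[OF iST])
  note [measurable] = STD(4)[OF iST] STD(4)[OF sST]
  have bdd: "bdd_below ((\<lambda>j. \<sigma> j \<omega>) ` {k..})" if "\<omega> \<in> space M" for k \<omega>
    using STD(2)[OF \<sigma> that] by (intro bdd_belowI[of _ 0]) auto
  have i_le: "i k \<omega> \<le> \<sigma> j \<omega>" if "\<omega> \<in> space M" "k \<le> j" for k j \<omega>
    unfolding i_def using that by (intro cINF_lower bdd) auto
  have i_mono: "i k \<omega> \<le> i k' \<omega>" if "\<omega> \<in> space M" "k \<le> k'" for k k' \<omega>
    unfolding i_def using that by (intro cINF_superset_mono bdd) auto
  have bdd': "bdd_above (range (\<lambda>k. i k \<omega>))" if "\<omega> \<in> space M" for \<omega>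
    using STD(3)[OF iST that] by (intro bdd_aboveI[of _ T]) auto
  have i_le_s: "i k \<omega> \<le> s \<omega>" if "\<omega> \<in> space M" for k \<omega>
    unfolding s_def by (intro cSUP_upper bdd' that) auto
  have i_lim: "(\<lambda>k. i k \<omega>) \<longlonglongrightarrow> s \<omega>" if "\<omega> \<in> space M" for \<omega>
    unfolding s_def using i_mono[OF that] by (intro LIMSEQ_incseq_SUP bdd' that) (auto simp: incseq_def)
  define U where "U k = {\<omega>\<in>space M. i k \<omega> < T}" for k
  have U[measurable]: "U k \<in> sets M" for k unfolding U_def by measurable
  have U_eq: "U k = (\<Union>j\<in>{k..}. A' j)" for k
    using bdd by (auto simp: U_def A'_def i_def cINF_less_iff)
  \<comment> \<open>Outside \<open>A\<close>, \<open>U k\<close> is the union of the events on which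
    some later time stops by mistake.\<close>
  have UA: "prob (U k - A) \<le> 2 * (1 / 2) ^ k" for k
  proof -
    have "U k - A = (\<Union>j\<in>{k..}. A' j - A)" by (auto simp: U_eq)
    then show ?thesis using A1 by (simp only:) (intro geometric_union_bound, auto simp: A'_def)
  qed
  have A'U: "A' k \<subseteq> U k" for k by (auto simp: U_eq)
  have A2': "prob (A - A' k) \<le> (1 / 2) ^ k" for k using A2[of k] by (simp add: A'_def)
  define R where "R = {\<omega>\<in>space M. (\<exists>k. i k \<omega> = s \<omega>) \<and> s \<omega> < T}"
  have R_pre: "R \<in> sets (pre_sigma s)"
  proof -
    \<comment> \<open>Whether \<open>i k\<close> is strictly below \<open>s\<close> is known at
      \<open>i k\<close>, hence at \<open>s\<close>.\<close>
    have "{\<omega>\<in>space M. i k \<omega> < s \<omega>} \<in> sets (pre_sigma s)" for k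
      by (rule pre_sigma_mono[OF iST sST pre_sigma_less[OF iST sST] i_le_s])
    moreover have "R = (\<Union>k. space M - {\<omega>\<in>space M. i k \<omega> < s \<omega>}) \<inter> {\<omega>\<in>space M. s \<omega> < T}"
    proof -
      have "i k \<omega> = s \<omega> \<longleftrightarrow> \<not> i k \<omega> < s \<omega>" if "\<omega> \<in> space M" for k \<omega>
        using i_le_s[OF that, of k] by auto
      then show ?thesis unfolding R_def by auto
    qed
    ultimately show ?thesis
      using pre_sigma_space[of s] pre_sigma_less[OF sST ST_horizon] by (auto intro!: sets.Int sets.countable_UN)
  qed
  have R[measurable]: "R \<in> sets M" by (rule sets_pre_sigma_subset[OF sST R_pre])
  have RU: "R \<subseteq> U k" for k
  proof
    fix \<omega> assume "\<omega> \<in> R"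
    then show "\<omega> \<in> U k" using i_le_s[of \<omega> k] by (auto simp: R_def U_def)
  qed
  have R0: "prob R = 0"
  proof -
    \<comment> \<open>The unit is invested where waiting from \<open>s\<close> leads to some
      \<open>\<sigma> k\<close> before \<open>T\<close>; on the rest of \<open>R\<close> it stays in
      cash.\<close>
    define B where "B k = {\<omega>\<in>R. s \<omega> \<le> \<sigma> k \<omega>} \<inter> A' k" for k
    have B_pre: "B k \<in> sets (pre_sigma (\<sigma> k))" for k
      unfolding B_def by (intro sets.Int pre_sigma_le_Int[OF sST \<sigma> R_pre] A'_pre)
    have B: "B k \<in> sets M" for k by (rule sets_pre_sigma_subset[OF \<sigma> B_pre])
    have gB: "gain_from s (\<lambda>\<omega>. indicator (B k) \<omega> * g k \<omega>)" for k
      by (rule gain_from_restrict[OF \<sigma> g B_pre]) (auto simp: B_def)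
    have "\<exists>\<theta>. \<theta> \<in> simple_strategies M F T S \<and>
        (\<forall>\<omega>\<in>space M. gains (start_after s T \<theta>) S T \<omega> = indicator (B k) \<omega> * g k \<omega>)" for k
      using gain_from_simple_strategy[OF gB[of k]] by metis
    then obtain \<theta> where \<theta>: "\<And>k. \<theta> k \<in> simple_strategies M F T S"
      "\<And>k \<omega>. \<omega> \<in> space M \<Longrightarrow> gains (start_after s T (\<theta> k)) S T \<omega> = indicator (B k) \<omega> * g k \<omega>" by metis
    \<comment> \<open>On \<open>R\<close> the sequence \<open>i k\<close> reaches its limit, so
      these events decrease to the empty set.\<close>
    have lim1: "(\<lambda>k. prob {\<omega>\<in>R. i k \<omega> < s \<omega>}) \<longlonglongrightarrow> 0"
    proof -
      have meas: "{\<omega>\<in>R. i k \<omega> < s \<omega>} \<in> sets M" for k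
      proof -
        have "{\<omega>\<in>R. i k \<omega> < s \<omega>} = R \<inter> {\<omega>\<in>space M. i k \<omega> < s \<omega>}" by (auto simp: R_def)
        then show ?thesis by simp
      qed
      have "(\<lambda>k. prob {\<omega>\<in>R. i k \<omega> < s \<omega>}) \<longlonglongrightarrow> prob (\<Inter>k. {\<omega>\<in>R. i k \<omega> < s \<omega>})"
      proof (rule finite_Lim_measure_decseq)
        show "decseq (\<lambda>k. {\<omega>\<in>R. i k \<omega> < s \<omega>})"
        proof (rule decseq_SucI, rule subsetI)
          fix k \<omega> assume "\<omega> \<in> {\<omega>\<in>R. i (Suc k) \<omega> < s \<omega>}"
          then show "\<omega> \<in> {\<omega>\<in>R. i k \<omega> < s \<omega>}"
            using i_mono[of \<omega> k "Suc k"] by (auto simp: R_def)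
        qed
      qed (use meas in auto)
      also have "(\<Inter>k. {\<omega>\<in>R. i k \<omega> < s \<omega>}) = {}" by (auto simp: R_def) (metis less_irrefl)
      finally show ?thesis by simp
    qed
    have lim2: "(\<lambda>k. prob (R - B k)) \<longlonglongrightarrow> 0"
    proof (rule tendsto_sandwich[OF _ always_eventually tendsto_const])
      show "(\<lambda>k. 2 * (1 / 2) ^ k + 1 * (1 / 2) ^ k + prob {\<omega>\<in>R. i k \<omega> < s \<omega>}) \<longlonglongrightarrow> 0"
        using tendsto_add[OF tendsto_add[OF half[of 2] half[of 1]] lim1] by simp
      show "\<forall>k. prob (R - B k) \<le> 2 * (1 / 2) ^ k + 1 * (1 / 2) ^ k + prob {\<omega>\<in>R. i k \<omega> < s \<omega>}"
      proof
        fix k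
        let ?C = "{\<omega>\<in>R. i k \<omega> < s \<omega>}"
        have "?C = R \<inter> {\<omega>\<in>space M. i k \<omega> < s \<omega>}" by (auto simp: R_def)
        then have C: "?C \<in> sets M" by simp
        \<comment> \<open>Two ways to fail: \<open>\<sigma> k = T\<close>, which on
          \<open>U k\<close> is a discrepancy with \<open>A\<close>, or
          \<open>\<sigma> k < s\<close>, which entails \<open>i k < s\<close>.\<close>
        have "R - B k \<subseteq> (U k - A) \<union> (A - A' k) \<union> ?C"
        proof
          fix \<omega> assume \<omega>: "\<omega> \<in> R - B k"
          then have "\<omega> \<in> space M" "\<omega> \<in> U k" using RU[of k] by (auto simp: R_def)
          then show "\<omega> \<in> (U k - A) \<union> (A - A' k) \<union> ?C"
            using \<omega> i_le[of \<omega> k k] by (auto simp: B_def)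
        qed
        then have "prob (R - B k) \<le> prob ((U k - A) \<union> (A - A' k) \<union> ?C)"
          using C by (intro finite_measure_mono) auto
        also have "\<dots> \<le> prob (U k - A) + prob (A - A' k) + prob ?C"
          using C by (intro order_trans[OF measure_Un_le] add_mono measure_Un_le) auto
        finally show "prob (R - B k) \<le> 2 * (1 / 2) ^ k + 1 * (1 / 2) ^ k + prob ?C"
          using UA[of k] A2'[of k] by simp
      qed
    qed auto
    have "L2_tendsto M (\<lambda>k \<omega>. indicator R \<omega> + indicator (B k) \<omega> * g k \<omega>) (\<lambda>\<omega>. 0)"
      by (rule L2_indicator_split[where A'=A' and C="\<lambda>k. R", OF g A' B])
        (use Y lim2 in \<open>auto simp: B_def A'_def\<close>)
    then have "L2_tendsto M (\<lambda>k \<omega>. indicator R \<omega> + gains (start_after s T (\<theta> k)) S T \<omega>) (\<lambda>\<omega>. 0)"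
      by (rule L2_tendsto_cong) (simp add: \<theta>(2))
    moreover have "indicator R \<in> borel_measurable (pre_sigma s)" by (intro borel_measurable_indicator R_pre)
    ultimately have "AE \<omega> in M. indicator R \<omega> = (0::real)"
      by (intro law_of_one_priceD[OF LOP sST _ \<theta>(1)])
    then show ?thesis by (rule prob_zero_of_AE_indicator[OF R])
  qed
  \<comment> \<open>Announcing times must stay strictly below their limit even where it is
    \<open>T\<close>, so they are capped by constants below \<open>T\<close>. The caps are late
    enough to interfere, where \<open>i k < T\<close>, with geometrically small probability
    only.\<close>
  have tail: "\<exists>y. x \<le> y \<and> y < T \<and> prob {\<omega>\<in>space M. y < i k \<omega> \<and> i k \<omega> < T} \<le> (1 / 2) ^ k"
    if x: "x < T" for k x
  proof -
    define u where "u n = max x (T - inverse (real (Suc n)))" for n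
    have "(\<lambda>n. u n) \<longlonglongrightarrow> max x (T - 0)"
      unfolding u_def by (intro tendsto_intros LIMSEQ_inverse_real_of_nat)
    then have u_lim: "u \<longlonglongrightarrow> T" using x by (simp add: max_def)
    have "(\<lambda>n. prob {\<omega>\<in>space M. u n < i k \<omega> \<and> i k \<omega> < T}) \<longlonglongrightarrow> prob (\<Inter>n. {\<omega>\<in>space M. u n < i k \<omega> \<and> i k \<omega> < T})"
    proof (rule finite_Lim_measure_decseq)
      have "u n \<le> u (Suc n)" for n unfolding u_def by (intro max.mono) (auto simp: field_simps)
      then show "decseq (\<lambda>n. {\<omega>\<in>space M. u n < i k \<omega> \<and> i k \<omega> < T})"
        by (intro decseq_SucI) (auto intro: le_less_trans)
    qed auto
    also have "(\<Inter>n. {\<omega>\<in>space M. u n < i k \<omega> \<and> i k \<omega> < T}) = {}"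
    proof (rule ccontr)
      assume "(\<Inter>n. {\<omega>\<in>space M. u n < i k \<omega> \<and> i k \<omega> < T}) \<noteq> {}"
      then obtain \<omega> where \<omega>: "\<And>n. u n < i k \<omega>" "i k \<omega> < T" by auto
      have "T \<le> i k \<omega>" by (rule LIMSEQ_le_const2[OF u_lim]) (use \<omega>(1) in \<open>auto intro: less_imp_le\<close>)
      with \<omega>(2) show False by simp
    qed
    finally have "(\<lambda>n. prob {\<omega>\<in>space M. u n < i k \<omega> \<and> i k \<omega> < T}) \<longlonglongrightarrow> 0" by simp
    then have "\<forall>\<^sub>F n in sequentially. prob {\<omega>\<in>space M. u n < i k \<omega> \<and> i k \<omega> < T} < (1 / 2) ^ k"
      by (rule order_tendstoD(2)) simp
    then obtain n where "prob {\<omega>\<in>space M. u n < i k \<omega> \<and> i k \<omega> < T} < (1 / 2) ^ k"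
      by (auto simp: eventually_sequentially)
    moreover have "x \<le> u n" "u n < T" using x by (auto simp: u_def)
    ultimately show ?thesis by (intro exI[of _ "u n"]) auto
  qed
  \<comment> \<open>Lower bounds that push the caps up to \<open>T\<close>, so that capping does not
    change the limit.\<close>
  define lb where "lb k = T * (1 - inverse (real (Suc k)))" for k
  have lb: "0 \<le> lb k" "lb k < T" for k using horizon_pos by (auto simp: lb_def field_simps)
  have "\<exists>t. \<forall>k. (lb k \<le> t k \<and> t k < T \<and> prob {\<omega>\<in>space M. t k < i k \<omega> \<and> i k \<omega> < T} \<le> (1 / 2) ^ k) \<and> t k \<le> t (Suc k)"
  proof (rule dependent_nat_choice)
    show "\<exists>x. lb 0 \<le> x \<and> x < T \<and> prob {\<omega>\<in>space M. x < i 0 \<omega> \<and> i 0 \<omega> < T} \<le> (1 / 2) ^ 0"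
      using tail[OF lb(2)[of 0], of 0] by blast
  next
    fix x k assume "lb k \<le> x \<and> x < T \<and> prob {\<omega>\<in>space M. x < i k \<omega> \<and> i k \<omega> < T} \<le> (1 / 2) ^ k"
    then have "max x (lb (Suc k)) < T" using lb(2) by simp
    from tail[OF this, of "Suc k"]
    show "\<exists>y. (lb (Suc k) \<le> y \<and> y < T \<and> prob {\<omega>\<in>space M. y < i (Suc k) \<omega> \<and> i (Suc k) \<omega> < T} \<le> (1 / 2) ^ Suc k) \<and> x \<le> y"
      by auto
  qed
  then obtain t where t: "\<And>k. lb k \<le> t k" "\<And>k. t k < T" "\<And>k. t k \<le> t (Suc k)"
    "\<And>k. prob {\<omega>\<in>space M. t k < i k \<omega> \<and> i k \<omega> < T} \<le> (1 / 2) ^ k" by blast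
  have t0: "0 \<le> t k" for k using lb(1) t(1) order_trans by blast
  have t_lim: "t \<longlonglongrightarrow> T"
  proof (rule tendsto_sandwich[OF always_eventually always_eventually _ tendsto_const])
    have "lb \<longlonglongrightarrow> T * (1 - 0)" unfolding lb_def by (intro tendsto_intros LIMSEQ_inverse_real_of_nat)
    then show "lb \<longlonglongrightarrow> T" by simp
  qed (use t in \<open>auto intro: less_imp_le\<close>)
  \<comment> \<open>The announcing conditions are required at every point, so \<open>R\<close> is
    not ignored but sent to \<open>T\<close>. It is null by the first step, and completeness puts it
    into the initial sigma-algebra, so the modified times are still stopping times.\<close>
  have R_F: "R \<in> sets (F u)" if "0 \<le> u" for u
  proof -
    have "R \<in> null_sets M" using R0 R by (intro null_setsI) (simp_all add: emeasure_eq_measure)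
    then have "R \<in> sets (F 0)" by (rule complete) simp
    then show ?thesis using sets_F_mono[OF that] by auto
  qed
  have send_R: "(\<lambda>\<omega>. if \<omega> \<in> R then T else c \<omega>) \<in> ST" if c: "c \<in> ST" for c
  proof (rule ST_I)
    show "0 \<le> (if \<omega> \<in> R then T else c \<omega>) \<and> (if \<omega> \<in> R then T else c \<omega>) \<le> T" if "\<omega> \<in> space M" for \<omega>
      using STD(2,3)[OF c that] horizon_pos by auto
    fix u assume u: "0 \<le> u" "u < T"
    have "{\<omega>\<in>space M. (if \<omega> \<in> R then T else c \<omega>) \<le> u} = {\<omega>\<in>space M. c \<omega> \<le> u} - R" using u by auto
    also have "\<dots> \<in> sets (F u)" by (intro sets.Diff ST_le_sets c R_F u)
    finally show "{\<omega>\<in>space M. (if \<omega> \<in> R then T else c \<omega>) \<le> u} \<in> sets (F u)" .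
  qed
  define \<rho> where "\<rho> k \<omega> = (if \<omega> \<in> R then T else i k \<omega>)" for k \<omega>
  define r where "r k \<omega> = min (\<rho> k \<omega>) (t k)" for k \<omega>
  define \<tau> where "\<tau> \<omega> = (if \<omega> \<in> R then T else s \<omega>)" for \<omega>
  have \<rho>ST: "\<rho> k \<in> ST" for k unfolding \<rho>_def[abs_def] by (rule send_R[OF iST])
  have \<tau>ST: "\<tau> \<in> ST" unfolding \<tau>_def[abs_def] by (rule send_R[OF sST])
  have rST: "r k \<in> ST" for k
    unfolding r_def[abs_def] using t0 t(2) by (intro ST_min \<rho>ST ST_const) (auto intro: less_imp_le)
  have ann: "announcing_sequence M F T \<tau> r"
    unfolding announcing_sequence_def
  proof (intro conjI allI ballI impI rST)
    fix \<omega> assume \<omega>: "\<omega> \<in> space M"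
    show "r n \<omega> \<le> r (Suc n) \<omega>" for n
      using t(3)[of n] i_mono[OF \<omega>, of n "Suc n"] unfolding r_def \<rho>_def by (intro min.mono) auto
    have "(\<lambda>n. r n \<omega>) \<longlonglongrightarrow> min (\<tau> \<omega>) T"
      unfolding r_def
    proof (intro tendsto_min t_lim)
      show "(\<lambda>n. \<rho> n \<omega>) \<longlonglongrightarrow> \<tau> \<omega>" using i_lim[OF \<omega>] by (simp add: \<rho>_def \<tau>_def)
    qed
    then show "(\<lambda>n. r n \<omega>) \<longlonglongrightarrow> \<tau> \<omega>" using STD(3)[OF \<tau>ST \<omega>] by (simp add: min_absorb1)
    show "r n \<omega> < \<tau> \<omega>" for n
    \<comment> \<open>Off \<open>R\<close> with \<open>s < T\<close>, no \<open>i n\<close> equals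
      \<open>s\<close> by the choice of \<open>R\<close>. In all other cases \<tau> is
      \<open>T\<close> and the cap is strictly below it.\<close>
    proof (cases "\<omega> \<notin> R \<and> s \<omega> < T")
      case True
      then have "i n \<omega> \<noteq> s \<omega>" using \<omega> by (auto simp: R_def)
      then have "i n \<omega> < s \<omega>" using i_le_s[OF \<omega>, of n] by simp
      then show ?thesis using True by (simp add: r_def \<rho>_def \<tau>_def)
    next
      case False
      then have "\<tau> \<omega> = T" using STD(3)[OF sST \<omega>] by (auto simp: \<tau>_def)
      then show ?thesis using t(2)[of n] by (simp add: r_def)
    qed
  qed
  \<comment> \<open>The event, known at \<open>r k\<close>, that the cap does not cut
    \<open>\<rho> k\<close>; there \<open>r k = i k < T\<close>. Its indicator serves as the initial
    capital at \<open>r k\<close>.\<close>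
  define C where "C k = {\<omega>\<in>space M. \<rho> k \<omega> \<le> r k \<omega>}" for k
  have C_pre: "C k \<in> sets (pre_sigma (r k))" for k
    unfolding C_def by (rule pre_sigma_le_Int[OF \<rho>ST rST pre_sigma_space])
  have C[measurable]: "C k \<in> sets M" for k by (rule sets_pre_sigma_subset[OF rST C_pre])
  have C_D: "\<omega> \<in> space M" "\<omega> \<notin> R" "i k \<omega> \<le> t k" "r k \<omega> = i k \<omega>" if "\<omega> \<in> C k" for k \<omega>
    using that t(2)[of k] by (auto simp: C_def r_def \<rho>_def split: if_splits)
  have C_U: "C k \<subseteq> U k" for k
    using C_D(1,3)[of _ k] t(2)[of k] by (auto simp: U_def intro: le_less_trans)
  define B where "B k = {\<omega>\<in>C k. r k \<omega> \<le> \<sigma> k \<omega>} \<inter> A' k" for k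
  have B_pre: "B k \<in> sets (pre_sigma (\<sigma> k))" for k
    unfolding B_def by (intro sets.Int pre_sigma_le_Int[OF rST \<sigma> C_pre] A'_pre)
  have B: "B k \<in> sets M" for k by (rule sets_pre_sigma_subset[OF \<sigma> B_pre])
  have gB: "gain_from (r k) (\<lambda>\<omega>. indicator (B k) \<omega> * g k \<omega>)" for k
    by (rule gain_from_restrict[OF \<sigma> g B_pre]) (auto simp: B_def)
  have "\<exists>\<theta>. \<theta> \<in> simple_strategies M F T S \<and>
      (\<forall>\<omega>\<in>space M. gains (start_after (r k) T \<theta>) S T \<omega> = indicator (B k) \<omega> * g k \<omega>)" for k
    using gain_from_simple_strategy[OF gB[of k]] by metis
  then obtain \<theta> where \<theta>: "\<And>k. \<theta> k \<in> simple_strategies M F T S"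
    "\<And>k \<omega>. \<omega> \<in> space M \<Longrightarrow> gains (start_after (r k) T (\<theta> k)) S T \<omega> = indicator (B k) \<omega> * g k \<omega>" by metis
  have CB_lim: "(\<lambda>k. prob (C k - B k)) \<longlonglongrightarrow> 0"
  proof (rule tendsto_sandwich[OF _ always_eventually tendsto_const])
    show "(\<lambda>k. 3 * (1 / 2 :: real) ^ k) \<longlonglongrightarrow> 0" by (rule half)
    show "\<forall>k. prob (C k - B k) \<le> 3 * (1 / 2) ^ k"
    proof
      fix k
      have "C k - B k \<subseteq> (U k - A) \<union> (A - A' k)"
      proof
        fix \<omega> assume \<omega>: "\<omega> \<in> C k - B k"
        then show "\<omega> \<in> (U k - A) \<union> (A - A' k)"
          using C_D(1,4)[of \<omega> k] C_U[of k] i_le[of \<omega> k k] by (auto simp: B_def)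
      qed
      then have "prob (C k - B k) \<le> prob ((U k - A) \<union> (A - A' k))" by (intro finite_measure_mono) auto
      also have "\<dots> \<le> prob (U k - A) + prob (A - A' k)" by (intro measure_Un_le) auto
      finally show "prob (C k - B k) \<le> 3 * (1 / 2) ^ k" using UA[of k] A2'[of k] by simp
    qed
  qed auto
  have "L2_tendsto M (\<lambda>k \<omega>. indicator (C k) \<omega> + indicator (B k) \<omega> * g k \<omega>) (\<lambda>\<omega>. 0)"
    by (rule L2_indicator_split[where A'=A', OF g A' B _ _ C])
      (use Y CB_lim in \<open>auto simp: B_def A'_def\<close>)
  then have lim: "L2_tendsto M (\<lambda>k \<omega>. indicator (C k) \<omega> + gains (start_after (r k) T (\<theta> k)) S T \<omega>) (\<lambda>\<omega>. 0)"
    by (rule L2_tendsto_cong) (simp add: \<theta>(2))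
  have C_lim: "tendsto_in_probability M (\<lambda>k. indicator (C k)) (indicator A)"
    unfolding tendsto_in_probability_def
  proof (intro conjI allI impI)
    fix \<epsilon> :: real assume \<epsilon>: "0 < \<epsilon>"
    show "(\<lambda>k. prob {\<omega>\<in>space M. \<epsilon> < \<bar>indicator (C k) \<omega> - indicator A \<omega>\<bar>}) \<longlonglongrightarrow> 0"
    proof (rule tendsto_sandwich[OF _ always_eventually tendsto_const])
      show "(\<lambda>k. 4 * (1 / 2 :: real) ^ k) \<longlonglongrightarrow> 0" by (rule half)
      show "\<forall>k. prob {\<omega>\<in>space M. \<epsilon> < \<bar>indicator (C k) \<omega> - indicator A \<omega> :: real\<bar>} \<le> 4 * (1 / 2) ^ k"
      proof
        fix k
        let ?E = "{\<omega>\<in>space M. t k < i k \<omega> \<and> i k \<omega> < T}"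
        \<comment> \<open>A point of \<open>C k\<close> outside \<open>A\<close> is in
          \<open>U k - A\<close>. A point of \<open>A\<close> outside \<open>C k\<close> is in
          \<open>R\<close> or has \<open>i k\<close> above the cap; in the latter case either
          \<open>i k < T\<close>, or \<open>i k = T\<close> and the point misses
          \<open>A' k\<close>. The bounds 2, 1, 1 and 0 add up to 4.\<close>
        have "{\<omega>\<in>space M. \<epsilon> < \<bar>indicator (C k) \<omega> - indicator A \<omega> :: real\<bar>} \<subseteq>
            (U k - A) \<union> (A - A' k) \<union> (?E \<union> R)"
        proof
          fix \<omega> assume "\<omega> \<in> {\<omega>\<in>space M. \<epsilon> < \<bar>indicator (C k) \<omega> - indicator A \<omega> :: real\<bar>}"
          then have \<omega>: "\<omega> \<in> space M" "(\<omega> \<in> C k \<and> \<omega> \<notin> A) \<or> (\<omega> \<notin> C k \<and> \<omega> \<in> A)"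
            using \<epsilon> by (cases "\<omega> \<in> C k"; cases "\<omega> \<in> A"; simp)+
          show "\<omega> \<in> (U k - A) \<union> (A - A' k) \<union> (?E \<union> R)"
          proof (cases "\<omega> \<in> C k")
            case True
            then show ?thesis using \<omega>(2) C_U[of k] by auto
          next
            case False
            then have "\<omega> \<in> R \<or> t k < i k \<omega>" 
              using \<omega>(1) by (cases "\<omega> \<in> R") (auto simp: C_def r_def \<rho>_def)
            then show ?thesis using \<omega> False A'U[of k] by (auto simp: U_def)
          qed
        qed
        then have "prob {\<omega>\<in>space M. \<epsilon> < \<bar>indicator (C k) \<omega> - indicator A \<omega> :: real\<bar>} \<le>
            prob ((U k - A) \<union> (A - A' k) \<union> (?E \<union> R))" by (intro finite_measure_mono) auto
        also have "\<dots> \<le> (prob (U k - A) + prob (A - A' k)) + (prob ?E + prob R)"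
          by (intro order_trans[OF measure_Un_le] add_mono measure_Un_le) auto
        finally show "prob {\<omega>\<in>space M. \<epsilon> < \<bar>indicator (C k) \<omega> - indicator A \<omega> :: real\<bar>} \<le> 4 * (1 / 2) ^ k"
          using UA[of k] A2'[of k] t(4)[of k] R0 by simp
      qed
    qed auto
  qed auto
  have "AE \<omega> in M. indicator A \<omega> = (0::real)"
    by (rule law_of_one_price_predictableD[OF LOP \<tau>ST ann _ \<theta>(1) lim C_lim])
      (intro borel_measurable_indicator C_pre)
  then show ?thesis by (rule prob_zero_of_AE_indicator[OF A])
qed

text \<open>Otherwise unit capital at time 0 together with the gains \<open>- h n\<close> would be
  worth nothing in the limit.\<close>

lemma law_of_one_price_not_unit_approximable:
  assumes "law_of_one_price M F T S" shows "\<not> unit_approximable"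
proof
  assume unit_approximable
  then obtain h where h: "\<And>n. gain_from (\<lambda>\<omega>. 0) (h n)" "L2_tendsto M h (\<lambda>\<omega>. 1)"
    by (auto simp: unit_approximable_def)
  have "\<exists>\<theta>. \<theta> \<in> simple_strategies M F T S \<and>
      (\<forall>\<omega>\<in>space M. gains (start_after (\<lambda>\<omega>. 0) T \<theta>) S T \<omega> = - 1 * h n \<omega>)" for n
    using gain_from_simple_strategy[OF gain_from_cmult[OF h(1)[of n], of "- 1"]] by metis
  then obtain \<theta> where \<theta>: "\<And>n. \<theta> n \<in> simple_strategies M F T S"
    "\<And>n \<omega>. \<omega> \<in> space M \<Longrightarrow> gains (start_after (\<lambda>\<omega>. 0) T (\<theta> n)) S T \<omega> = - 1 * h n \<omega>" by metis
  have "L2_tendsto M (\<lambda>n \<omega>. 1 + - 1 * h n \<omega>) (\<lambda>\<omega>. 0)"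
    using h(2) L2_norm_minus_commute[of M _ "\<lambda>\<omega>. 1"]
    by (auto simp: L2_tendsto_def intro!: L2_zero_fun L2_diff L2_const)
  then have "L2_tendsto M (\<lambda>n \<omega>. 1 + gains (start_after (\<lambda>\<omega>. 0) T (\<theta> n)) S T \<omega>) (\<lambda>\<omega>. 0)"
    by (rule L2_tendsto_cong) (simp add: \<theta>(2))
  moreover have "(\<lambda>\<omega>. 0) \<in> ST" using horizon_pos by (intro ST_const) auto
  moreover have "(\<lambda>\<omega>. 1) \<in> borel_measurable (pre_sigma (\<lambda>\<omega>. 0))" by simp
  ultimately have "AE \<omega> in M. (1::real) = 0"
    by (intro law_of_one_priceD[OF assms _ _ \<theta>(1)])
  then show False by simp
qed

section \<open>Absence of arbitrage on the closure, and the closing of the circle\<close>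

lemma gain_limit_in_closure:
  assumes h: "\<And>n. gain_from (\<lambda>\<omega>. 0) (h n)" and lim: "L2_tendsto M h f"
  shows "f \<in> L2_closure M (terminal_gains M F T S)"
proof -
  have "\<exists>\<theta>. \<theta> \<in> simple_strategies M F T S \<and> (\<forall>\<omega>\<in>space M. gains \<theta> S T \<omega> = h n \<omega>)" for n
    using gain_from_simple_strategy[OF h[of n]] by metis
  then obtain \<theta> where \<theta>: "\<And>n. \<theta> n \<in> simple_strategies M F T S"
    "\<And>n \<omega>. \<omega> \<in> space M \<Longrightarrow> gains (\<theta> n) S T \<omega> = h n \<omega>" by metis
  have "L2_tendsto M (\<lambda>n. gains (\<theta> n) S T) f"
    by (rule L2_tendsto_cong[OF lim]) (simp add: \<theta>(2))
  then show ?thesis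
    by (rule L2_closure_memI) (use \<theta>(1) in \<open>auto simp: terminal_gains_def\<close>)
qed

lemma no_closure_arbitrage_indicator:
  assumes "no_L2_closure_arbitrage M F T S" and h: "\<And>n. gain_from (\<lambda>\<omega>. 0) (h n)"
    and A: "A \<in> sets M" and lim: "L2_tendsto M h (indicator A)"
  shows "prob A = 0"
proof -
  have "indicator A \<in> L2_plus M" using L2_indicator[OF A] by (simp add: L2_plus_def)
  with gain_limit_in_closure[OF h lim] have "indicator A \<in> L2_zero M"
    using assms(1) unfolding no_L2_closure_arbitrage_def by blast
  then show ?thesis by (intro prob_zero_of_AE_indicator[OF A]) (simp add: L2_zero_def)
qed

lemma no_closure_arbitrage_not_unit_approximable:
  assumes "no_L2_closure_arbitrage M F T S" shows "\<not> unit_approximable"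
proof
  assume unit_approximable
  then obtain h where h: "\<And>n. gain_from (\<lambda>\<omega>. 0) (h n)" "L2_tendsto M h (\<lambda>\<omega>. 1)"
    by (auto simp: unit_approximable_def)
  have "L2_tendsto M h (indicator (space M))"
    using h(2) by (auto simp: L2_tendsto_def L2_cong[of M "indicator (space M)" "\<lambda>\<omega>. 1"]
      L2_norm_cong[of M "\<lambda>\<omega>. h _ \<omega> - indicator (space M) \<omega>" "\<lambda>\<omega>. h _ \<omega> - 1"])
  from no_closure_arbitrage_indicator[OF assms h(1) _ this] show False by (simp add: prob_space)
qed

text \<open>Each of the two conditions alone makes the zero set of the minimal element null; both
  arguments exploit the same hitting times.\<close>

lemma variance_optimal_positive:
  assumes "law_of_one_price M F T S \<or> no_L2_closure_arbitrage M F T S"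
  shows "\<exists>Q Z. variance_optimal_lmm M F T S Q Z \<and> (AE \<omega> in M. 0 < Z \<omega>)"
proof -
  have "\<not> unit_approximable"
    using assms law_of_one_price_not_unit_approximable no_closure_arbitrage_not_unit_approximable by blast
  then obtain X h where X: "orthogonal_density X" "AE \<omega> in M. 0 \<le> X \<omega>" "0 < (\<integral>\<omega>. (X \<omega>)\<^sup>2 \<partial>M)"
    and h: "\<And>n. gain_from (\<lambda>\<omega>. 0) (h n)" "L2_tendsto M (\<lambda>n \<omega>. 1 + h n \<omega>) X"
    using minimal_element by blast
  have [measurable]: "X \<in> borel_measurable M" using X(1) by (auto simp: orthogonal_density_def L2_measurable)
  define A where "A = {\<omega>\<in>space M. X \<omega> = 0}"
  have A: "A \<in> sets M" unfolding A_def by measurable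
  obtain \<sigma> g where \<sigma>g: "\<forall>k. \<sigma> k \<in> ST \<and> gain_from (\<sigma> k) (g k)"
    and Y: "(\<lambda>k. L2_norm M (\<lambda>\<omega>. indicator {\<omega>\<in>space M. \<sigma> k \<omega> < T} \<omega> * (1 + g k \<omega>))) \<longlonglongrightarrow> 0"
    and A1: "(\<lambda>k. prob ({\<omega>\<in>space M. \<sigma> k \<omega> < T} - A)) \<longlonglongrightarrow> 0"
    and A2: "(\<lambda>k. prob (A - {\<omega>\<in>space M. \<sigma> k \<omega> < T})) \<longlonglongrightarrow> 0"
    using zero_set_sequence[OF X(1) h, folded A_def]
    by (elim exE conjE) (rule that, assumption+)
  have \<sigma>: "\<sigma> k \<in> ST" and g: "gain_from (\<sigma> k) (g k)" for k using \<sigma>g by auto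
  note [measurable] = STD(4)[OF \<sigma>] A
  have "prob A = 0" using assms
  proof
    assume LOP: "law_of_one_price M F T S"
    \<comment> \<open>A subsequence with geometric rates, as the union bound over later times
      requires.\<close>
    have ex: "\<forall>k. \<exists>m. L2_norm M (\<lambda>\<omega>. indicator {\<omega>\<in>space M. \<sigma> m \<omega> < T} \<omega> * (1 + g m \<omega>)) < (1 / 2) ^ k \<and>
        prob ({\<omega>\<in>space M. \<sigma> m \<omega> < T} - A) < (1 / 2) ^ k \<and>
        prob (A - {\<omega>\<in>space M. \<sigma> m \<omega> < T}) < (1 / 2) ^ k"
    proof
      fix k :: nat
      have "0 < (1 / 2 :: real) ^ k" by simp
      from eventually_conj[OF order_tendstoD(2)[OF Y this]
          eventually_conj[OF order_tendstoD(2)[OF A1 this] order_tendstoD(2)[OF A2 this]]]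
      show "\<exists>m. L2_norm M (\<lambda>\<omega>. indicator {\<omega>\<in>space M. \<sigma> m \<omega> < T} \<omega> * (1 + g m \<omega>)) < (1 / 2) ^ k \<and>
          prob ({\<omega>\<in>space M. \<sigma> m \<omega> < T} - A) < (1 / 2) ^ k \<and>
          prob (A - {\<omega>\<in>space M. \<sigma> m \<omega> < T}) < (1 / 2) ^ k"
        by (rule eventually_happens'[OF sequentially_bot])
    qed
    from choice[OF ex] obtain m where
      "\<forall>k. L2_norm M (\<lambda>\<omega>. indicator {\<omega>\<in>space M. \<sigma> (m k) \<omega> < T} \<omega> * (1 + g (m k) \<omega>)) < (1 / 2) ^ k \<and>
        prob ({\<omega>\<in>space M. \<sigma> (m k) \<omega> < T} - A) < (1 / 2) ^ k \<and>
        prob (A - {\<omega>\<in>space M. \<sigma> (m k) \<omega> < T}) < (1 / 2) ^ k"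
      by (elim exE) (rule that)
    note m = this[rule_format, THEN conjunct1] this[rule_format, THEN conjunct2, THEN conjunct1]
      this[rule_format, THEN conjunct2, THEN conjunct2]
    show "prob A = 0"
    proof (rule law_of_one_price_null[OF LOP, of "\<lambda>k. \<sigma> (m k)" "\<lambda>k. g (m k)"])
      show "(\<lambda>k. L2_norm M (\<lambda>\<omega>. indicator {\<omega>\<in>space M. \<sigma> (m k) \<omega> < T} \<omega> * (1 + g (m k) \<omega>))) \<longlonglongrightarrow> 0"
        by (rule tendsto_sandwich[OF always_eventually always_eventually tendsto_const LIMSEQ_power_zero[of "1 / 2"]])
          (use m(1) in \<open>auto simp: L2_norm_nonneg intro: less_imp_le\<close>)
    qed (use \<sigma> g A m in \<open>auto intro: less_imp_le\<close>)
  next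
    assume NA: "no_L2_closure_arbitrage M F T S"
    define A' where "A' k = {\<omega>\<in>space M. \<sigma> k \<omega> < T}" for k
    have A': "A' k \<in> sets M" for k unfolding A'_def by measurable
    have A'_pre: "A' k \<in> sets (pre_sigma (\<sigma> k))" for k
      unfolding A'_def by (rule pre_sigma_less[OF \<sigma> ST_horizon])
    have gA: "gain_from (\<lambda>\<omega>. 0) (\<lambda>\<omega>. indicator (A' k) \<omega> * g k \<omega>)" for k
      by (rule gain_from_restrict[OF \<sigma> g A'_pre]) (auto simp: A'_def intro: STD(2)[OF \<sigma>])
    \<comment> \<open>The opposite position: where \<open>\<sigma> k < T\<close>,
      \<open>1 + g k\<close> is nearly 0, so \<open>- g k\<close> earns nearly 1 from no capital. In
      the limit this is the claim paying 1 on \<open>A\<close>.\<close>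
    have gA': "gain_from (\<lambda>\<omega>. 0) (\<lambda>\<omega>. - 1 * (indicator (A' k) \<omega> * g k \<omega>))" for k
      by (rule gain_from_cmult[OF gA])
    have L: "(\<lambda>\<omega>. indicator (A' k) \<omega> * (1 + g k \<omega>)) \<in> L2 M" for k
      by (intro L2_indicator_mult L2_add L2_const gain_from_L2[OF g] A')
    show "prob A = 0"
    proof (rule no_closure_arbitrage_indicator[OF NA gA' A], rule L2_tendsto_I)
      show "(\<lambda>\<omega>. - 1 * (indicator (A' k) \<omega> * g k \<omega>)) \<in> L2 M" for k by (rule gain_from_L2[OF gA'])
      show "indicator A \<in> L2 M" by (rule L2_indicator[OF A])
      show "(\<lambda>k. L2_norm M (\<lambda>\<omega>. - 1 * (indicator (A' k) \<omega> * g k \<omega>) - indicator A \<omega>)) \<longlonglongrightarrow> 0"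
      proof (rule tendsto_sandwich[OF always_eventually always_eventually tendsto_const])
        show "\<forall>k. L2_norm M (\<lambda>\<omega>. - 1 * (indicator (A' k) \<omega> * g k \<omega>) - indicator A \<omega>) \<le>
            L2_norm M (\<lambda>\<omega>. indicator (A' k) \<omega> * (1 + g k \<omega>)) +
            (L2_norm M (indicator (A' k - A)) + L2_norm M (indicator (A - A' k)))"
        proof
          fix k
          have L1: "indicator (A' k - A) \<in> L2 M" "indicator (A - A' k) \<in> L2 M"
            using A A' by (auto intro!: L2_indicator)
          \<comment> \<open>The indicator of \<open>A\<close> differs from that of
            \<open>A' k\<close> by the two set differences, so the error is minus the terminal value
            of unit capital plus indicators of events of small probability.\<close>
          have "L2_norm M (\<lambda>\<omega>. - 1 * (indicator (A' k) \<omega> * g k \<omega>) - indicator A \<omega>) =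
              L2_norm M (\<lambda>\<omega>. - 1 * (indicator (A' k) \<omega> * (1 + g k \<omega>)) +
                (indicator (A' k - A) \<omega> + - 1 * indicator (A - A' k) \<omega>))"
            by (intro L2_norm_cong) (auto simp: indicator_def)
          also have "\<dots> \<le> L2_norm M (\<lambda>\<omega>. - 1 * (indicator (A' k) \<omega> * (1 + g k \<omega>))) +
              L2_norm M (\<lambda>\<omega>. indicator (A' k - A) \<omega> + - 1 * indicator (A - A' k) \<omega>)"
            by (intro L2_norm_triangle L2_add L2_cmult L L1)
          also have "\<dots> \<le> L2_norm M (\<lambda>\<omega>. - 1 * (indicator (A' k) \<omega> * (1 + g k \<omega>))) +
              (L2_norm M (indicator (A' k - A)) + L2_norm M (\<lambda>\<omega>. - 1 * indicator (A - A' k) \<omega>))"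
            by (intro add_left_mono L2_norm_triangle L2_cmult L1)
          finally show "L2_norm M (\<lambda>\<omega>. - 1 * (indicator (A' k) \<omega> * g k \<omega>) - indicator A \<omega>) \<le>
              L2_norm M (\<lambda>\<omega>. indicator (A' k) \<omega> * (1 + g k \<omega>)) +
              (L2_norm M (indicator (A' k - A)) + L2_norm M (indicator (A - A' k)))"
            unfolding L2_norm_cmult by simp
        qed
        have "(\<lambda>k. sqrt (prob (A' k - A))) \<longlonglongrightarrow> sqrt 0" "(\<lambda>k. sqrt (prob (A - A' k))) \<longlonglongrightarrow> sqrt 0"
          using A1 A2 by (auto simp: A'_def intro!: tendsto_real_sqrt simp del: real_sqrt_zero)
        moreover have "L2_norm M (indicator (A' k - A)) = sqrt (prob (A' k - A))"
          "L2_norm M (indicator (A - A' k)) = sqrt (prob (A - A' k))" for k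
          using A A' by (auto intro!: L2_norm_indicator)
        ultimately show "(\<lambda>k. L2_norm M (\<lambda>\<omega>. indicator (A' k) \<omega> * (1 + g k \<omega>)) +
            (L2_norm M (indicator (A' k - A)) + L2_norm M (indicator (A - A' k)))) \<longlonglongrightarrow> 0"
          using Y by (auto simp: A'_def intro!: tendsto_add_zero)
      qed (simp add: L2_norm_nonneg)
    qed
  qed
  then have "AE \<omega> in M. \<omega> \<notin> A"
    using A by (intro AE_not_in null_setsI) (simp_all add: emeasure_eq_measure)
  then have "AE \<omega> in M. 0 < X \<omega> / (\<integral>\<omega>. (X \<omega>)\<^sup>2 \<partial>M)"
    using X(2) AE_space by eventually_elim (use X(3) in \<open>auto simp: A_def less_le\<close>)
  then show ?thesis using minimal_element_variance_optimal[OF X(1,3) h] by blast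
qed

lemma variance_optimal_pricing_density:
  assumes "variance_optimal_lmm M F T S Q Z" "AE \<omega> in M. 0 < Z \<omega>"
  shows "pricing_density Z"
  using assms signed_lmmD(1) by (auto simp: variance_optimal_lmm_def pricing_density_def)

end

theorem proposition3p4:
  fixes M :: "'a measure" and F :: "real \<Rightarrow> 'a measure" and T :: real
    and S :: "real \<Rightarrow> 'a \<Rightarrow> real ^ 'd"
  assumes "usual_filtered_prob_space M F T"
    and "semimartingale M F T S"
    and "continuous_paths M T S"
    and "locally_square_integrable M F T S"
  shows "(law_of_one_price M F T S \<longleftrightarrow> (\<exists>Q. equivalent_lmm M F T S Q)) \<and>
    (law_of_one_price M F T S \<longleftrightarrow>
       (\<exists>Q Z. variance_optimal_lmm M F T S Q Z \<and> (AE \<omega> in M. 0 < Z \<omega>))) \<and>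
    (law_of_one_price M F T S \<longleftrightarrow> no_L2_free_lunch M F T S) \<and>
    (law_of_one_price M F T S \<longleftrightarrow> no_L2_closure_arbitrage M F T S)"
proof -
  interpret usual_filtered_prob_space M F T by (rule assms(1))
  interpret continuous_market M F T S
  proof unfold_locales
    show "S t \<in> borel_measurable (F t)" if t: "0 \<le> t" "t \<le> T" for t
    proof -
      \<comment> \<open>Adaptedness of \<open>S\<close> comes from its decomposition: all three
        summands are known at \<open>t\<close>.\<close>
      obtain N A where S0: "S 0 \<in> borel_measurable (F 0)"
        and N: "local_martingale M F T N" and A: "adapted F T A"
        and S_eq: "\<forall>\<omega>\<in>space M. N 0 \<omega> = 0 \<and> A 0 \<omega> = 0 \<and> (\<forall>t\<in>{0..T}. S t \<omega> = S 0 \<omega> + N t \<omega> + A t \<omega>)"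
        using assms(2) unfolding semimartingale_def by blast
      have NA: "N t \<in> borel_measurable (F t)" "A t \<in> borel_measurable (F t)"
          "\<forall>\<omega>\<in>space M. S t \<omega> = S 0 \<omega> + N t \<omega> + A t \<omega>"
      proof -
        have t': "t \<in> {0..T}" using t by simp
        show "N t \<in> borel_measurable (F t)" using N t' unfolding local_martingale_def adapted_def by blast
        show "A t \<in> borel_measurable (F t)" using A t' unfolding adapted_def by blast
        show "\<forall>\<omega>\<in>space M. S t \<omega> = S 0 \<omega> + N t \<omega> + A t \<omega>" using S_eq t' by blast
      qed
      have "S 0 \<in> borel_measurable (F t)"
        by (rule measurable_from_subalg[OF _ S0]) (use sets_F_mono[OF t(1)] in \<open>simp add: subalgebra_def space_F\<close>)
      then have "(\<lambda>\<omega>. S 0 \<omega> + N t \<omega> + A t \<omega>) \<in> borel_measurable (F t)"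
        using NA(1,2) by (intro borel_measurable_add)
      then show ?thesis by (rule measurable_cong[THEN iffD1, rotated]) (simp add: NA(3) space_F)
    qed
  qed (use assms in \<open>auto simp: continuous_paths_def\<close>)
  \<comment> \<open>(i) or (v) yields (iii), which provides a pricing density; from it follow (i),
    (ii) and (iv), and (iv) gives (v). A measure as in (ii) leads back to a pricing density.\<close>
  show ?thesis
    using variance_optimal_positive variance_optimal_pricing_density pricing_density_equivalent_lmm
      equivalent_lmm_pricing_density pricing_density_law_of_one_price pricing_density_no_free_lunch
      no_free_lunch_no_closure_arbitrage by meson
qed

end
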